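(* Let $L>0$ and $a>0$. The reduced perfect-conductor Maxwell operator $\mathcal L_{\mathrm{Mx}}$ on $\mathcal H_{\mathrm{phys}}$ is unitarily equivalent to $L_{\mathrm D}\oplus L_{\mathrm N}'$: there is a unitary operator $\mathcal U:L^2(\Omega_{L,a})\oplus\mathcal H_{\mathrm N}'\to\mathcal H_{\mathrm{phys}}$ such that $$\mathcal L_{\mathrm{Mx}}\,\mathcal U=\mathcal U\,(L_{\mathrm D}\oplus L_{\mathrm N}')\quad\text{on the operator domain of }L_{\mathrm D}\oplus L_{\mathrm N}'.$$
   Context: Slab and spaces. $T_L^2=(\mathbb R/L\mathbb Z)^2$, $\Omega_{L,a}=T_L^2\times[0,a]$ with coordinates $(r,z)$, $r=(x,y)$; there are boundary faces only at the plates $z=0$ and $z=a$. All function spaces are complex. $H(\operatorname{curl})=\{E\in L^2(\Omega_{L,a};\mathbb C^3):\nabla\times E\in L^2\}$ with norm$^2$ $\|E\|_{L^2}^2+\|\nabla\times E\|_{L^2}^2$. $H_0(\operatorname{curl})$ is the closure in this norm of the smooth (up to the plates), laterally periodic vector fields with $E_x=E_y=0$ at $z=0,a$. Put $\mathcal V_{\mathrm{PEC}}=\{E\in H_0(\operatorname{curl}):\nabla\cdot E=0$ in distributions on $T_L^2\times(0,a)\}$, $\mathcal H_{\mathrm{PEC}}=$ the $L^2$-closure of $\mathcal V_{\mathrm{PEC}}$, $h_0=(L^2a)^{-1/2}e_z$, $\mathcal H_{\mathrm{phys}}=\mathcal H_{\mathrm{PEC}}\ominus\operatorname{span}\{h_0\}$,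 $\mathcal V_{\mathrm{phys}}=\mathcal V_{\mathrm{PEC}}\cap\mathcal H_{\mathrm{phys}}$. $\mathcal L_{\mathrm{Mx}}$ is the nonnegative self-adjoint operator on $\mathcal H_{\mathrm{phys}}$ associated with the closed densely defined form $q_{\mathrm{Mx}}[E,F]=\int_{\Omega_{L,a}}(\nabla\times E)\cdot\overline{(\nabla\times F)}\,dx$, $E,F\in\mathcal V_{\mathrm{phys}}$. Scalar operators on $L^2(\Omega_{L,a})$, with periodic lateral conditions: $L_{\mathrm D}$ is the positive Laplacian $-\Delta$ with Dirichlet conditions at $z=0,a$; $L_{\mathrm N}$ is the positive Laplacian with Neumann conditions at $z=0,a$. $\mathcal H_{\mathrm N}'\subset L^2(\Omega_{L,a})$ is the orthogonal complement of the constant functions, and $L_{\mathrm N}'$ is the restriction of $L_{\mathrm N}$ to $\mathcal H_{\mathrm N}'$. *)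

theory Defs
  imports "HOL-Analysis.Analysis"
begin

text \<open>
  A function on the slab \<open>T_L^2 \<times> [0,a]\<close> is represented by a function of \<open>(x, y, z)\<close>.  Elements of
  \<open>L^2\<close> are functions regarded up to equality almost everywhere on the fundamental cell
  \<open>[0,L) \<times> [0,L) \<times> [0,a]\<close>; values off the cell are irrelevant.  Lateral periodicity is imposed on
  the smooth functions and the test functions, so that weak derivatives are taken on the torus.
  All sets of \<open>L^2\<close> functions below are saturated with respect to almost-everywhere equality of
  measurable functions.
\<close>

type_synonym pt = "real \<times> real \<times> real"
type_synonym sfield = "pt \<Rightarrow> complex"
type_synonym vfield = "pt \<Rightarrow> complex ^ 3"

definition slab :: "real \<Rightarrow> real \<Rightarrow> pt measure" where
  "slab L a = restrict_space lborel ({0..<L} \<times> {0..<L} \<times> {0..a})"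

definition L2 :: "real \<Rightarrow> real \<Rightarrow> (pt \<Rightarrow> 'b::euclidean_space) set" where
  "L2 L a = {f \<in> borel_measurable (slab L a). integrable (slab L a) (\<lambda>p. (norm (f p))\<^sup>2)}"

definition L2_norm :: "real \<Rightarrow> real \<Rightarrow> (pt \<Rightarrow> 'b::euclidean_space) \<Rightarrow> real" where
  "L2_norm L a f = sqrt (\<integral>p. (norm (f p))\<^sup>2 \<partial>slab L a)"

definition s_inner :: "real \<Rightarrow> real \<Rightarrow> sfield \<Rightarrow> sfield \<Rightarrow> complex" where
  "s_inner L a u v = (\<integral>p. u p * cnj (v p) \<partial>slab L a)"

definition v_inner :: "real \<Rightarrow> real \<Rightarrow> vfield \<Rightarrow> vfield \<Rightarrow> complex" where
  "v_inner L a E F = (\<integral>p. (\<Sum>i\<in>UNIV. E p $ i * cnj (F p $ i)) \<partial>slab L a)"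

definition norm_closure ::
  "((pt \<Rightarrow> 'b::euclidean_space) \<Rightarrow> real) \<Rightarrow> (pt \<Rightarrow> 'b) set \<Rightarrow> (pt \<Rightarrow> 'b) set \<Rightarrow> (pt \<Rightarrow> 'b) set" where
  "norm_closure N X A = {f \<in> X. \<forall>e>0. \<exists>g\<in>A. N (\<lambda>p. f p - g p) < e}"


section \<open>Smooth functions and classical differential operators\<close>

definition pd :: "pt \<Rightarrow> sfield \<Rightarrow> sfield" where
  "pd d f = (\<lambda>p. frechet_derivative f (at p) d)"

abbreviation "pdx \<equiv> pd (1, 0, 0)"
abbreviation "pdy \<equiv> pd (0, 1, 0)"
abbreviation "pdz \<equiv> pd (0, 0, 1)"

primrec Ck :: "nat \<Rightarrow> sfield \<Rightarrow> bool" where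
  "Ck 0 f \<longleftrightarrow> continuous_on UNIV f"
| "Ck (Suc n) f \<longleftrightarrow> f differentiable_on UNIV \<and> (\<forall>d\<in>Basis. Ck n (pd d f))"

definition lat_periodic :: "real \<Rightarrow> sfield \<Rightarrow> bool" where
  "lat_periodic L f \<longleftrightarrow> (\<forall>x y z. f (x + L, y, z) = f (x, y, z) \<and> f (x, y + L, z) = f (x, y, z))"

text \<open>Smoothness up to the plates is read as being the restriction of a smooth function on the
  whole space.\<close>

definition smooth_per :: "real \<Rightarrow> sfield set" where
  "smooth_per L = {f. (\<forall>n. Ck n f) \<and> lat_periodic L f}"

definition smooth_per_v :: "real \<Rightarrow> vfield set" where
  "smooth_per_v L = {E. \<forall>i. (\<lambda>p. E p $ i) \<in> smooth_per L}"

definition grad :: "sfield \<Rightarrow> vfield" where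
  "grad f = (\<lambda>p. vector [pdx f p, pdy f p, pdz f p])"

definition divergence :: "vfield \<Rightarrow> sfield" where
  "divergence E = (\<lambda>p. pdx (\<lambda>q. E q $ 1) p + pdy (\<lambda>q. E q $ 2) p + pdz (\<lambda>q. E q $ 3) p)"

definition curl :: "vfield \<Rightarrow> vfield" where
  "curl E = (\<lambda>p. vector
     [pdy (\<lambda>q. E q $ 3) p - pdz (\<lambda>q. E q $ 2) p,
      pdz (\<lambda>q. E q $ 1) p - pdx (\<lambda>q. E q $ 3) p,
      pdx (\<lambda>q. E q $ 2) p - pdy (\<lambda>q. E q $ 1) p])"


section \<open>Distributional derivatives on \<open>T_L^2 \<times> (0,a)\<close>\<close>

text \<open>Test functions are compactly supported in \<open>T_L^2 \<times> (0,a)\<close>, extended by zero in \<open>z\<close>.\<close>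

definition test :: "real \<Rightarrow> real \<Rightarrow> sfield set" where
  "test L a = {f \<in> smooth_per L.
     \<exists>\<delta>>0. \<forall>x y z. z < \<delta> \<or> a - \<delta> < z \<longrightarrow> f (x, y, z) = 0}"

definition test_v :: "real \<Rightarrow> real \<Rightarrow> vfield set" where
  "test_v L a = {E. \<forall>i. (\<lambda>p. E p $ i) \<in> test L a}"

definition pairing :: "real \<Rightarrow> real \<Rightarrow> vfield \<Rightarrow> vfield \<Rightarrow> complex" where
  "pairing L a E F = (\<integral>p. (\<Sum>i\<in>UNIV. E p $ i * F p $ i) \<partial>slab L a)"

definition is_weak_grad :: "real \<Rightarrow> real \<Rightarrow> sfield \<Rightarrow> vfield \<Rightarrow> bool" where
  "is_weak_grad L a u G \<longleftrightarrow> G \<in> L2 L a \<and>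
     (\<forall>F\<in>test_v L a. (\<integral>p. u p * divergence F p \<partial>slab L a) = - pairing L a G F)"

definition is_weak_curl :: "real \<Rightarrow> real \<Rightarrow> vfield \<Rightarrow> vfield \<Rightarrow> bool" where
  "is_weak_curl L a E C \<longleftrightarrow> C \<in> L2 L a \<and>
     (\<forall>F\<in>test_v L a. pairing L a E (curl F) = pairing L a C F)"

definition weak_div_free :: "real \<Rightarrow> real \<Rightarrow> vfield \<Rightarrow> bool" where
  "weak_div_free L a E \<longleftrightarrow> (\<forall>f\<in>test L a. pairing L a E (grad f) = 0)"

text \<open>Weak derivatives are unique up to almost-everywhere equality; a representative is chosen.\<close>

definition weak_grad :: "real \<Rightarrow> real \<Rightarrow> sfield \<Rightarrow> vfield" where
  "weak_grad L a u = (SOME G. is_weak_grad L a u G)"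

definition weak_curl :: "real \<Rightarrow> real \<Rightarrow> vfield \<Rightarrow> vfield" where
  "weak_curl L a E = (SOME C. is_weak_curl L a E C)"


section \<open>Operators associated with forms\<close>

text \<open>Operators are graphs.  For a closed nonnegative form \<open>q\<close> with domain \<open>V\<close> dense in the Hilbert
  space \<open>H\<close>, the following is the graph of the self-adjoint operator of the first representation
  theorem (single-valued up to almost-everywhere equality).\<close>

definition form_operator ::
  "('a \<Rightarrow> 'a \<Rightarrow> complex) \<Rightarrow> 'a set \<Rightarrow> 'a set \<Rightarrow> ('a \<Rightarrow> 'a \<Rightarrow> complex) \<Rightarrow> ('a \<times> 'a) set" where
  "form_operator ip H V q = {(u, f). u \<in> V \<and> f \<in> H \<and> (\<forall>v\<in>V. q u v = ip f v)}"


section \<open>The Maxwell operator\<close>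

definition H_curl :: "real \<Rightarrow> real \<Rightarrow> vfield set" where
  "H_curl L a = {E \<in> L2 L a. \<exists>C. is_weak_curl L a E C}"

definition H_curl_norm :: "real \<Rightarrow> real \<Rightarrow> vfield \<Rightarrow> real" where
  "H_curl_norm L a E = sqrt ((L2_norm L a E)\<^sup>2 + (L2_norm L a (weak_curl L a E))\<^sup>2)"

definition H0_curl :: "real \<Rightarrow> real \<Rightarrow> vfield set" where
  "H0_curl L a = norm_closure (H_curl_norm L a) (H_curl L a)
     {E \<in> smooth_per_v L. \<forall>x y. \<forall>z\<in>{0, a}. E (x, y, z) $ 1 = 0 \<and> E (x, y, z) $ 2 = 0}"

definition V_PEC :: "real \<Rightarrow> real \<Rightarrow> vfield set" where
  "V_PEC L a = {E \<in> H0_curl L a. weak_div_free L a E}"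

definition H_PEC :: "real \<Rightarrow> real \<Rightarrow> vfield set" where
  "H_PEC L a = norm_closure (L2_norm L a) (L2 L a) (V_PEC L a)"

definition h0 :: "real \<Rightarrow> real \<Rightarrow> vfield" where
  "h0 L a = (\<lambda>p. vector [0, 0, complex_of_real (1 / sqrt (L\<^sup>2 * a))])"

definition H_phys :: "real \<Rightarrow> real \<Rightarrow> vfield set" where
  "H_phys L a = {E \<in> H_PEC L a. v_inner L a E (h0 L a) = 0}"

definition V_phys :: "real \<Rightarrow> real \<Rightarrow> vfield set" where
  "V_phys L a = V_PEC L a \<inter> H_phys L a"

definition q_Mx :: "real \<Rightarrow> real \<Rightarrow> vfield \<Rightarrow> vfield \<Rightarrow> complex" where
  "q_Mx L a E F = v_inner L a (weak_curl L a E) (weak_curl L a F)"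

definition L_Mx :: "real \<Rightarrow> real \<Rightarrow> (vfield \<times> vfield) set" where
  "L_Mx L a = form_operator (v_inner L a) (H_phys L a) (V_phys L a) (q_Mx L a)"


section \<open>The scalar operators\<close>

definition H1 :: "real \<Rightarrow> real \<Rightarrow> sfield set" where
  "H1 L a = {u \<in> L2 L a. \<exists>G. is_weak_grad L a u G}"

definition H1_norm :: "real \<Rightarrow> real \<Rightarrow> sfield \<Rightarrow> real" where
  "H1_norm L a u = sqrt ((L2_norm L a u)\<^sup>2 + (L2_norm L a (weak_grad L a u))\<^sup>2)"

definition H1_D :: "real \<Rightarrow> real \<Rightarrow> sfield set" where
  "H1_D L a = norm_closure (H1_norm L a) (H1 L a)
     {u \<in> smooth_per L. \<forall>x y. \<forall>z\<in>{0, a}. u (x, y, z) = 0}"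

definition q_grad :: "real \<Rightarrow> real \<Rightarrow> sfield \<Rightarrow> sfield \<Rightarrow> complex" where
  "q_grad L a u v = v_inner L a (weak_grad L a u) (weak_grad L a v)"

text \<open>The Dirichlet condition is essential, the Neumann condition is the natural boundary condition
  of the form on all of \<open>H1\<close>.\<close>

definition L_D :: "real \<Rightarrow> real \<Rightarrow> (sfield \<times> sfield) set" where
  "L_D L a = form_operator (s_inner L a) (L2 L a) (H1_D L a) (q_grad L a)"

definition L_N :: "real \<Rightarrow> real \<Rightarrow> (sfield \<times> sfield) set" where
  "L_N L a = form_operator (s_inner L a) (L2 L a) (H1 L a) (q_grad L a)"

definition H_N' :: "real \<Rightarrow> real \<Rightarrow> sfield set" where
  "H_N' L a = {u \<in> L2 L a. \<forall>c. s_inner L a u (\<lambda>p. c) = 0}"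

definition L_N' :: "real \<Rightarrow> real \<Rightarrow> (sfield \<times> sfield) set" where
  "L_N' L a = L_N L a \<inter> H_N' L a \<times> H_N' L a"


section \<open>Direct sums and unitary operators\<close>

definition op_sum :: "('a \<times> 'a) set \<Rightarrow> ('b \<times> 'b) set \<Rightarrow> (('a \<times> 'b) \<times> ('a \<times> 'b)) set" where
  "op_sum S T = {((u, v), (f, g)). (u, f) \<in> S \<and> (v, g) \<in> T}"

text \<open>A unitary operator from \<open>A \<oplus> B\<close> onto \<open>H\<close>, acting on representatives.\<close>

definition unitary_sum ::
  "real \<Rightarrow> real \<Rightarrow> sfield set \<Rightarrow> sfield set \<Rightarrow> vfield set \<Rightarrow> (sfield \<times> sfield \<Rightarrow> vfield) \<Rightarrow> bool" where
  "unitary_sum L a A B H U \<longleftrightarrow>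
     (\<forall>w\<in>A \<times> B. U w \<in> H) \<and>
     (\<forall>u\<in>A. \<forall>v\<in>B. \<forall>u'\<in>A. \<forall>v'\<in>B.
        (AE p in slab L a. u p = u' p) \<and> (AE p in slab L a. v p = v' p) \<longrightarrow>
        (AE p in slab L a. U (u, v) p = U (u', v') p)) \<and>
     (\<forall>u\<in>A. \<forall>v\<in>B. \<forall>u'\<in>A. \<forall>v'\<in>B. \<forall>c d.
        AE p in slab L a.
          U (\<lambda>q. c * u q + d * u' q, \<lambda>q. c * v q + d * v' q) p
            = c *s U (u, v) p + d *s U (u', v') p) \<and>
     (\<forall>u\<in>A. \<forall>v\<in>B. \<forall>u'\<in>A. \<forall>v'\<in>B.
        v_inner L a (U (u, v)) (U (u', v')) = s_inner L a u u' + s_inner L a v v') \<and>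
     (\<forall>E\<in>H. \<exists>w\<in>A \<times> B. AE p in slab L a. U w p = E p)"

end

(* Every operator in the statement is diagonal in the Fourier modes e^(i(k_x x + k_y y)) sin(nu z) and
   e^(i(k_x x + k_y y)) cos(nu z), nu = n pi / a.  A square-integrable scalar field is expanded in the sine
   modes for the Dirichlet operator and in the cosine modes for the Neumann operator; both operators multiply
   the coefficients by lambda = k_x^2 + k_y^2 + nu^2.  A vector field is expanded with sine modes in its two
   tangential components and cosine modes in the normal one.  It lies in H_phys exactly if each coefficient
   vector x in C^3 satisfies k_x x_1 + k_y x_2 + i nu x_3 = 0 and the coefficient of h0 vanishes, and on
   such fields curl curl is again multiplication by lambda.  Rotating each two-dimensional space of
   coefficient vectors to the basis of a transverse electric and a transverse magnetic polarisation
   identifies these fields with pairs of a Dirichlet and a Neumann scalar field.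

   The boundary conditions enter through the closure of smooth fields (Dirichlet and PEC) or through
   cutoffs near the plates (weak divergence and Neumann), where sine modes vanish linearly. *)

theory Submission
  imports Defs
begin

section \<open>Calculus of smooth functions\<close>

text \<open>The obstacle: weak derivatives are tested only with functions vanishing near the plates,
  and nonzero modes do not vanish there. Where the condition is natural, a cutoff is inserted; its
  derivative, of size 1/distance, always meets a sine, so the error tends to 0 for every L2 factor.
  Where the condition is essential, Green's identity is applied to the approximating smooth fields
  and the limit is taken afterwards. Each operator graph is turned into a relation between
  coefficients: testing the form with modes gives one direction, Parseval the other. Completeness of
  the cosine modes rests on Stone-Weierstrass: \<open>tau\<close> maps the cell injectively into a
  compact set, and polynomials in its coordinates are finite sums of cosine modes. Sine modes
  inherit completeness through the factor sin(pi z / a). The degenerate indices match: for n = 0 the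
  sines vanish and a physical field has only a normal component, and the constant cosine mode is
  missing from the Neumann space just as \<open>h0\<close> is missing from the fields.\<close>

declare split_paired_All [simp del] split_paired_Ex [simp del]

lemma Basis_pt: "(Basis :: pt set) = {(1,0,0), (0,1,0), (0,0,1)}"
  by (auto simp: Basis_prod_def zero_prod_def)

text \<open>\<open>Ck (Suc n)\<close> demands differentiability at each level, so continuity of the
  lower derivatives is recovered by induction; the base case is that differentiable functions are
  continuous.\<close>

lemma Ck_mono: "Ck (Suc n) f \<Longrightarrow> Ck n f"
proof (induction n arbitrary: f)
  case 0
  then show ?case by (simp add: differentiable_imp_continuous_on)
next
  case (Suc n)
  then show ?case by (metis Ck.simps(2))
qed

lemma Ck_Suc_differentiable: "Ck (Suc n) f \<Longrightarrow> f differentiable (at p)"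
  by (auto simp: differentiable_on_def)

lemma Ck_continuous: "Ck n f \<Longrightarrow> continuous_on UNIV f"
proof (induction n)
  case (Suc n)
  then show ?case using Ck_mono by blast
qed auto

lemma pd_eqI:
  assumes "\<And>p. (f has_derivative f' p) (at p)"
  shows "pd d f = (\<lambda>p. f' p d)"
  unfolding pd_def using frechet_derivative_at[OF assms] by (intro ext) metis

lemma pd_add:
  assumes "\<And>p. f differentiable (at p)" "\<And>p. g differentiable (at p)"
  shows "pd d (\<lambda>p. f p + g p) = (\<lambda>p. pd d f p + pd d g p)"
proof -
  have "((\<lambda>p. f p + g p) has_derivative
      (\<lambda>h. frechet_derivative f (at p) h + frechet_derivative g (at p) h)) (at p)" for p
    using assms by (intro has_derivative_add) (auto simp: frechet_derivative_works[symmetric])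
  from pd_eqI[OF this] show ?thesis by (simp add: pd_def)
qed

lemma pd_mult:
  assumes "\<And>p. f differentiable (at p)" "\<And>p. g differentiable (at p)"
  shows "pd d (\<lambda>p. f p * g p) = (\<lambda>p. f p * pd d g p + pd d f p * g p)"
proof -
  have "((\<lambda>p. f p * g p) has_derivative
      (\<lambda>h. f p * frechet_derivative g (at p) h + frechet_derivative f (at p) h * g p)) (at p)" for p
    using assms by (intro has_derivative_mult) (auto simp: frechet_derivative_works[symmetric])
  from pd_eqI[OF this] show ?thesis by (simp add: pd_def)
qed

lemma pd_const: "pd d (\<lambda>p. c) = (\<lambda>p. 0)"
  using pd_eqI[of "\<lambda>_. c" "\<lambda>_ _. 0"] by simp

lemma Ck_const: "Ck n (\<lambda>p. c)"
  by (induction n arbitrary: c) (auto simp: pd_const)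

lemma Ck_add: "Ck n f \<Longrightarrow> Ck n g \<Longrightarrow> Ck n (\<lambda>p. f p + g p)"
proof (induction n arbitrary: f g)
  case (Suc n)
  have d: "\<And>p. f differentiable (at p)" "\<And>p. g differentiable (at p)"
    using Suc.prems Ck_Suc_differentiable by blast+
  show ?case using Suc
    by (auto simp: pd_add[OF d] intro: differentiable_on_add)
qed (auto intro: continuous_intros)

lemma Ck_mult: "Ck n f \<Longrightarrow> Ck n g \<Longrightarrow> Ck n (\<lambda>p. f p * g p)"
proof (induction n arbitrary: f g)
  case (Suc n)
  have d: "\<And>p. f differentiable (at p)" "\<And>p. g differentiable (at p)"
    using Suc.prems Ck_Suc_differentiable by blast+
  have "Ck n (pd e (\<lambda>p. f p * g p))" if "e \<in> Basis" for e
    unfolding pd_mult[OF d]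
    using Suc.prems that Ck_mono by (intro Ck_add Suc.IH) auto
  then show ?case using d by (auto simp: differentiable_on_def)
qed (auto intro: continuous_intros)

text \<open>The smoothness half of \<open>smooth_per\<close>: factors depending on one coordinate
  are treated before any periodicity is known.\<close>

definition smooth :: "sfield \<Rightarrow> bool" where
  "smooth f \<longleftrightarrow> (\<forall>n. Ck n f)"

lemma smooth_differentiable: "smooth f \<Longrightarrow> f differentiable (at p)"
  using Ck_Suc_differentiable unfolding smooth_def by blast

lemma smooth_continuous: "smooth f \<Longrightarrow> continuous_on UNIV f"
  using Ck_continuous by (auto simp: smooth_def)

lemma smooth_const: "smooth (\<lambda>p. c)"
  by (simp add: smooth_def Ck_const)

lemma smooth_add: "smooth f \<Longrightarrow> smooth g \<Longrightarrow> smooth (\<lambda>p. f p + g p)"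
  by (simp add: smooth_def Ck_add)

lemma smooth_mult: "smooth f \<Longrightarrow> smooth g \<Longrightarrow> smooth (\<lambda>p. f p * g p)"
  by (simp add: smooth_def Ck_mult)

lemma smooth_cmult: "smooth f \<Longrightarrow> smooth (\<lambda>p. c * f p)"
  by (intro smooth_mult smooth_const)

lemma smooth_sum: "(\<And>i. i \<in> B \<Longrightarrow> smooth (f i)) \<Longrightarrow> smooth (\<lambda>p. \<Sum>i\<in>B. f i p)"
  by (induction B rule: infinite_finite_induct) (auto intro: smooth_const smooth_add)

lemma smooth_pd: "smooth f \<Longrightarrow> d \<in> Basis \<Longrightarrow> smooth (pd d f)"
  unfolding smooth_def by (metis Ck.simps(2))

lemma smooth_pds:
  assumes "smooth f" shows "smooth (pdx f)" "smooth (pdy f)" "smooth (pdz f)"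
  using smooth_pd[OF assms] by (auto simp: Basis_pt)

lemmas smooth_pd_add = pd_add[OF smooth_differentiable smooth_differentiable]
lemmas smooth_pd_mult = pd_mult[OF smooth_differentiable smooth_differentiable]

lemma pd_cmult: "smooth f \<Longrightarrow> pd d (\<lambda>p. c * f p) = (\<lambda>p. c * pd d f p)"
  by (subst smooth_pd_mult) (auto intro: smooth_const simp: pd_const)

lemma smooth_pd_diff: "smooth f \<Longrightarrow> smooth g \<Longrightarrow> pd d (\<lambda>p. f p - g p) = (\<lambda>p. pd d f p - pd d g p)"
  using smooth_pd_add[OF _ smooth_cmult[of g "-1"], of f d] pd_cmult[of g d "-1"] by simp

lemma pd_sum: "(\<And>i. i \<in> B \<Longrightarrow> smooth (f i)) \<Longrightarrow>
    pd d (\<lambda>p. \<Sum>i\<in>B. f i p) = (\<lambda>p. \<Sum>i\<in>B. pd d (f i) p)"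
  by (induction B rule: infinite_finite_induct) (auto simp: pd_const smooth_pd_add smooth_sum)

text \<open>All derivatives are supplied at once as a sequence, so closure under linear combinations
  and affine substitutions is obtained by transforming the sequence termwise.\<close>

definition smooth1 :: "(real \<Rightarrow> complex) \<Rightarrow> bool" where
  "smooth1 h \<longleftrightarrow> (\<exists>s. s 0 = h \<and> (\<forall>n t. (s n has_vector_derivative s (Suc n) t) (at t)))"

lemma pd_coord:
  fixes \<pi> :: "pt \<Rightarrow> real"
  assumes "bounded_linear \<pi>" "\<And>t. (h has_vector_derivative h' t) (at t)"
  shows "((\<lambda>p. h (\<pi> p)) has_derivative (\<lambda>d. \<pi> d *\<^sub>R h' (\<pi> p))) (at p)"
proof -
  have "(\<pi> has_derivative \<pi>) (at p)"
    using assms(1) by (rule bounded_linear_imp_has_derivative)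
  moreover have "(h has_derivative (\<lambda>x. x *\<^sub>R h' (\<pi> p))) (at (\<pi> p))"
    using assms(2) by (simp add: has_vector_derivative_def)
  ultimately show ?thesis
    using has_derivative_compose by blast
qed

lemma smooth_coord:
  fixes \<pi> :: "pt \<Rightarrow> real"
  assumes \<pi>: "bounded_linear \<pi>" and h: "smooth1 h"
  shows "smooth (\<lambda>p. h (\<pi> p))"
proof -
  obtain s where s0: "s 0 = h" and s: "\<And>n t. (s n has_vector_derivative s (Suc n) t) (at t)"
    using h by (auto simp: smooth1_def)
  \<comment> \<open>Generalised over the order m and the factor c: each differentiation raises m by
    one and multiplies c by \<open>\<pi> d\<close>.\<close>
  have "Ck n (\<lambda>p. c * s m (\<pi> p))" for n m c
  proof (induction n arbitrary: m c)
    case 0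
    have "continuous_on UNIV (s m)"
      using s by (meson continuous_at_imp_continuous_on has_vector_derivative_continuous)
    then show ?case
      using continuous_on_compose2[OF _ linear_continuous_on[OF \<pi>]] by (auto intro!: continuous_on_mult_left)
  next
    case (Suc n)
    have d: "((\<lambda>p. c * s m (\<pi> p)) has_derivative (\<lambda>d. c * (\<pi> d *\<^sub>R s (Suc m) (\<pi> p)))) (at p)" for p
      using pd_coord[OF \<pi> s] by (rule has_derivative_mult_right)
    have "pd d (\<lambda>p. c * s m (\<pi> p)) = (\<lambda>p. (c * of_real (\<pi> d)) * s (Suc m) (\<pi> p))" for d
      unfolding pd_eqI[OF d] by (simp add: scaleR_conv_of_real mult.assoc)
    moreover have "(\<lambda>p. c * s m (\<pi> p)) differentiable (at p)" for p
      using d[of p] unfolding differentiable_def by blast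
    ultimately show ?case using Suc
      by (simp add: differentiable_on_def)
  qed
  from this[of _ 1 0] show ?thesis by (simp add: smooth_def s0)
qed

lemma smooth1_exp: "smooth1 (\<lambda>t. exp (c * of_real t))"
proof -
  have "((\<lambda>t. c ^ n * exp (c * of_real t)) has_vector_derivative c ^ Suc n * exp (c * of_real t)) (at t)" for n t
    by (rule has_vector_derivative_real_field) (auto intro!: derivative_eq_intros)
  then show ?thesis
    unfolding smooth1_def by (intro exI[of _ "\<lambda>n t. c ^ n * exp (c * of_real t)"]) auto
qed

lemma smooth1_add: "smooth1 f \<Longrightarrow> smooth1 g \<Longrightarrow> smooth1 (\<lambda>t. a * f t + b * g t)"
proof -
  assume "smooth1 f" "smooth1 g"
  then obtain s r where s: "s 0 = f" "\<And>n t. (s n has_vector_derivative s (Suc n) t) (at t)"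
    and r: "r 0 = g" "\<And>n t. (r n has_vector_derivative r (Suc n) t) (at t)"
    unfolding smooth1_def by blast
  have "((\<lambda>t. a * s n t + b * r n t) has_vector_derivative a * s (Suc n) t + b * r (Suc n) t) (at t)" for n t
    by (intro has_vector_derivative_add has_vector_derivative_mult_right s r)
  then show ?thesis
    unfolding smooth1_def using s r by (intro exI[of _ "\<lambda>n t. a * s n t + b * r n t"]) auto
qed

lemma smooth1_affine: "smooth1 f \<Longrightarrow> smooth1 (\<lambda>t. f (b * t + c))"
proof -
  assume "smooth1 f"
  then obtain s where s: "s 0 = f" "\<And>n t. (s n has_vector_derivative s (Suc n) t) (at t)"
    unfolding smooth1_def by blast
  have "((\<lambda>t. b ^ n *\<^sub>R s n (b * t + c)) has_vector_derivative b ^ Suc n *\<^sub>R s (Suc n) (b * t + c)) (at t)" for n t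
  proof -
    have "((\<lambda>t. b * t + c) has_vector_derivative b) (at t)"
      by (auto intro!: derivative_eq_intros simp: has_real_derivative_iff_has_vector_derivative[symmetric])
    from vector_diff_chain_at[OF this s(2)]
    have "((\<lambda>t. s n (b * t + c)) has_vector_derivative b *\<^sub>R s (Suc n) (b * t + c)) (at t)"
      by (simp add: o_def)
    from bounded_linear.has_vector_derivative[OF bounded_linear_scaleR_right[of "b^n"] this]
    show ?thesis by (simp add: mult.commute)
  qed
  then show ?thesis
    unfolding smooth1_def using s by (intro exI[of _ "\<lambda>n t. b ^ n *\<^sub>R s n (b * t + c)"]) auto
qed

lemma smooth1_cos: "smooth1 (\<lambda>t. of_real (cos (b * t)))"
  and smooth1_sin: "smooth1 (\<lambda>t. of_real (sin (b * t)))"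
proof -
  have "(\<lambda>t. of_real (cos (b * t))) =
      (\<lambda>t. (1/2) * exp ((\<i> * of_real b) * of_real t) + (1/2) * exp ((- \<i> * of_real b) * of_real t))"
    by (auto simp: fun_eq_iff cos_of_real[symmetric] cos_exp_eq field_simps)
  then show "smooth1 (\<lambda>t. of_real (cos (b * t)))"
    using smooth1_add[OF smooth1_exp smooth1_exp] by metis
  have "(\<lambda>t. of_real (sin (b * t))) =
      (\<lambda>t. (1/(2*\<i>)) * exp ((\<i> * of_real b) * of_real t) + (-1/(2*\<i>)) * exp ((- \<i> * of_real b) * of_real t))"
    by (auto simp: fun_eq_iff sin_of_real[symmetric] sin_exp_eq field_simps)
  then show "smooth1 (\<lambda>t. of_real (sin (b * t)))"
    using smooth1_add[OF smooth1_exp smooth1_exp] by metis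
qed

lemma bounded_linear_coords:
  "bounded_linear (fst :: pt \<Rightarrow> real)"
  "bounded_linear (\<lambda>p::pt. fst (snd p))"
  "bounded_linear (\<lambda>p::pt. snd (snd p))"
  by (auto intro: bounded_linear_fst bounded_linear_snd bounded_linear_compose[OF bounded_linear_fst]
      bounded_linear_compose[OF bounded_linear_snd])

subsection \<open>A flat function\<close>

text \<open>It tends to \<open>1\<close> at infinity, and \<open>t\<close> times its derivative is bounded and tends to \<open>0\<close>; this is
  all that is needed of a cutoff.\<close>

definition flat :: "real \<Rightarrow> real" where
  "flat t = (if t \<le> 1 then 0 else exp (- inverse (t - 1)))"

definition flat' :: "real \<Rightarrow> real" where
  "flat' t = (if t \<le> 1 then 0 else inverse (t - 1) ^ 2 * exp (- inverse (t - 1)))"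

text \<open>With s = 1/(t - 1), the products of a polynomial in s with exp(-s), extended by 0, form
  a family that is closed under differentiation and contains \<open>flat\<close> and
  \<open>flat'\<close>.\<close>

definition flat_poly :: "real poly \<Rightarrow> real \<Rightarrow> real" where
  "flat_poly P t = (if t \<le> 1 then 0 else poly P (inverse (t - 1)) * exp (- inverse (t - 1)))"

text \<open>For s = 1/(t - 1) this is the decay at the junction t = 1 that makes the extension by
  zero differentiable.\<close>

lemma poly_exp_tendsto_0: "((\<lambda>s. poly P s / exp s) \<longlongrightarrow> (0::real)) at_top"
proof -
  have "(\<lambda>s. poly P s / exp s) = (\<lambda>s. \<Sum>i\<le>degree P. coeff P i * (s ^ i / exp s))"
    by (auto simp: poly_altdef sum_divide_distrib)
  moreover have "((\<lambda>s. \<Sum>i\<le>degree P. coeff P i * (s ^ i / exp s)) \<longlongrightarrow> (\<Sum>i\<le>degree P. coeff P i * 0)) at_top"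
    by (intro tendsto_sum tendsto_mult tendsto_const tendsto_power_div_exp_0)
  ultimately show ?thesis by simp
qed

text \<open>Since ds/dt = -s^2 for s = 1/(t - 1), the derivative of P(s) exp(-s) is s^2 (P - P')(s)
  exp(-s). The junction t = 1 escapes the chain rule; there the difference quotient from the right
  is s P(s) / exp s.\<close>

lemma flat_poly_deriv:
  "(flat_poly P has_real_derivative flat_poly (monom 1 2 * (P - pderiv P)) t) (at t)"
proof (cases t "1::real" rule: linorder_cases)
  case less
  have "((\<lambda>t. 0) has_real_derivative flat_poly (monom 1 2 * (P - pderiv P)) t) (at t)"
    using less by (simp add: flat_poly_def)
  moreover have "eventually (\<lambda>t. 0 = flat_poly P t) (nhds t)"
    using eventually_nhds_in_open[of "{..<1}" t] less
    by (auto simp: flat_poly_def elim!: eventually_mono)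
  ultimately show ?thesis
    by (subst (asm) DERIV_cong_ev[OF refl _ refl])
next
  case greater
  have "((\<lambda>t. poly P (inverse (t - 1)) * exp (- inverse (t - 1))) has_real_derivative
     flat_poly (monom 1 2 * (P - pderiv P)) t) (at t)"
  proof -
    have i: "((\<lambda>t. inverse (t - 1)) has_real_derivative - (inverse (t - 1))\<^sup>2) (at t)"
      using greater by (auto intro!: derivative_eq_intros simp: power2_eq_square)
    have "((\<lambda>t. poly P (inverse (t - 1))) has_real_derivative
        - (inverse (t - 1))\<^sup>2 * poly (pderiv P) (inverse (t - 1))) (at t)"
      using DERIV_chain2[OF poly_DERIV i] by (simp add: mult.commute)
    moreover have "((\<lambda>t. exp (- inverse (t - 1))) has_real_derivative
        exp (- inverse (t - 1)) * (inverse (t - 1))\<^sup>2) (at t)"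
      using DERIV_chain2[OF DERIV_exp DERIV_minus[OF i]] by simp
    ultimately show ?thesis
      by (rule DERIV_cong[OF DERIV_mult]) (use greater in \<open>simp add: flat_poly_def poly_monom algebra_simps\<close>)
  qed
  moreover have "eventually (\<lambda>t. poly P (inverse (t - 1)) * exp (- inverse (t - 1)) = flat_poly P t) (nhds t)"
    using eventually_nhds_in_open[of "{1<..}" t] greater
    by (auto simp: flat_poly_def elim!: eventually_mono)
  ultimately show ?thesis
    by (subst (asm) DERIV_cong_ev[OF refl _ refl])
next
  case equal
  have "filterlim (\<lambda>h::real. inverse h) at_top (at_right 0)"
    by (rule filterlim_inverse_at_top_right)
  \<comment> \<open>\<open>pCons 0 P\<close> is s P(s): the extra factor s = 1/h comes from dividing
    by the increment h.\<close>
  from filterlim_compose[OF poly_exp_tendsto_0[of "pCons 0 P"] this]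
  have R: "((\<lambda>h. flat_poly P (1 + h) / h) \<longlongrightarrow> 0) (at_right 0)"
    by (rule Lim_transform_eventually, intro eventually_mono[OF eventually_at_right_less])
      (simp add: flat_poly_def exp_minus divide_inverse)
  have L: "((\<lambda>h. flat_poly P (1 + h) / h) \<longlongrightarrow> 0) (at_left 0)"
    by (rule Lim_transform_eventually[OF tendsto_const])
      (auto simp: flat_poly_def eventually_at_filter)
  have "((\<lambda>h. flat_poly P (1 + h) / h) \<longlongrightarrow> 0) (at 0)"
    using L R by (simp add: filterlim_split_at)
  then have "((\<lambda>h. (flat_poly P (1 + h) - flat_poly P 1) / h) \<longlongrightarrow> flat_poly (monom 1 2 * (P - pderiv P)) 1) (at 0)"
    by (simp add: flat_poly_def)
  then show ?thesis using equal by (simp add: DERIV_def)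
qed

lemma flat_has_derivative: "(flat has_real_derivative flat' t) (at t)"
proof -
  have "flat = flat_poly 1" "flat' = flat_poly (monom 1 2 * (1 - pderiv 1))"
    by (auto simp: fun_eq_iff flat_def flat'_def flat_poly_def poly_monom)
  then show ?thesis using flat_poly_deriv by metis
qed

lemma smooth1_flat: "smooth1 (\<lambda>t. of_real (flat t))"
proof -
  define P where "P n = ((\<lambda>P. monom 1 2 * (P - pderiv P)) ^^ n) (1::real poly)" for n
  have "flat = flat_poly (P 0)"
    by (auto simp: fun_eq_iff flat_def flat_poly_def P_def)
  moreover have "((\<lambda>t. of_real (flat_poly (P n) t) :: complex) has_vector_derivative of_real (flat_poly (P (Suc n)) t)) (at t)" for n t
    using flat_poly_deriv[of "P n" t] by (auto simp: P_def intro: has_vector_derivative_of_real)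
  ultimately show ?thesis
    unfolding smooth1_def by (intro exI[of _ "\<lambda>n t. of_real (flat_poly (P n) t)"]) auto
qed

lemma flat_bounds: "0 \<le> flat t" "flat t \<le> 1" "t \<le> 1 \<Longrightarrow> flat t = 0" "t \<le> 1 \<Longrightarrow> flat' t = 0"
  by (auto simp: flat_def flat'_def)

lemma inverse_shift_tendsto: "((\<lambda>t::real. inverse (t - 1)) \<longlongrightarrow> 0) at_top"
proof -
  have "filterlim (\<lambda>t::real. t - 1) at_top at_top"
    using filterlim_tendsto_add_at_top[of "\<lambda>_. -1::real" "-1", OF tendsto_const filterlim_ident] by simp
  then show ?thesis
    by (rule tendsto_inverse_0_at_top)
qed

lemma flat_tendsto: "(flat \<longlongrightarrow> 1) at_top"
proof -
  have "((\<lambda>t::real. exp (- inverse (t - 1))) \<longlongrightarrow> exp (- 0)) at_top"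
    by (intro tendsto_intros inverse_shift_tendsto)
  then have "((\<lambda>t::real. exp (- inverse (t - 1))) \<longlongrightarrow> 1) at_top"
    by simp
  then show ?thesis
    by (rule Lim_transform_eventually, intro eventually_mono[OF eventually_gt_at_top[of 1]])
      (simp add: flat_def)
qed

text \<open>For s = 1/(t - 1) the product is (s + s^2) exp(-s), and exp s is at least 1 + s + s^2/2,
  three times which exceeds s + s^2.\<close>

lemma flat'_bound: "\<bar>t * flat' t\<bar> \<le> 3"
proof (cases "t \<le> 1")
  case False
  define s where "s = inverse (t - 1)"
  have s: "s > 0" "t = 1 + inverse s" using False by (auto simp: s_def)
  have "1 + s + s\<^sup>2/2 \<le> exp s"
    using s by (simp add: exp_lower_Taylor_quadratic)
  then have "s + s\<^sup>2 \<le> 3 * exp s" using s zero_le_power2[of s] by linarith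
  then have "(s + s\<^sup>2) / exp s \<le> 3" by (simp add: divide_simps)
  moreover have "t * flat' t = (s + s\<^sup>2) / exp s"
  proof -
    have "t * flat' t = (1 + inverse s) * s\<^sup>2 * inverse (exp s)"
      using False s by (simp add: flat'_def exp_minus)
    also have "(1 + inverse s) * s\<^sup>2 = s + s\<^sup>2"
      using s(1) by (simp add: field_simps power2_eq_square)
    finally show ?thesis by (simp add: divide_inverse)
  qed
  ultimately show ?thesis using s by simp
qed (simp add: flat'_def)

text \<open>In the variable s = 1/(t - 1) this is (s + s^2) exp(-s) as s tends to 0. Together with
  \<open>flat'_bound\<close> it permits dominated convergence for the cutoff derivatives.\<close>

lemma flat'_tendsto: "((\<lambda>t. t * flat' t) \<longlongrightarrow> 0) at_top"
proof -
  have "((\<lambda>t::real. (inverse (t - 1) + inverse (t - 1) ^ 2) * exp (- inverse (t - 1))) \<longlongrightarrow> (0 + 0^2) * exp (- 0)) at_top"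
    by (intro tendsto_intros inverse_shift_tendsto)
  then have *: "((\<lambda>t::real. (inverse (t - 1) + inverse (t - 1) ^ 2) * exp (- inverse (t - 1))) \<longlongrightarrow> 0) at_top"
    by simp
  have "(inverse (t - 1) + inverse (t - 1) ^ 2) * exp (- inverse (t - 1)) = t * flat' t" if "t > 1" for t :: real
  proof -
    define s where "s = inverse (t - 1)"
    have "s > 0" "t = 1 + inverse s" using that by (auto simp: s_def)
    then have "t * s\<^sup>2 = s + s\<^sup>2" by (simp add: field_simps power2_eq_square)
    then show ?thesis using that by (simp add: flat'_def flip: s_def mult.assoc)
  qed
  then show ?thesis
    by (intro Lim_transform_eventually[OF * eventually_mono[OF eventually_gt_at_top[of 1]]]) auto
qed

section \<open>Square-integrable functions on the slab\<close>

lemma measurable_cnj [measurable]: "f \<in> borel_measurable N \<Longrightarrow> (\<lambda>p. cnj (f p)) \<in> borel_measurable N"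
  by (rule borel_measurable_continuous_on[of cnj]) (auto intro: continuous_intros)

locale slab_domain =
  fixes L a :: real
  assumes L: "0 < L" and a: "0 < a"
begin

abbreviation M :: "pt measure" where "M \<equiv> slab L a"
abbreviation cell :: "pt set" where "cell \<equiv> {0..<L} \<times> {0..<L} \<times> {0..a}"
abbreviation ip :: "sfield \<Rightarrow> sfield \<Rightarrow> complex" where "ip \<equiv> s_inner L a"
abbreviation nm :: "sfield \<Rightarrow> real" where "nm \<equiv> L2_norm L a"

section \<open>The fundamental cell and its measure\<close>

lemma cell_borel: "cell \<in> sets borel"
  by (intro borel_Times) auto

lemma space_M: "space M = cell"
  by (simp add: slab_def space_restrict_space)

lemma sets_M: "A \<in> sets borel \<Longrightarrow> A \<inter> cell \<in> sets M"
  using cell_borel by (auto simp: slab_def sets_restrict_space)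

lemma measurable_M: "f \<in> borel_measurable borel \<Longrightarrow> f \<in> borel_measurable M"
  unfolding slab_def by (intro measurable_restrict_space1) simp

lemma continuous_measurable_M: "continuous_on UNIV f \<Longrightarrow> f \<in> borel_measurable M"
  by (intro measurable_M borel_measurable_continuous_onI)

lemma emeasure_M: "emeasure M (space M) = ennreal (L * L * a)"
proof -
  have "emeasure M (space M) = emeasure lborel cell"
    using cell_borel by (simp add: space_M slab_def emeasure_restrict_space)
  also have "\<dots> = emeasure (lborel \<Otimes>\<^sub>M lborel) ({0..<L} \<times> ({0..<L} \<times> {0..a}))"
    by (simp add: lborel_prod)
  also have "\<dots> = emeasure lborel {0..<L} * emeasure (lborel \<Otimes>\<^sub>M lborel) ({0..<L} \<times> {0..a})"
    by (subst lborel.emeasure_pair_measure_Times) (auto simp: lborel_prod borel_Times)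
  also have "\<dots> = ennreal L * (ennreal L * ennreal a)"
    using L a by (subst lborel.emeasure_pair_measure_Times) auto
  finally show ?thesis
    using L a by (simp add: ennreal_mult mult.assoc)
qed

sublocale finite_measure M
  by standard (simp add: emeasure_M)

lemma measure_M: "measure M (space M) = L * L * a"
  using L a by (simp add: measure_def emeasure_M)

lemma integral_M:
  fixes f :: "pt \<Rightarrow> 'b::{banach, second_countable_topology}"
  shows "(\<integral>p. f p \<partial>M) = (\<integral>p. indicator cell p *\<^sub>R f p \<partial>lborel)"
  unfolding slab_def using cell_borel by (subst integral_restrict_space) auto

lemma integrable_M:
  fixes f :: "pt \<Rightarrow> 'b::{banach, second_countable_topology}"
  shows "integrable M f \<longleftrightarrow> integrable lborel (\<lambda>p. indicator cell p *\<^sub>R f p)"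
  unfolding slab_def using cell_borel by (subst integrable_restrict_space) auto

text \<open>The faces are null sets. The cutoffs converge to 1, and sin(pi z / a) is positive, only
  off the plates.\<close>

lemma AE_interior: "AE p in M. 0 < fst p \<and> 0 < fst (snd p) \<and> 0 < snd (snd p) \<and> snd (snd p) < a"
proof -
  have "AE p in lborel. p \<bullet> b \<noteq> c" if "b \<in> Basis" for b :: pt and c
    using AE_lborel_inner_neq[OF that] .
  from this[of "(1,0,0)" 0] this[of "(0,1,0)" 0] this[of "(0,0,1)" 0] this[of "(0,0,1)" a]
  have "AE p in (lborel :: pt measure). fst p \<noteq> 0 \<and> fst (snd p) \<noteq> 0 \<and> snd (snd p) \<noteq> 0 \<and> snd (snd p) \<noteq> (a::real)"
    by (auto simp: Basis_pt inner_prod_def)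
  then have "AE p in M. fst p \<noteq> 0 \<and> fst (snd p) \<noteq> 0 \<and> snd (snd p) \<noteq> 0 \<and> snd (snd p) \<noteq> (a::real)"
    unfolding slab_def using cell_borel by (subst AE_restrict_space_iff) auto
  moreover have "AE p in M. p \<in> cell" using AE_space[of M] by (simp add: space_M)
  ultimately show ?thesis by eventually_elim auto
qed

text \<open>The cell is half open, so the bound is taken on its compact closure.\<close>

lemma continuous_bounded:
  fixes f :: "pt \<Rightarrow> 'b::real_normed_vector"
  assumes "continuous_on UNIV f"
  obtains K where "K > 0" "\<And>p. p \<in> cell \<Longrightarrow> norm (f p) \<le> K"
proof -
  have "compact ({0..L} \<times> {0..L} \<times> {0..a})"
    by (intro compact_Times compact_Icc)
  then have "compact (f ` ({0..L} \<times> {0..L} \<times> {0..a}))"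
    by (rule compact_continuous_image[OF continuous_on_subset[OF assms subset_UNIV]])
  then have "bounded (f ` ({0..L} \<times> {0..L} \<times> {0..a}))"
    by (rule compact_imp_bounded)
  then obtain K where K: "K > 0" "\<forall>v \<in> f ` ({0..L} \<times> {0..L} \<times> {0..a}). norm v \<le> K"
    unfolding bounded_pos by blast
  have "norm (f p) \<le> K" if "p \<in> cell" for p
  proof -
    have "p \<in> {0..L} \<times> {0..L} \<times> {0..a}"
      using that by (simp add: mem_Times_iff)
    then show ?thesis by (rule bspec[OF K(2) imageI])
  qed
  with K(1) show ?thesis by (rule that)
qed

lemma bounded_integrable:
  fixes f :: "pt \<Rightarrow> 'b::{banach, second_countable_topology}"
  assumes "f \<in> borel_measurable M" "\<And>p. p \<in> cell \<Longrightarrow> norm (f p) \<le> K"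
  shows "integrable M f"
  using assms by (intro integrable_const_bound[of _ K]) (auto simp: space_M)

lemma continuous_integrable:
  fixes f :: "pt \<Rightarrow> 'b::euclidean_space"
  assumes "continuous_on UNIV f"
  shows "integrable M f"
proof -
  obtain K where "\<And>p. p \<in> cell \<Longrightarrow> norm (f p) \<le> K" using continuous_bounded[OF assms] by blast
  then show ?thesis by (rule bounded_integrable[OF continuous_measurable_M[OF assms]])
qed

subsection \<open>Integrals of derivatives\<close>

text \<open>Reconciles the half-open period of the cell with the closed interval of the fundamental
  theorem of calculus.\<close>

lemma integral_half_open:
  fixes h :: "real \<Rightarrow> complex"
  assumes "continuous_on UNIV h"
  shows "(\<integral>t. indicator {0..<L} t *\<^sub>R h t \<partial>lborel) = (\<integral>t. indicator {0..L} t *\<^sub>R h t \<partial>lborel)"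
proof (rule integral_cong_AE)
  note [measurable] = borel_measurable_continuous_onI[OF assms]
  show "(\<lambda>t. indicator {0..<L} t *\<^sub>R h t) \<in> borel_measurable lborel"
    "(\<lambda>t. indicator {0..L} t *\<^sub>R h t) \<in> borel_measurable lborel" by measurable
  show "AE t in lborel. indicator {0..<L} t *\<^sub>R h t = indicator {0..L} t *\<^sub>R h t"
    using AE_lborel_singleton[of L] by eventually_elim (auto simp: indicator_def)
qed

lemma pd_line:
  assumes "\<And>p. g differentiable (at p)"
  shows "((\<lambda>t. g (p + t *\<^sub>R d)) has_vector_derivative pd d g (p + t *\<^sub>R d)) (at t)"
proof -
  have "(g has_derivative frechet_derivative g (at (p + t *\<^sub>R d))) (at (p + t *\<^sub>R d))"
    using assms by (simp add: frechet_derivative_works[symmetric])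
  moreover have "((\<lambda>t. p + t *\<^sub>R d) has_derivative (\<lambda>s. s *\<^sub>R d)) (at t)"
    by (auto intro!: derivative_eq_intros)
  ultimately have "((\<lambda>t. g (p + t *\<^sub>R d)) has_derivative
      (\<lambda>s. frechet_derivative g (at (p + t *\<^sub>R d)) (s *\<^sub>R d))) (at t)"
    using has_derivative_compose by blast
  moreover have "linear (frechet_derivative g (at (p + t *\<^sub>R d)))"
    using assms linear_frechet_derivative by blast
  ultimately show ?thesis
    by (simp add: has_vector_derivative_def pd_def linear_cmul)
qed

lemma FTC_line:
  assumes g: "\<And>p. g differentiable (at p)" "continuous_on UNIV (pd d g)" and "0 \<le> c"
  shows "(\<integral>t. indicator {0..c} t *\<^sub>R pd d g (p + t *\<^sub>R d) \<partial>lborel) = g (p + c *\<^sub>R d) - g p"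
proof -
  have "continuous_on {0..c} (\<lambda>t. pd d g (p + t *\<^sub>R d))"
    by (intro continuous_on_compose2[OF g(2)]) (auto intro!: continuous_intros)
  then show ?thesis
    using integral_FTC_atLeastAtMost[of 0 c "\<lambda>t. g (p + t *\<^sub>R d)" "\<lambda>t. pd d g (p + t *\<^sub>R d)"]
      has_vector_derivative_at_within[OF pd_line[OF g(1)]] \<open>0 \<le> c\<close> by simp
qed

lemma integral_pdx:
  assumes g: "\<And>p. g differentiable (at p)" "continuous_on UNIV (pdx g)"
    and per: "\<And>x y z. g (x + L, y, z) = g (x, y, z)"
  shows "(\<integral>p. pdx g p \<partial>M) = 0"
proof -
  define F where "F = (\<lambda>x. \<lambda>(y,z). indicator cell (x,y,z) *\<^sub>R pdx g (x,y,z))"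
  have int: "integrable (lborel \<Otimes>\<^sub>M lborel) (case_prod F)"
    using continuous_integrable[OF g(2)]
    by (simp add: integrable_M lborel_prod F_def case_prod_beta')
  have "(\<integral>p. pdx g p \<partial>M) = integral\<^sup>L (lborel \<Otimes>\<^sub>M lborel) (case_prod F)"
    by (simp add: integral_M lborel_prod F_def case_prod_beta')
  also have "\<dots> = (\<integral>q. (\<integral>x. F x q \<partial>lborel) \<partial>lborel)"
    by (rule lborel_pair.integral_snd[OF int, symmetric])
  also have "(\<lambda>q. \<integral>x. F x q \<partial>lborel) = (\<lambda>q. 0)"
  proof
    fix q :: "real \<times> real"
    obtain y z where q: "q = (y,z)" by force
    have "(\<integral>x. F x q \<partial>lborel) =
        (\<integral>x. indicator ({0..<L} \<times> {0..a}) (y,z) *\<^sub>R (indicator {0..<L} x *\<^sub>R pdx g (x,y,z)) \<partial>lborel)"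
      by (intro Bochner_Integration.integral_cong) (auto simp: F_def q indicator_def)
    also have "\<dots> = indicator ({0..<L} \<times> {0..a}) (y,z) *\<^sub>R (\<integral>x. indicator {0..<L} x *\<^sub>R pdx g (x,y,z) \<partial>lborel)"
      by (rule Bochner_Integration.integral_scaleR_right)
    also have "(\<integral>x. indicator {0..<L} x *\<^sub>R pdx g (x,y,z) \<partial>lborel) = (\<integral>x. indicator {0..L} x *\<^sub>R pdx g (x,y,z) \<partial>lborel)"
      by (intro integral_half_open continuous_on_compose2[OF g(2)]) (auto intro!: continuous_intros)
    also have "\<dots> = 0"
      using FTC_line[OF g, of L "(0,y,z)"] L per[of 0 y z] by simp
    finally show "(\<integral>x. F x q \<partial>lborel) = 0" by simp
  qed
  finally show ?thesis by simp
qed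

text \<open>Fubini gives integrability of a slice only for almost every x, so the hypothesis on
  slices is conditional on it. It serves the y and z directions, which sit in the inner pair and
  require a second use of Fubini.\<close>

lemma integral_M_slices_zero:
  fixes f :: sfield
  assumes f: "integrable M f"
    and slice: "\<And>x. integrable lborel (\<lambda>q. indicator cell (x, q) *\<^sub>R f (x, q)) \<Longrightarrow>
      (\<integral>q. indicator cell (x, q) *\<^sub>R f (x, q) \<partial>lborel) = 0"
  shows "(\<integral>p. f p \<partial>M) = 0"
proof -
  define F where "F = (\<lambda>x q. indicator cell (x, q) *\<^sub>R f (x, q))"
  have int: "integrable (lborel \<Otimes>\<^sub>M lborel) (case_prod F)"
    using f by (simp add: integrable_M lborel_prod F_def case_prod_beta')
  have "(\<integral>p. f p \<partial>M) = integral\<^sup>L (lborel \<Otimes>\<^sub>M lborel) (case_prod F)"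
    by (simp add: integral_M lborel_prod F_def case_prod_beta')
  also have "\<dots> = (\<integral>x. (\<integral>q. F x q \<partial>lborel) \<partial>lborel)"
    by (rule lborel_pair.integral_fst[OF int, symmetric])
  also have "\<dots> = (\<integral>x. 0 \<partial>(lborel :: real measure))"
  proof (rule integral_cong_AE)
    show "AE x in lborel. (\<integral>q. F x q \<partial>lborel) = 0"
      using lborel_pair.AE_integrable_fst[OF int] unfolding F_def
      by eventually_elim (rule slice)
  qed (use lborel_pair.integrable_fst[OF int] in auto)
  finally show ?thesis by simp
qed

lemma integral_pdy:
  assumes g: "\<And>p. g differentiable (at p)" "continuous_on UNIV (pdy g)"
    and per: "\<And>x y z. g (x, y + L, z) = g (x, y, z)"
  shows "(\<integral>p. pdy g p \<partial>M) = 0"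
proof (rule integral_M_slices_zero[OF continuous_integrable[OF g(2)]])
  fix x
  define F where "F = (\<lambda>q. indicator cell (x, q) *\<^sub>R pdy g (x, q))"
  assume "integrable lborel (\<lambda>q. indicator cell (x, q) *\<^sub>R pdy g (x, q))"
  then have "integrable lborel F" by (simp only: F_def)
  then have "integrable (lborel \<Otimes>\<^sub>M lborel) (case_prod (\<lambda>y z. F (y,z)))"
    by (simp add: lborel_prod)
  from lborel_pair.integral_snd[OF this]
  have "(\<integral>q. F q \<partial>lborel) = (\<integral>z. (\<integral>y. F (y,z) \<partial>lborel) \<partial>lborel)"
    by (simp add: lborel_prod)
  also have "(\<lambda>z. \<integral>y. F (y,z) \<partial>lborel) = (\<lambda>z. 0)"
  proof
    fix z
    have "(\<integral>y. F (y,z) \<partial>lborel) =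
        (\<integral>y. indicator ({0..<L} \<times> {0..a}) (x,z) *\<^sub>R (indicator {0..<L} y *\<^sub>R pdy g (x,y,z)) \<partial>lborel)"
      by (intro Bochner_Integration.integral_cong) (auto simp: F_def indicator_def)
    also have "\<dots> = indicator ({0..<L} \<times> {0..a}) (x,z) *\<^sub>R (\<integral>y. indicator {0..<L} y *\<^sub>R pdy g (x,y,z) \<partial>lborel)"
      by (rule Bochner_Integration.integral_scaleR_right)
    also have "(\<integral>y. indicator {0..<L} y *\<^sub>R pdy g (x,y,z) \<partial>lborel) = (\<integral>y. indicator {0..L} y *\<^sub>R pdy g (x,y,z) \<partial>lborel)"
      by (intro integral_half_open continuous_on_compose2[OF g(2)]) (auto intro!: continuous_intros)
    also have "\<dots> = 0"
      using FTC_line[OF g, of L "(x,0,z)"] L per[of x 0 z] by simp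
    finally show "(\<integral>y. F (y,z) \<partial>lborel) = 0" by simp
  qed
  finally show "(\<integral>q. indicator cell (x, q) *\<^sub>R pdy g (x, q) \<partial>lborel) = 0" by (simp add: F_def)
qed

lemma integral_pdz:
  assumes g: "\<And>p. g differentiable (at p)" "continuous_on UNIV (pdz g)"
    and plates: "\<And>x y. g (x, y, 0) = 0" "\<And>x y. g (x, y, a) = 0"
  shows "(\<integral>p. pdz g p \<partial>M) = 0"
proof (rule integral_M_slices_zero[OF continuous_integrable[OF g(2)]])
  fix x
  define F where "F = (\<lambda>q. indicator cell (x, q) *\<^sub>R pdz g (x, q))"
  assume "integrable lborel (\<lambda>q. indicator cell (x, q) *\<^sub>R pdz g (x, q))"
  then have "integrable lborel F" by (simp only: F_def)
  then have "integrable (lborel \<Otimes>\<^sub>M lborel) (case_prod (\<lambda>y z. F (y,z)))"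
    by (simp add: lborel_prod)
  from lborel_pair.integral_fst[OF this]
  have "(\<integral>q. F q \<partial>lborel) = (\<integral>y. (\<integral>z. F (y,z) \<partial>lborel) \<partial>lborel)"
    by (simp add: lborel_prod)
  also have "(\<lambda>y. \<integral>z. F (y,z) \<partial>lborel) = (\<lambda>y. 0)"
  proof
    fix y
    have "(\<integral>z. F (y,z) \<partial>lborel) =
        (\<integral>z. indicator ({0..<L} \<times> {0..<L}) (x,y) *\<^sub>R (indicator {0..a} z *\<^sub>R pdz g (x,y,z)) \<partial>lborel)"
      by (intro Bochner_Integration.integral_cong) (auto simp: F_def indicator_def)
    also have "\<dots> = indicator ({0..<L} \<times> {0..<L}) (x,y) *\<^sub>R (\<integral>z. indicator {0..a} z *\<^sub>R pdz g (x,y,z) \<partial>lborel)"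
      by (rule Bochner_Integration.integral_scaleR_right)
    also have "\<dots> = 0"
      using FTC_line[OF g, of a "(x,y,0)"] a plates by simp
    finally show "(\<integral>z. F (y,z) \<partial>lborel) = 0" by simp
  qed
  finally show "(\<integral>q. indicator cell (x, q) *\<^sub>R pdz g (x, q) \<partial>lborel) = 0" by (simp add: F_def)
qed

subsection \<open>The Hilbert space of scalar functions\<close>

lemma L2_iff: "f \<in> L2 L a \<longleftrightarrow> f \<in> borel_measurable M \<and> integrable M (\<lambda>p. (norm (f p))\<^sup>2)"
  by (simp add: L2_def)

lemma L2_measurable: "f \<in> L2 L a \<Longrightarrow> f \<in> borel_measurable M"
  by (simp add: L2_def)

lemma L2_by_bound:
  fixes f :: "pt \<Rightarrow> 'b::euclidean_space"
  assumes "f \<in> borel_measurable M" "integrable M g" "\<And>p. p \<in> cell \<Longrightarrow> (norm (f p))\<^sup>2 \<le> g p"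
  shows "f \<in> L2 L a"
proof -
  have "integrable M (\<lambda>p. (norm (f p))\<^sup>2)"
    using assms by (intro Bochner_Integration.integrable_bound[OF assms(2)] AE_I2)
      (auto simp: space_M intro: order_trans[OF assms(3) abs_ge_self])
  then show ?thesis using assms(1) by (simp add: L2_iff)
qed

lemma L2_bounded:
  fixes f :: "pt \<Rightarrow> 'b::euclidean_space"
  assumes "f \<in> borel_measurable M" "\<And>p. p \<in> cell \<Longrightarrow> norm (f p) \<le> K"
  shows "f \<in> L2 L a"
  using assms by (intro L2_by_bound[of _ "\<lambda>_. K\<^sup>2"]) (auto intro!: power_mono)

lemma L2_continuous:
  fixes f :: "pt \<Rightarrow> 'b::euclidean_space"
  assumes "continuous_on UNIV f" shows "f \<in> L2 L a"
proof -
  obtain K where "\<And>p. p \<in> cell \<Longrightarrow> norm (f p) \<le> K" using continuous_bounded[OF assms] by blast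
  then show ?thesis by (rule L2_bounded[OF continuous_measurable_M[OF assms]])
qed

lemma L2_mult_bounded:
  fixes f h :: sfield
  assumes "f \<in> L2 L a" "h \<in> borel_measurable M" "\<And>p. p \<in> cell \<Longrightarrow> norm (h p) \<le> K"
  shows "(\<lambda>p. h p * f p) \<in> L2 L a"
proof (rule L2_by_bound)
  show "integrable M (\<lambda>p. K\<^sup>2 * (norm (f p))\<^sup>2)" using assms(1) by (simp add: L2_iff)
  show "(norm (h p * f p))\<^sup>2 \<le> K\<^sup>2 * (norm (f p))\<^sup>2" if "p \<in> cell" for p
    using assms(3)[OF that] by (auto simp: norm_mult power_mult_distrib intro!: mult_right_mono power_mono)
qed (use assms in \<open>auto simp: L2_iff\<close>)

lemma L2_add:
  fixes f g :: "pt \<Rightarrow> 'b::euclidean_space"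
  assumes "f \<in> L2 L a" "g \<in> L2 L a" shows "(\<lambda>p. f p + g p) \<in> L2 L a"
proof (rule L2_by_bound)
  show "integrable M (\<lambda>p. 2 * (norm (f p))\<^sup>2 + 2 * (norm (g p))\<^sup>2)"
    using assms by (auto simp: L2_iff)
  show "(norm (f p + g p))\<^sup>2 \<le> 2 * (norm (f p))\<^sup>2 + 2 * (norm (g p))\<^sup>2" for p
  proof -
    have "(norm (f p + g p))\<^sup>2 \<le> (norm (f p) + norm (g p))\<^sup>2"
      by (intro power_mono norm_triangle_ineq) auto
    also have "\<dots> \<le> 2 * (norm (f p))\<^sup>2 + 2 * (norm (g p))\<^sup>2"
      using sum_squares_bound[of "norm (f p)" "norm (g p)"] by (simp add: power2_sum)
    finally show ?thesis .
  qed
qed (use assms in \<open>auto simp: L2_iff\<close>)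

lemma L2_cmult: "f \<in> L2 L a \<Longrightarrow> (\<lambda>p. c * f p) \<in> L2 L a" for f :: sfield
  by (rule L2_mult_bounded[of _ _ "norm c"]) auto

lemma L2_diff: "f \<in> L2 L a \<Longrightarrow> g \<in> L2 L a \<Longrightarrow> (\<lambda>p. f p - g p) \<in> L2 L a" for f :: sfield
  using L2_add[OF _ L2_cmult[of g "-1"], of f] by simp

lemma L2_const: "(\<lambda>p. c) \<in> L2 L a" for c :: "'b::euclidean_space"
  by (rule L2_continuous) auto

lemma L2_sum: "(\<And>i. i \<in> B \<Longrightarrow> f i \<in> L2 L a) \<Longrightarrow> (\<lambda>p. \<Sum>i\<in>B. f i p) \<in> L2 L a" for f :: "'i \<Rightarrow> sfield"
  by (induction B rule: infinite_finite_induct) (auto intro: L2_add L2_const)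

lemma L2_cnj: "f \<in> L2 L a \<Longrightarrow> (\<lambda>p. cnj (f p)) \<in> L2 L a"
  unfolding L2_iff by (auto intro: measurable_cnj)

lemma integrable_norm_mult:
  fixes f g :: sfield
  assumes "f \<in> L2 L a" "g \<in> L2 L a" shows "integrable M (\<lambda>p. norm (f p) * norm (g p))"
proof (rule Bochner_Integration.integrable_bound)
  show "integrable M (\<lambda>p. (norm (f p))\<^sup>2 + (norm (g p))\<^sup>2)"
    using assms by (auto simp: L2_iff)
  have "norm (norm x * norm y) \<le> norm ((norm x)\<^sup>2 + (norm y)\<^sup>2)" for x y :: complex
  proof -
    have "norm x * norm y \<le> (norm x)\<^sup>2 + (norm y)\<^sup>2"
      using sum_squares_bound[of "norm x" "norm y"] mult_nonneg_nonneg[OF norm_ge_zero norm_ge_zero, of x y] by linarith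
    then show ?thesis by simp
  qed
  then show "AE p in M. norm (norm (f p) * norm (g p)) \<le> norm ((norm (f p))\<^sup>2 + (norm (g p))\<^sup>2)"
    by simp
qed (use assms in \<open>auto simp: L2_iff\<close>)

lemma integrable_mult_L2:
  fixes f g :: sfield
  assumes "f \<in> L2 L a" "g \<in> L2 L a" shows "integrable M (\<lambda>p. f p * g p)"
  by (rule Bochner_Integration.integrable_bound[OF integrable_norm_mult[OF assms]])
    (use assms in \<open>auto simp: L2_iff norm_mult\<close>)

lemma integrable_L2: "f \<in> L2 L a \<Longrightarrow> integrable M f" for f :: sfield
  using integrable_mult_L2[OF _ L2_const[of 1], of f] by simp

lemma nm_sq: "(nm f)\<^sup>2 = (\<integral>p. (norm (f p))\<^sup>2 \<partial>M)"
  by (simp add: L2_norm_def)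

lemma nm_nonneg: "0 \<le> nm f"
  by (simp add: L2_norm_def)

text \<open>The discriminant argument for the nonnegative quadratic in t given by the integral of
  (|f| - t |g|)^2.\<close>

lemma Cauchy_Schwarz_norm:
  fixes f g :: sfield
  assumes f: "f \<in> L2 L a" and g: "g \<in> L2 L a"
  shows "(\<integral>p. norm (f p) * norm (g p) \<partial>M) \<le> nm f * nm g"
proof -
  define A B P where "A = (nm f)\<^sup>2" "B = (nm g)\<^sup>2" "P = (\<integral>p. norm (f p) * norm (g p) \<partial>M)"
  have quad: "0 \<le> A - 2 * t * P + t\<^sup>2 * B" for t
  proof -
    have "0 \<le> (\<integral>p. (norm (f p) - t * norm (g p))\<^sup>2 \<partial>M)" by simp
    also have "\<dots> = (\<integral>p. (norm (f p))\<^sup>2 - 2 * t * (norm (f p) * norm (g p)) + t\<^sup>2 * (norm (g p))\<^sup>2 \<partial>M)"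
      by (simp add: power2_eq_square algebra_simps)
    also have "\<dots> = A - 2 * t * P + t\<^sup>2 * B"
      using integrable_norm_mult[OF f g] f g by (simp add: L2_iff A_B_P_def nm_sq)
    finally show ?thesis .
  qed
  have P: "0 \<le> P" by (simp add: A_B_P_def)
  have "P\<^sup>2 \<le> A * B"
  proof (cases "B = 0")
    case True
    have "P = 0"
    proof (rule ccontr)
      assume "P \<noteq> 0"
      \<comment> \<open>For B = 0 the quadratic is affine in t, and this t gives it the value
        -1.\<close>
      with quad[of "(A + 1) / (2 * P)"] True show False by simp
    qed
    then show ?thesis using True by simp
  next
    case False
    then have "B > 0" by (simp add: A_B_P_def)
    \<comment> \<open>The minimiser of the quadratic.\<close>
    with quad[of "P / B"] show ?thesis by (simp add: field_simps power2_eq_square)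
  qed
  then have "P\<^sup>2 \<le> (nm f * nm g)\<^sup>2" by (simp add: A_B_P_def power_mult_distrib)
  then show ?thesis
    using nm_nonneg[of f] nm_nonneg[of g] by (simp add: power2_le_iff_abs_le A_B_P_def)
qed

lemma Cauchy_Schwarz:
  fixes f g :: sfield
  assumes "f \<in> L2 L a" "g \<in> L2 L a"
  shows "norm (\<integral>p. f p * g p \<partial>M) \<le> nm f * nm g"
  using integral_norm_bound[of M "\<lambda>p. f p * g p"] Cauchy_Schwarz_norm[OF assms]
  by (simp add: norm_mult)

lemma nm_triangle:
  fixes f g :: sfield
  assumes f: "f \<in> L2 L a" and g: "g \<in> L2 L a"
  shows "nm (\<lambda>p. f p + g p) \<le> nm f + nm g"
proof -
  have "(nm (\<lambda>p. f p + g p))\<^sup>2 \<le> (\<integral>p. (norm (f p))\<^sup>2 + 2 * (norm (f p) * norm (g p)) + (norm (g p))\<^sup>2 \<partial>M)"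
    unfolding nm_sq
  proof (rule integral_mono)
    show "integrable M (\<lambda>p. (norm (f p + g p))\<^sup>2)" using L2_add[OF f g] by (simp add: L2_iff)
    show "integrable M (\<lambda>p. (norm (f p))\<^sup>2 + 2 * (norm (f p) * norm (g p)) + (norm (g p))\<^sup>2)"
      using integrable_norm_mult[OF f g] f g by (simp add: L2_iff)
    fix p
    have "(norm (f p + g p))\<^sup>2 \<le> (norm (f p) + norm (g p))\<^sup>2"
      by (intro power_mono norm_triangle_ineq) auto
    then show "(norm (f p + g p))\<^sup>2 \<le> (norm (f p))\<^sup>2 + 2 * (norm (f p) * norm (g p)) + (norm (g p))\<^sup>2"
      by (simp add: power2_sum)
  qed
  also have "\<dots> = (nm f)\<^sup>2 + 2 * (\<integral>p. norm (f p) * norm (g p) \<partial>M) + (nm g)\<^sup>2"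
    using integrable_norm_mult[OF f g] f g by (simp add: L2_iff nm_sq)
  also have "\<dots> \<le> (nm f + nm g)\<^sup>2"
    using Cauchy_Schwarz_norm[OF f g] by (simp add: power2_sum)
  finally show ?thesis
    using nm_nonneg[of f] nm_nonneg[of g] by (simp add: power2_le_iff_abs_le)
qed

lemma nm_minus_commute: "nm (\<lambda>p. f p - g p) = nm (\<lambda>p. g p - f p)"
  by (simp add: L2_norm_def norm_minus_commute)

lemma ip_integrable: "f \<in> L2 L a \<Longrightarrow> g \<in> L2 L a \<Longrightarrow> integrable M (\<lambda>p. f p * cnj (g p))"
  by (intro integrable_mult_L2 L2_cnj)

lemma ip_add_left: "f \<in> L2 L a \<Longrightarrow> g \<in> L2 L a \<Longrightarrow> h \<in> L2 L a \<Longrightarrow> ip (\<lambda>p. f p + g p) h = ip f h + ip g h"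
  unfolding s_inner_def by (simp add: distrib_right ip_integrable)

lemma ip_diff_left: "f \<in> L2 L a \<Longrightarrow> g \<in> L2 L a \<Longrightarrow> h \<in> L2 L a \<Longrightarrow> ip (\<lambda>p. f p - g p) h = ip f h - ip g h"
  unfolding s_inner_def by (simp add: left_diff_distrib ip_integrable)

lemma ip_cmult_left: "ip (\<lambda>p. c * f p) h = c * ip f h"
  unfolding s_inner_def by (simp add: mult.assoc)

lemma ip_sum_left: "(\<And>i. i \<in> B \<Longrightarrow> f i \<in> L2 L a) \<Longrightarrow> h \<in> L2 L a \<Longrightarrow> ip (\<lambda>p. \<Sum>i\<in>B. f i p) h = (\<Sum>i\<in>B. ip (f i) h)"
  unfolding s_inner_def by (simp add: sum_distrib_right ip_integrable)

lemma ip_cnj: "cnj (ip f g) = ip g f"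
  unfolding s_inner_def by (subst Bochner_Integration.integral_cnj[symmetric]) (simp add: mult.commute)

lemma ip_self: "ip f f = of_real ((nm f)\<^sup>2)"
  unfolding s_inner_def nm_sq complex_norm_square[symmetric] by (rule integral_complex_of_real)

lemma ip_cong_AE:
  assumes "f \<in> L2 L a" "f' \<in> L2 L a" "g \<in> L2 L a" "AE p in M. f p = f' p"
  shows "ip f g = ip f' g"
  unfolding s_inner_def
  using assms by (intro integral_cong_AE) (auto simp: L2_iff)

section \<open>Convergence and completeness in L2\<close>

definition l2conv :: "(nat \<Rightarrow> sfield) \<Rightarrow> sfield \<Rightarrow> bool" where
  "l2conv X f \<longleftrightarrow> (\<forall>n. X n \<in> L2 L a) \<and> f \<in> L2 L a \<and> (\<lambda>n. nm (\<lambda>p. X n p - f p)) \<longlonglongrightarrow> 0"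

lemma l2conv_integral:
  assumes "l2conv X f" "g \<in> L2 L a"
  shows "(\<lambda>n. \<integral>p. X n p * g p \<partial>M) \<longlonglongrightarrow> (\<integral>p. f p * g p \<partial>M)"
proof -
  have X: "\<And>n. X n \<in> L2 L a" "f \<in> L2 L a" and lim: "(\<lambda>n. nm (\<lambda>p. X n p - f p)) \<longlonglongrightarrow> 0"
    using assms by (auto simp: l2conv_def)
  have bd: "norm ((\<integral>p. X n p * g p \<partial>M) - (\<integral>p. f p * g p \<partial>M)) \<le> nm (\<lambda>p. X n p - f p) * nm g" for n
  proof -
    have "(\<integral>p. X n p * g p \<partial>M) - (\<integral>p. f p * g p \<partial>M) = (\<integral>p. (X n p - f p) * g p \<partial>M)"
      unfolding left_diff_distrib
      by (rule Bochner_Integration.integral_diff[symmetric]) (intro integrable_mult_L2 X assms)+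
    then show ?thesis using Cauchy_Schwarz[OF L2_diff[OF X(1) X(2)] assms(2), of n] by simp
  qed
  have "(\<lambda>n. nm (\<lambda>p. X n p - f p) * nm g) \<longlonglongrightarrow> 0"
    using tendsto_mult_left_zero[OF lim] .
  then have "(\<lambda>n. (\<integral>p. X n p * g p \<partial>M) - (\<integral>p. f p * g p \<partial>M)) \<longlonglongrightarrow> 0"
    by (rule Lim_null_comparison[rotated]) (rule always_eventually, rule allI, rule bd)
  then show ?thesis by (rule LIM_zero_cancel)
qed

lemma l2conv_ip: "l2conv X f \<Longrightarrow> g \<in> L2 L a \<Longrightarrow> (\<lambda>n. ip (X n) g) \<longlonglongrightarrow> ip f g"
  unfolding s_inner_def by (intro l2conv_integral L2_cnj)

text \<open>The form of dominated convergence used throughout: an L2 factor, integrable because the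
  measure is finite, against uniformly bounded factors converging almost everywhere. It serves
  cutoffs, polynomial approximations and indicator functions.\<close>

lemma dominated_mult:
  fixes f :: sfield
  assumes "f \<in> L2 L a" "\<And>n. h n \<in> borel_measurable M" "h' \<in> borel_measurable M"
    "\<And>n p. p \<in> cell \<Longrightarrow> norm (h n p) \<le> K" "AE p in M. (\<lambda>n. h n p) \<longlonglongrightarrow> h' p"
  shows "(\<lambda>n. \<integral>p. f p * h n p \<partial>M) \<longlonglongrightarrow> (\<integral>p. f p * h' p \<partial>M)"
proof (rule integral_dominated_convergence[where w="\<lambda>p. K * norm (f p)"])
  show "integrable M (\<lambda>p. K * norm (f p))" using integrable_L2[OF assms(1)] by simp
  show "AE p in M. (\<lambda>n. f p * h n p) \<longlonglongrightarrow> f p * h' p"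
    using assms(5) by eventually_elim (auto intro: tendsto_mult)
  show "AE p in M. norm (f p * h n p) \<le> K * norm (f p)" for n
  proof (rule AE_I2)
    fix p assume "p \<in> space M"
    then show "norm (f p * h n p) \<le> K * norm (f p)"
      using mult_left_mono[OF assms(4) norm_ge_zero[of "f p"], of p n] by (simp add: space_M norm_mult mult.commute)
  qed
  note [measurable] = L2_measurable[OF assms(1)] assms(2,3)
  show "(\<lambda>p. f p * h' p) \<in> borel_measurable M" "\<And>n. (\<lambda>p. f p * h n p) \<in> borel_measurable M"
    by measurable
qed

text \<open>A subsequence with increments below 2^-k converges almost everywhere, Fatou controls its
  L2 distance to the limit, and the Cauchy property carries this over to the whole sequence.\<close>

lemma L2_complete:
  assumes X: "\<And>n. X n \<in> L2 L a"
    and Cauchy: "\<And>e. e > 0 \<Longrightarrow> \<exists>N. \<forall>m\<ge>N. \<forall>n\<ge>N. nm (\<lambda>p. X m p - X n p) < e"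
  shows "\<exists>f. l2conv X f"
proof -
  have "\<exists>r. \<forall>k. (\<forall>m\<ge>r k. \<forall>n\<ge>r k. nm (\<lambda>p. X m p - X n p) < (1/2)^k) \<and> r k \<le> r (Suc k)"
  proof (rule dependent_nat_choice)
    show "\<exists>x. \<forall>m\<ge>x. \<forall>n\<ge>x. nm (\<lambda>p. X m p - X n p) < (1/2)^0" using Cauchy[of 1] by simp
    fix x k
    obtain N where "\<forall>m\<ge>N. \<forall>n\<ge>N. nm (\<lambda>p. X m p - X n p) < (1/2)^Suc k"
      using Cauchy[of "(1/2)^Suc k"] by auto
    then show "\<exists>y. (\<forall>m\<ge>y. \<forall>n\<ge>y. nm (\<lambda>p. X m p - X n p) < (1/2)^Suc k) \<and> x \<le> y"
      by (intro exI[of _ "max x N"]) auto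
  qed
  then obtain r where r: "\<And>k m n. r k \<le> m \<Longrightarrow> r k \<le> n \<Longrightarrow> nm (\<lambda>p. X m p - X n p) < (1/2)^k"
    and rS: "\<And>k. r k \<le> r (Suc k)" by blast
  have rmono: "r k \<le> r n" if "k \<le> n" for k n
    using that rS by (rule lift_Suc_mono_le[rotated])
  define d where "d k p = X (r (Suc k)) p - X (r k) p" for k p
  have d: "d k \<in> L2 L a" for k unfolding d_def by (intro L2_diff X)
  have [measurable]: "X k \<in> borel_measurable M" "d k \<in> borel_measurable M" for k
    using X d L2_measurable by blast+
  \<comment> \<open>Cauchy-Schwarz against the constant 1 turns the L2 bound on the increments into
    a summable L1 bound.\<close>
  have dint: "(\<integral>p. norm (d k p) \<partial>M) \<le> (1/2)^k * nm (\<lambda>p. 1)" for k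
  proof -
    have "(\<integral>p. norm (d k p) \<partial>M) \<le> nm (d k) * nm (\<lambda>p. 1)"
      using Cauchy_Schwarz_norm[OF d L2_const[of 1], of k] by simp
    also have "\<dots> \<le> (1/2)^k * nm (\<lambda>p. 1)"
    proof (rule mult_right_mono[OF _ nm_nonneg])
      have "d k = (\<lambda>p. X (r (Suc k)) p - X (r k) p)" by (simp add: d_def fun_eq_iff)
      then show "nm (d k) \<le> (1/2)^k" using r[of k "r (Suc k)" "r k"] rS[of k] by simp
    qed
    finally show ?thesis .
  qed
  have "summable (\<lambda>k. (\<integral>p. norm (d k p) \<partial>M))"
    by (rule summable_comparison_test'[where g="\<lambda>k. (1/2)^k * nm (\<lambda>p. 1)"])
      (use dint in \<open>auto intro!: summable_mult2 summable_geometric\<close>)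
  then have "(\<Sum>k. ennreal (\<integral>p. norm (d k p) \<partial>M)) \<noteq> \<infinity>"
    by (simp add: suminf_ennreal2)
  moreover have "(\<integral>\<^sup>+p. (\<Sum>k. ennreal (norm (d k p))) \<partial>M) = (\<Sum>k. ennreal (\<integral>p. norm (d k p) \<partial>M))"
    using integrable_L2[OF d] by (subst nn_integral_suminf) (auto simp: nn_integral_eq_integral)
  ultimately have "AE p in M. (\<Sum>k. ennreal (norm (d k p))) \<noteq> \<infinity>"
    by (intro nn_integral_PInf_AE) auto
  then have conv: "AE p in M. (\<lambda>k. X (r k) p) \<longlonglongrightarrow> lim (\<lambda>k. X (r k) p)"
  proof eventually_elim
    case (elim p)
    then have "summable (\<lambda>k. norm (d k p))"
      by (intro summable_suminf_not_top) auto
    then have "summable (\<lambda>k. d k p)" by (rule summable_norm_cancel)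
    then have "convergent (\<lambda>n. \<Sum>k<n. d k p)" by (simp add: summable_iff_convergent)
    then have "convergent (\<lambda>n. X (r 0) p + (\<Sum>k<n. d k p))" by (simp add: convergent_add convergent_const)
    moreover have "X (r 0) p + (\<Sum>k<n. d k p) = X (r n) p" for n
      by (simp add: d_def sum_lessThan_telescope[of "\<lambda>n. X (r n) p"])
    ultimately show ?case by (simp add: convergent_LIMSEQ_iff)
  qed
  define f where "f p = lim (\<lambda>k. X (r k) p)" for p
  have f[measurable]: "f \<in> borel_measurable M" unfolding f_def by measurable
  \<comment> \<open>Here k is fixed and n tends to infinity: the Cauchy estimate valid from rank
    \<open>r k\<close> on passes to the limit.\<close>
  have Fatou: "(\<integral>\<^sup>+p. ennreal ((norm (X (r k) p - f p))\<^sup>2) \<partial>M) \<le> ennreal (((1/2)^k)\<^sup>2)" for k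
  proof -
    have "(\<integral>\<^sup>+p. ennreal ((norm (X (r k) p - f p))\<^sup>2) \<partial>M) =
        (\<integral>\<^sup>+p. liminf (\<lambda>n. ennreal ((norm (X (r k) p - X (r n) p))\<^sup>2)) \<partial>M)"
    proof (rule nn_integral_cong_AE)
      show "AE p in M. ennreal ((norm (X (r k) p - f p))\<^sup>2) = liminf (\<lambda>n. ennreal ((norm (X (r k) p - X (r n) p))\<^sup>2))"
        using conv
      proof eventually_elim
        case (elim p)
        then have "(\<lambda>n. ennreal ((norm (X (r k) p - X (r n) p))\<^sup>2)) \<longlonglongrightarrow> ennreal ((norm (X (r k) p - f p))\<^sup>2)"
          unfolding f_def by (intro tendsto_intros tendsto_ennrealI)
        then show ?case using lim_imp_Liminf[OF sequentially_bot] by metis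
      qed
    qed
    also have "\<dots> \<le> liminf (\<lambda>n. \<integral>\<^sup>+p. ennreal ((norm (X (r k) p - X (r n) p))\<^sup>2) \<partial>M)"
      by (rule nn_integral_liminf) measurable
    also have "\<dots> \<le> ennreal (((1/2)^k)\<^sup>2)"
    proof (rule Liminf_le)
      show "\<forall>\<^sub>F n in sequentially. (\<integral>\<^sup>+p. ennreal ((norm (X (r k) p - X (r n) p))\<^sup>2) \<partial>M) \<le> ennreal (((1/2)^k)\<^sup>2)"
        using eventually_ge_at_top[of k]
      proof eventually_elim
        case (elim n)
        have "(\<integral>\<^sup>+p. ennreal ((norm (X (r k) p - X (r n) p))\<^sup>2) \<partial>M) = ennreal ((nm (\<lambda>p. X (r k) p - X (r n) p))\<^sup>2)"
          unfolding nm_sq using L2_diff[OF X X] by (intro nn_integral_eq_integral) (auto simp: L2_iff)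
        also have "\<dots> \<le> ennreal (((1/2)^k)\<^sup>2)"
          using r[of k "r k" "r n"] rmono[OF elim] by (intro ennreal_leI power_mono nm_nonneg) auto
        finally show ?case .
      qed
    qed simp
    finally show ?thesis .
  qed
  have dL2: "(\<lambda>p. X (r k) p - f p) \<in> L2 L a" for k
  proof -
    have "(\<integral>\<^sup>+p. ennreal ((norm (X (r k) p - f p))\<^sup>2) \<partial>M) < \<infinity>"
      using Fatou[of k] by (simp add: order_le_less_trans)
    then show ?thesis
      unfolding L2_iff by (auto intro!: integrableI_bounded)
  qed
  have fL2: "f \<in> L2 L a" using L2_diff[OF X dL2, of "r 0" 0] by simp
  have dn: "nm (\<lambda>p. X (r k) p - f p) \<le> (1/2)^k" for k
  proof -
    have "ennreal ((nm (\<lambda>p. X (r k) p - f p))\<^sup>2) \<le> ennreal (((1/2)^k)\<^sup>2)"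
      unfolding nm_sq using Fatou[of k] dL2[of k]
      by (subst nn_integral_eq_integral[symmetric]) (auto simp: L2_iff)
    then have "(nm (\<lambda>p. X (r k) p - f p))\<^sup>2 \<le> ((1/2)^k)\<^sup>2"
      by (subst (asm) ennreal_le_iff) auto
    then show ?thesis using nm_nonneg by (simp add: power2_le_iff_abs_le)
  qed
  have "(\<lambda>n. nm (\<lambda>p. X n p - f p)) \<longlonglongrightarrow> 0"
  proof (rule LIMSEQ_I)
    fix e :: real assume "e > 0"
    then obtain k where k: "(1/2::real)^k < e/2" using real_arch_pow_inv[of "e/2" "1/2"] by auto
    have "nm (\<lambda>p. X n p - f p) < e" if "n \<ge> r k" for n
    proof -
      have "nm (\<lambda>p. X n p - f p) \<le> nm (\<lambda>p. X n p - X (r k) p) + nm (\<lambda>p. X (r k) p - f p)"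
        using nm_triangle[OF L2_diff[OF X[of n] X[of "r k"]] dL2[of k]] by simp
      also have "\<dots> < e" using k dn[of k] r[of k n "r k"] that by simp
      finally show ?thesis .
    qed
    then show "\<exists>N. \<forall>n\<ge>N. norm (nm (\<lambda>p. X n p - f p) - 0) < e"
      using nm_nonneg by auto
  qed
  then show ?thesis using X fL2 by (auto simp: l2conv_def)
qed

end

section \<open>Fourier modes\<close>

lemma pd_coord_eq:
  assumes "bounded_linear \<pi>" "\<And>t. (h has_vector_derivative h' t) (at t)"
  shows "pd d (\<lambda>p. h (\<pi> p)) = (\<lambda>p. \<pi> d *\<^sub>R h' (\<pi> p))"
  by (rule pd_eqI[OF pd_coord[OF assms]])

text \<open>The right-nested product with a leading constant is the exact shape of \<open>CC\<close>
  and \<open>SS\<close>, so their derivatives are obtained by rewriting.\<close>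

lemma pd_triple:
  assumes sm: "smooth1 f" "smooth1 g" "smooth1 h"
    and d: "\<And>t. (f has_vector_derivative f' t) (at t)" "\<And>t. (g has_vector_derivative g' t) (at t)"
      "\<And>t. (h has_vector_derivative h' t) (at t)"
  shows "smooth (\<lambda>p. c * (f (fst p) * (g (fst (snd p)) * h (snd (snd p)))))"
    and "pdx (\<lambda>p. c * (f (fst p) * (g (fst (snd p)) * h (snd (snd p))))) =
      (\<lambda>p. c * (f' (fst p) * (g (fst (snd p)) * h (snd (snd p)))))"
    and "pdy (\<lambda>p. c * (f (fst p) * (g (fst (snd p)) * h (snd (snd p))))) =
      (\<lambda>p. c * (f (fst p) * (g' (fst (snd p)) * h (snd (snd p)))))"
    and "pdz (\<lambda>p. c * (f (fst p) * (g (fst (snd p)) * h (snd (snd p))))) =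
      (\<lambda>p. c * (f (fst p) * (g (fst (snd p)) * h' (snd (snd p)))))"
proof -
  note bl = bounded_linear_coords
  have s: "smooth (\<lambda>p::pt. f (fst p))" "smooth (\<lambda>p::pt. g (fst (snd p)))" "smooth (\<lambda>p::pt. h (snd (snd p)))"
    using smooth_coord[OF bl(1) sm(1)] smooth_coord[OF bl(2) sm(2)] smooth_coord[OF bl(3) sm(3)] by auto
  have s2: "smooth (\<lambda>p::pt. g (fst (snd p)) * h (snd (snd p)))" by (intro smooth_mult s)
  have s3: "smooth (\<lambda>p::pt. f (fst p) * (g (fst (snd p)) * h (snd (snd p))))" by (intro smooth_mult s)
  show "smooth (\<lambda>p. c * (f (fst p) * (g (fst (snd p)) * h (snd (snd p)))))" by (intro smooth_cmult s3)
  note e = pd_cmult[OF s3] smooth_pd_mult[OF s(1) s2] smooth_pd_mult[OF s(2,3)]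
    pd_coord_eq[OF bl(1) d(1)] pd_coord_eq[OF bl(2) d(2)] pd_coord_eq[OF bl(3) d(3)]
  show "pdx (\<lambda>p. c * (f (fst p) * (g (fst (snd p)) * h (snd (snd p))))) =
      (\<lambda>p. c * (f' (fst p) * (g (fst (snd p)) * h (snd (snd p)))))"
    and "pdy (\<lambda>p. c * (f (fst p) * (g (fst (snd p)) * h (snd (snd p))))) =
      (\<lambda>p. c * (f (fst p) * (g' (fst (snd p)) * h (snd (snd p)))))"
    and "pdz (\<lambda>p. c * (f (fst p) * (g (fst (snd p)) * h (snd (snd p))))) =
      (\<lambda>p. c * (f (fst p) * (g (fst (snd p)) * h' (snd (snd p)))))"
    unfolding e by (simp_all add: fun_eq_iff)
qed

lemma cis_deriv: "((\<lambda>t. cis (b * t)) has_vector_derivative \<i> * of_real b * cis (b * t)) (at t)"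
proof -
  have "((\<lambda>t. exp ((\<i> * of_real b) * of_real t)) has_vector_derivative (\<i> * of_real b) * exp ((\<i> * of_real b) * of_real t)) (at t)"
    by (rule has_vector_derivative_real_field) (auto intro!: derivative_eq_intros)
  then show ?thesis by (simp add: cis_conv_exp mult.assoc)
qed

lemma smooth1_cis: "smooth1 (\<lambda>t. cis (b * t))"
  using smooth1_exp[of "\<i> * of_real b"] by (simp add: cis_conv_exp mult.assoc)

lemma cos_deriv: "((\<lambda>t. complex_of_real (cos (b * t))) has_vector_derivative of_real (- b * sin (b * t))) (at t)"
  by (intro has_vector_derivative_of_real) (auto intro!: derivative_eq_intros)

lemma sin_deriv: "((\<lambda>t. complex_of_real (sin (b * t))) has_vector_derivative of_real (b * cos (b * t))) (at t)"
  by (intro has_vector_derivative_of_real) (auto intro!: derivative_eq_intros)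

section \<open>Laterally periodic smooth functions\<close>

lemma smooth_perI: "smooth f \<Longrightarrow> lat_periodic L f \<Longrightarrow> f \<in> smooth_per L"
  by (simp add: smooth_per_def smooth_def)

lemma smooth_per_smooth: "f \<in> smooth_per L \<Longrightarrow> smooth f"
  by (simp add: smooth_per_def smooth_def)

lemma smooth_per_lat: "f \<in> smooth_per L \<Longrightarrow> lat_periodic L f"
  by (simp add: smooth_per_def)

lemma smooth_per_mult: "f \<in> smooth_per L \<Longrightarrow> g \<in> smooth_per L \<Longrightarrow> (\<lambda>p. f p * g p) \<in> smooth_per L"
  by (simp add: smooth_per_def lat_periodic_def Ck_mult)

lemma smooth_per_add: "f \<in> smooth_per L \<Longrightarrow> g \<in> smooth_per L \<Longrightarrow> (\<lambda>p. f p + g p) \<in> smooth_per L"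
  by (simp add: smooth_per_def lat_periodic_def Ck_add)

lemma smooth_per_const: "(\<lambda>p. c) \<in> smooth_per L"
  by (intro smooth_perI smooth_const) (auto simp: lat_periodic_def)

lemma smooth_per_cmult: "f \<in> smooth_per L \<Longrightarrow> (\<lambda>p. c * f p) \<in> smooth_per L"
  by (intro smooth_per_mult smooth_per_const)

lemma smooth_per_diff: "f \<in> smooth_per L \<Longrightarrow> g \<in> smooth_per L \<Longrightarrow> (\<lambda>p. f p - g p) \<in> smooth_per L"
  using smooth_per_add[OF _ smooth_per_cmult[of g L "-1"], of f] by simp

lemma smooth_per_sum: "(\<And>i. i \<in> B \<Longrightarrow> f i \<in> smooth_per L) \<Longrightarrow> (\<lambda>p. \<Sum>i\<in>B. f i p) \<in> smooth_per L"
  by (induction B rule: infinite_finite_induct) (auto intro: smooth_per_const smooth_per_add)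

lemma pd_periodic:
  assumes f: "smooth f" and t: "\<And>p. f (p + v) = f p"
  shows "pd d f (p + v) = pd d f p"
proof -
  have "(f has_derivative frechet_derivative f (at (p + v))) (at (p + v))"
    using smooth_differentiable[OF f] by (simp add: frechet_derivative_works[symmetric])
  moreover have "((\<lambda>p. p + v) has_derivative (\<lambda>h. h)) (at p)"
    by (auto intro!: derivative_eq_intros)
  ultimately have "((\<lambda>p. f (p + v)) has_derivative (\<lambda>h. frechet_derivative f (at (p + v)) h)) (at p)"
    using has_derivative_compose by blast
  then have "(f has_derivative frechet_derivative f (at (p + v))) (at p)"
    by (simp add: t)
  then show ?thesis
    unfolding pd_def by (simp add: frechet_derivative_at[symmetric])
qed

lemma smooth_per_pd:
  assumes f: "f \<in> smooth_per L" and d: "d \<in> Basis"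
  shows "pd d f \<in> smooth_per L"
proof (rule smooth_perI)
  show "smooth (pd d f)" using smooth_pd[OF smooth_per_smooth[OF f] d] .
  have "f (p + (L,0,0)) = f p" "f (p + (0,L,0)) = f p" for p
    using smooth_per_lat[OF f] by (cases p; auto simp: lat_periodic_def)+
  from pd_periodic[OF smooth_per_smooth[OF f] this(1)] pd_periodic[OF smooth_per_smooth[OF f] this(2)]
  have "pd d f ((x,y,z) + (L,0,0)) = pd d f (x,y,z)" "pd d f ((x,y,z) + (0,L,0)) = pd d f (x,y,z)" for x y z
    by blast+
  then show "lat_periodic L (pd d f)" by (simp add: lat_periodic_def)
qed

lemma smooth_per_pds:
  assumes "f \<in> smooth_per L" shows "pdx f \<in> smooth_per L" "pdy f \<in> smooth_per L" "pdz f \<in> smooth_per L"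
  using smooth_per_pd[OF assms] by (auto simp: Basis_pt)

type_synonym index = "int \<times> int \<times> nat"

text \<open>Complex conjugation of a mode flips both lateral wave numbers and keeps the plate
  number; \<open>neg\<close> thus converts inner products with modes into bilinear
  integrals.\<close>

definition neg :: "index \<Rightarrow> index" where "neg j = (- fst j, - fst (snd j), snd (snd j))"

lemma neg_neg [simp]: "neg (neg j) = j"
  by (simp add: neg_def)

context slab_domain
begin

lemma L2_smooth_per: "f \<in> smooth_per L \<Longrightarrow> f \<in> L2 L a"
  by (intro L2_continuous smooth_continuous smooth_per_smooth)

lemma integral_pd_smooth_per:
  assumes "f \<in> smooth_per L"
  shows "(\<integral>p. pdx f p \<partial>M) = 0" "(\<integral>p. pdy f p \<partial>M) = 0"
    "(\<And>x y. f (x, y, 0) = 0) \<Longrightarrow> (\<And>x y. f (x, y, a) = 0) \<Longrightarrow> (\<integral>p. pdz f p \<partial>M) = 0"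
proof -
  note s = smooth_per_smooth[OF assms]
  note c = smooth_pds[OF s, THEN smooth_continuous]
  show "(\<integral>p. pdx f p \<partial>M) = 0" "(\<integral>p. pdy f p \<partial>M) = 0"
    using integral_pdx[OF smooth_differentiable[OF s] c(1)] integral_pdy[OF smooth_differentiable[OF s] c(2)]
      smooth_per_lat[OF assms] by (simp_all add: lat_periodic_def)
  show "(\<integral>p. pdz f p \<partial>M) = 0" if "\<And>x y. f (x, y, 0) = 0" "\<And>x y. f (x, y, a) = 0"
    by (rule integral_pdz[OF smooth_differentiable[OF s] c(3) that])
qed

section \<open>Wave numbers and the two families of modes\<close>

definition kx :: "index \<Rightarrow> real" where "kx j = 2 * pi * of_int (fst j) / L"
definition ky :: "index \<Rightarrow> real" where "ky j = 2 * pi * of_int (fst (snd j)) / L"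
definition nu :: "index \<Rightarrow> real" where "nu j = pi * of_nat (snd (snd j)) / a"
definition lam :: "index \<Rightarrow> real" where "lam j = (kx j)\<^sup>2 + (ky j)\<^sup>2 + (nu j)\<^sup>2"

text \<open>The mean of cos^2(n pi z / a) over [0,a] is 1 for n = 0 and 1/2 otherwise. The same
  constants normalise the sines with n > 0.\<close>

definition nrm :: "nat \<Rightarrow> real" where "nrm n = sqrt ((if n = 0 then 1 else 2) / (L * L * a))"

definition CC :: "index \<Rightarrow> sfield" where
  "CC j = (\<lambda>p. of_real (nrm (snd (snd j))) *
     (cis (kx j * fst p) * (cis (ky j * fst (snd p)) * of_real (cos (nu j * snd (snd p))))))"

definition SS :: "index \<Rightarrow> sfield" where
  "SS j = (\<lambda>p. of_real (nrm (snd (snd j))) *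
     (cis (kx j * fst p) * (cis (ky j * fst (snd p)) * of_real (sin (nu j * snd (snd p))))))"

lemma nrm_pos: "nrm n > 0"
  using L a by (simp add: nrm_def)

lemma neg_simps [simp]: "kx (neg j) = - kx j" "ky (neg j) = - ky j" "nu (neg j) = nu j" "lam (neg j) = lam j"
  by (simp_all add: kx_def ky_def nu_def lam_def neg_def)

lemma snd_neg [simp]: "snd (snd (neg j)) = snd (snd j)"
  by (simp add: neg_def)

lemma cnj_CC: "cnj (CC j p) = CC (neg j) p"
  and cnj_SS: "cnj (SS j p) = SS (neg j) p"
  by (simp_all add: CC_def SS_def cis_cnj)

lemma CC_pd: "pdx (CC j) = (\<lambda>p. \<i> * of_real (kx j) * CC j p)" "pdy (CC j) = (\<lambda>p. \<i> * of_real (ky j) * CC j p)"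
    "pdz (CC j) = (\<lambda>p. - of_real (nu j) * SS j p)"
  and SS_pd: "pdx (SS j) = (\<lambda>p. \<i> * of_real (kx j) * SS j p)" "pdy (SS j) = (\<lambda>p. \<i> * of_real (ky j) * SS j p)"
    "pdz (SS j) = (\<lambda>p. of_real (nu j) * CC j p)"
  and smooth_CC: "smooth (CC j)" and smooth_SS: "smooth (SS j)"
proof -
  note c = pd_triple[OF smooth1_cis smooth1_cis smooth1_cos cis_deriv cis_deriv cos_deriv]
  note s = pd_triple[OF smooth1_cis smooth1_cis smooth1_sin cis_deriv cis_deriv sin_deriv]
  show "pdx (CC j) = (\<lambda>p. \<i> * of_real (kx j) * CC j p)" "pdy (CC j) = (\<lambda>p. \<i> * of_real (ky j) * CC j p)"
    "pdz (CC j) = (\<lambda>p. - of_real (nu j) * SS j p)" "smooth (CC j)"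
    unfolding CC_def SS_def c(2-4) using c(1) by (simp_all add: fun_eq_iff)
  show "pdx (SS j) = (\<lambda>p. \<i> * of_real (kx j) * SS j p)" "pdy (SS j) = (\<lambda>p. \<i> * of_real (ky j) * SS j p)"
    "pdz (SS j) = (\<lambda>p. of_real (nu j) * CC j p)" "smooth (SS j)"
    unfolding CC_def SS_def s(2-4) using s(1) by (simp_all add: fun_eq_iff)
qed

lemma modes_pdzz:
  "pdz (pdz (CC j)) = (\<lambda>p. - of_real ((nu j)\<^sup>2) * CC j p)"
  "pdz (pdz (SS j)) = (\<lambda>p. - of_real ((nu j)\<^sup>2) * SS j p)"
proof -
  show "pdz (pdz (CC j)) = (\<lambda>p. - of_real ((nu j)\<^sup>2) * CC j p)"
    unfolding CC_pd pd_cmult[OF smooth_SS] SS_pd by (simp add: power2_eq_square mult.assoc)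
  show "pdz (pdz (SS j)) = (\<lambda>p. - of_real ((nu j)\<^sup>2) * SS j p)"
    unfolding SS_pd pd_cmult[OF smooth_CC] CC_pd by (simp add: power2_eq_square mult.assoc)
qed

lemma cis_period: "cis (kx j * (x + L)) = cis (kx j * x)" "cis (ky j * (y + L)) = cis (ky j * y)"
proof -
  have "cis (2 * pi * of_int m) = 1" for m by (simp add: cis_multiple_2pi)
  then have "cis (kx j * L) = 1" "cis (ky j * L) = 1" using L by (simp_all add: kx_def ky_def)
  then show "cis (kx j * (x + L)) = cis (kx j * x)" "cis (ky j * (y + L)) = cis (ky j * y)"
    by (simp_all add: distrib_left flip: cis_mult)
qed

lemma smooth_per_CC: "CC j \<in> smooth_per L" and smooth_per_SS: "SS j \<in> smooth_per L"
  by (rule smooth_perI[OF smooth_CC], simp add: lat_periodic_def CC_def cis_period)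
    (rule smooth_perI[OF smooth_SS], simp add: lat_periodic_def SS_def cis_period)

lemma sin_nu_a: "sin (nu j * a) = 0"
  using a by (simp add: nu_def)

lemma SS_plates: "SS j (x, y, 0) = 0" "SS j (x, y, a) = 0"
  using sin_nu_a[of j] by (simp_all add: SS_def)

lemma SS_zero: "snd (snd j) = 0 \<Longrightarrow> SS j = (\<lambda>p. 0)"
  by (simp add: SS_def nu_def)

lemma L2_CC: "CC j \<in> L2 L a" and L2_SS: "SS j \<in> L2 L a"
  by (intro L2_smooth_per smooth_per_CC smooth_per_SS)+

subsection \<open>Orthonormality\<close>

text \<open>Orthogonality and normalisation both come from \<open>\<integral> \<partial>g = 0\<close> for suitable products \<open>g\<close> of modes.\<close>

lemma index_eqI:
  assumes "kx i = kx j" "ky i = ky j" "(nu i)\<^sup>2 = (nu j)\<^sup>2"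
  shows "i = j"
proof -
  \<comment> \<open>The plate wave number is nonnegative, so its square determines it; the
    second-order argument in z yields squares.\<close>
  have "nu i = nu j" using assms(3) a by (intro power2_eq_imp_eq[OF assms(3)]) (auto simp: nu_def)
  then show ?thesis
    using assms L a by (cases i; cases j) (auto simp: kx_def ky_def nu_def)
qed

text \<open>The product g of a mode and a conjugate mode is an eigenfunction of the lateral
  derivatives, whose integrals vanish by periodicity, so the integral of g is 0 unless the lateral
  wave numbers agree. In z the first derivative exchanges sine and cosine, so a second-order
  identity takes its place.\<close>

lemma orthogonal:
  assumes "F = CC \<or> F = SS" "i \<noteq> j"
  shows "(\<integral>p. F i p * F (neg j) p \<partial>M) = 0"
proof -
  define g where "g p = F i p * F (neg j) p" for p
  have sF: "F i \<in> smooth_per L" for i using assms(1) smooth_per_CC[of i] smooth_per_SS[of i] by auto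
  note s = smooth_per_smooth[OF sF]
  have F: "pdx (F i) = (\<lambda>p. \<i> * of_real (kx i) * F i p)" "pdy (F i) = (\<lambda>p. \<i> * of_real (ky i) * F i p)"
    "pdz (pdz (F i)) = (\<lambda>p. - of_real ((nu i)\<^sup>2) * F i p)" for i
    using assms(1) CC_pd[of i] SS_pd[of i] modes_pdzz[of i] by (elim disjE; simp only:)+
  have gs: "g \<in> smooth_per L" unfolding g_def by (intro smooth_per_mult sF)
  have x: "pdx g = (\<lambda>p. \<i> * of_real (kx i - kx j) * g p)" and y: "pdy g = (\<lambda>p. \<i> * of_real (ky i - ky j) * g p)"
    unfolding g_def by (simp_all add: smooth_pd_mult[OF s s] F fun_eq_iff algebra_simps)
  have z: "(\<integral>p. of_real ((nu j)\<^sup>2 - (nu i)\<^sup>2) * g p \<partial>M) = 0"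
  proof -
    \<comment> \<open>The Wronskian in z: each of its terms contains a sine factor and vanishes at
      the plates, and its z-derivative is g times the difference of the squared plate wave
      numbers.\<close>
    define h where "h p = pdz (F i) p * F (neg j) p - F i p * pdz (F (neg j)) p" for p
    have hs: "h \<in> smooth_per L" unfolding h_def by (intro smooth_per_diff smooth_per_mult sF smooth_per_pds)
    have "h (x,y,0) = 0" "h (x,y,a) = 0" for x y
      using assms(1) SS_plates[of i] SS_plates[of "neg j"] by (auto simp: h_def CC_pd SS_pd)
    moreover have "pdz h = (\<lambda>p. of_real ((nu j)\<^sup>2 - (nu i)\<^sup>2) * g p)"
      unfolding h_def g_def
      by (simp add: smooth_pd_diff smooth_mult s smooth_pds smooth_pd_mult F fun_eq_iff algebra_simps)
    ultimately show ?thesis using integral_pd_smooth_per(3)[OF hs] by metis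
  qed
  have "\<i> * of_real (kx i - kx j) * (\<integral>p. g p \<partial>M) = 0" "\<i> * of_real (ky i - ky j) * (\<integral>p. g p \<partial>M) = 0"
    "of_real ((nu j)\<^sup>2 - (nu i)\<^sup>2) * (\<integral>p. g p \<partial>M) = 0"
    using integral_pd_smooth_per(1,2)[OF gs] z unfolding x y by (simp_all del: of_real_diff of_real_power)
  then have "(\<integral>p. g p \<partial>M) = 0"
    using index_eqI[of i j] assms(2) by (auto simp del: of_real_diff of_real_power)
  then show ?thesis by (simp add: g_def)
qed

lemma sum_squares_modes: "CC j p * CC (neg j) p + SS j p * SS (neg j) p = of_real ((nrm (snd (snd j)))\<^sup>2)"
proof -
  have e: "cis (b * t) * cis (- b * t) = 1" for b t by (simp add: cis_mult)
  have "CC j p * CC (neg j) p + SS j p * SS (neg j) p =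
     of_real ((nrm (snd (snd j)))\<^sup>2) * (cis (kx j * fst p) * cis (- kx j * fst p)) *
     (cis (ky j * fst (snd p)) * cis (- ky j * fst (snd p))) *
     ((of_real (cos (nu j * snd (snd p))))\<^sup>2 + (of_real (sin (nu j * snd (snd p))))\<^sup>2)"
    by (simp add: CC_def SS_def power2_eq_square algebra_simps)
  also have "(of_real (cos (nu j * snd (snd p))))\<^sup>2 + (of_real (sin (nu j * snd (snd p))))\<^sup>2 = (1::complex)"
    by (metis of_real_1 of_real_add of_real_power sin_cos_squared_add2)
  finally show ?thesis unfolding e by simp
qed

lemma nrm_sq: "(nrm n)\<^sup>2 * (L * L * a) = (if n = 0 then 1 else 2)"
  using L a by (simp add: nrm_def)

text \<open>Two linear relations determine the squared norms of the cosine and the sine mode: their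
  sum comes from cos^2 + sin^2 = 1, their difference from integrating a z-derivative.\<close>

lemma normalized:
  shows "(\<integral>p. CC j p * CC (neg j) p \<partial>M) = 1"
    and "snd (snd j) \<noteq> 0 \<Longrightarrow> (\<integral>p. SS j p * SS (neg j) p \<partial>M) = 1"
proof -
  let ?c = "\<integral>p. CC j p * CC (neg j) p \<partial>M" and ?s = "\<integral>p. SS j p * SS (neg j) p \<partial>M"
  have "?c + ?s = (\<integral>p. CC j p * CC (neg j) p + SS j p * SS (neg j) p \<partial>M)"
    by (intro Bochner_Integration.integral_add[symmetric] integrable_mult_L2 L2_CC L2_SS)
  also have "\<dots> = of_real (L * L * a) * of_real ((nrm (snd (snd j)))\<^sup>2)"
    unfolding sum_squares_modes by (simp add: measure_M scaleR_conv_of_real)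
  also have "\<dots> = (if snd (snd j) = 0 then 1 else 2)"
    using nrm_sq[of "snd (snd j)"] by (simp only: of_real_mult[symmetric] mult.commute) auto
  finally have sum: "?c + ?s = (if snd (snd j) = 0 then 1 else 2)" .
  have diff: "?c = ?s" if n: "snd (snd j) \<noteq> 0"
  proof -
    have nu: "nu j \<noteq> 0" using n a by (simp add: nu_def)
    \<comment> \<open>Vanishes at the plates because of the sine; its z-derivative is
      \<open>nu j\<close> times the difference of the two squared moduli.\<close>
    define g where "g p = SS j p * CC (neg j) p" for p
    have "g \<in> smooth_per L" unfolding g_def by (intro smooth_per_mult smooth_per_CC smooth_per_SS)
    from integral_pd_smooth_per(3)[OF this] have "(\<integral>p. pdz g p \<partial>M) = 0"
      by (simp add: g_def SS_plates)
    moreover have "pdz g = (\<lambda>p. of_real (nu j) * (CC j p * CC (neg j) p - SS j p * SS (neg j) p))"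
      unfolding g_def by (simp add: smooth_pd_mult smooth_CC smooth_SS CC_pd SS_pd fun_eq_iff algebra_simps)
    moreover have "(\<integral>p. CC j p * CC (neg j) p - SS j p * SS (neg j) p \<partial>M) = ?c - ?s"
      by (intro Bochner_Integration.integral_diff integrable_mult_L2 L2_CC L2_SS)
    ultimately show ?thesis using nu by simp
  qed
  show "?c = 1"
  proof (cases "snd (snd j) = 0")
    case True
    then show ?thesis using sum SS_zero[of j] by simp
  next
    case False
    then show ?thesis using sum diff by simp
  qed
  show "?s = 1" if "snd (snd j) \<noteq> 0" using sum diff that by simp
qed

lemma ip_CC: "ip (CC i) (CC j) = (if i = j then 1 else 0)"
  using orthogonal[of CC i j] normalized(1)[of j] by (auto simp: s_inner_def cnj_CC)

lemma ip_SS: "snd (snd j) \<noteq> 0 \<Longrightarrow> ip (SS i) (SS j) = (if i = j then 1 else 0)"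
  using orthogonal[of SS i j] normalized(2)[of j] by (auto simp: s_inner_def cnj_SS)

subsection \<open>Cutoffs near the plates\<close>

text \<open>Depends on z alone and, for m > 0, vanishes within distance 1/m of each plate, so its
  products with periodic smooth functions are test functions.\<close>

definition cut :: "nat \<Rightarrow> sfield" where
  "cut m p = of_real (flat (m * snd (snd p)) * flat (m * (a - snd (snd p))))"

definition cut' :: "nat \<Rightarrow> sfield" where
  "cut' m p = of_real (m * flat' (m * snd (snd p)) * flat (m * (a - snd (snd p)))
     - flat (m * snd (snd p)) * (m * flat' (m * (a - snd (snd p)))))"

lemma smooth1_flat_affine: "smooth1 (\<lambda>t. of_real (flat (m * t)))" "smooth1 (\<lambda>t. of_real (flat (m * (b - t))))"
  using smooth1_affine[OF smooth1_flat, of m 0] smooth1_affine[OF smooth1_flat, of "-m" "m * b"]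
  by (simp_all add: algebra_simps)

lemma flat_affine_deriv:
  "((\<lambda>t. complex_of_real (flat (m * t))) has_vector_derivative of_real (m * flat' (m * t))) (at t)"
  "((\<lambda>t. complex_of_real (flat (m * (b - t)))) has_vector_derivative of_real (- m * flat' (m * (b - t)))) (at t)"
proof -
  have "((\<lambda>t. flat (m * t)) has_real_derivative flat' (m * t) * m) (at t)"
    by (rule DERIV_chain2[OF flat_has_derivative]) (auto intro!: derivative_eq_intros)
  then show "((\<lambda>t. complex_of_real (flat (m * t))) has_vector_derivative of_real (m * flat' (m * t))) (at t)"
    by (intro has_vector_derivative_of_real) (simp add: mult.commute)
  have "((\<lambda>t. flat (m * (b - t))) has_real_derivative flat' (m * (b - t)) * (- m)) (at t)"
    by (rule DERIV_chain2[OF flat_has_derivative]) (auto intro!: derivative_eq_intros)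
  then show "((\<lambda>t. complex_of_real (flat (m * (b - t)))) has_vector_derivative of_real (- m * flat' (m * (b - t)))) (at t)"
    by (intro has_vector_derivative_of_real) (simp add: mult.commute)
qed

lemma smooth_cut: "smooth (cut m)"
  and cut_pd: "pdx (cut m) = (\<lambda>p. 0)" "pdy (cut m) = (\<lambda>p. 0)" "pdz (cut m) = cut' m"
proof -
  have c: "cut m = (\<lambda>p::pt. of_real (flat (m * snd (snd p))) * of_real (flat (m * (a - snd (snd p)))))"
    by (simp add: cut_def fun_eq_iff)
  note bl = bounded_linear_coords(3)
  have s: "smooth (\<lambda>p::pt. of_real (flat (real m * snd (snd p))))" "smooth (\<lambda>p::pt. of_real (flat (real m * (a - snd (snd p)))))"
    using smooth_coord[OF bl smooth1_flat_affine(1)[of m]] smooth_coord[OF bl smooth1_flat_affine(2)[of m a]] by auto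
  show "smooth (cut m)" unfolding c by (intro smooth_mult s)
  note e = smooth_pd_mult[OF s] pd_coord_eq[OF bl flat_affine_deriv(1)[of m]] pd_coord_eq[OF bl flat_affine_deriv(2)[of m a]]
  show "pdx (cut m) = (\<lambda>p. 0)" "pdy (cut m) = (\<lambda>p. 0)" "pdz (cut m) = cut' m"
    unfolding c e by (simp_all add: fun_eq_iff cut'_def algebra_simps)
qed

lemma smooth_per_cut: "cut m \<in> smooth_per L"
  by (intro smooth_perI smooth_cut) (simp add: lat_periodic_def cut_def)

lemma cut_test: "h \<in> smooth_per L \<Longrightarrow> (\<lambda>p. cut m p * h p) \<in> test L a"
proof -
  assume h: "h \<in> smooth_per L"
  \<comment> \<open>The margin 1/(m + 1) also makes sense at m = 0, where the cutoff is identically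
    zero.\<close>
  have "cut m (x, y, z) = 0" if "z < 1 / (m + 1) \<or> a - 1 / (m + 1) < z" for x y z
  proof -
    have "m * z \<le> 1 \<or> m * (a - z) \<le> 1"
      using that
    proof
      assume "z < 1 / (m + 1)"
      then have "m * z \<le> m * (1 / (m + 1))" by (intro mult_left_mono) auto
      also have "\<dots> \<le> 1" by simp
      finally show ?thesis by simp
    next
      assume "a - 1 / (m + 1) < z"
      then have "m * (a - z) \<le> m * (1 / (m + 1))" by (intro mult_left_mono) auto
      also have "\<dots> \<le> 1" by simp
      finally show ?thesis by simp
    qed
    then show ?thesis by (auto simp: cut_def flat_bounds)
  qed
  then have "\<exists>\<delta>>0. \<forall>x y z. z < \<delta> \<or> a - \<delta> < z \<longrightarrow> cut m (x, y, z) * h (x, y, z) = 0"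
    by (intro exI[of _ "1 / (m + 1)"]) auto
  then show ?thesis using smooth_per_mult[OF smooth_per_cut h] by (simp add: test_def)
qed

lemma cut_bounded: "norm (cut m p) \<le> 1"
  using flat_bounds by (auto simp: cut_def norm_mult intro!: mult_le_one)

lemma filterlim_nat_mult: "c > 0 \<Longrightarrow> filterlim (\<lambda>m. real m * c) at_top sequentially"
  by (rule filterlim_at_top_mult_tendsto_pos[OF tendsto_const _ filterlim_real_sequentially])

lemma cut_tendsto: "AE p in M. (\<lambda>m. cut m p) \<longlonglongrightarrow> 1"
  using AE_interior
proof eventually_elim
  case (elim p)
  then have "(\<lambda>m. complex_of_real (flat (m * snd (snd p)) * flat (m * (a - snd (snd p))))) \<longlonglongrightarrow> of_real (1 * 1)"
    by (intro tendsto_of_real tendsto_mult filterlim_compose[OF flat_tendsto filterlim_nat_mult]) auto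
  then show ?case by (simp add: cut_def)
qed

lemma cut_limit:
  assumes "f \<in> L2 L a" "h \<in> smooth_per L"
  shows "(\<lambda>m. \<integral>p. f p * (cut m p * h p) \<partial>M) \<longlonglongrightarrow> (\<integral>p. f p * h p \<partial>M)"
proof -
  have hm: "h \<in> borel_measurable M" "\<And>m. cut m \<in> borel_measurable M"
    using assms(2) smooth_cut by (auto intro!: continuous_measurable_M smooth_continuous dest: smooth_per_smooth)
  obtain K where K: "K > 0" "\<And>p. p \<in> cell \<Longrightarrow> norm (h p) \<le> K"
    using continuous_bounded[OF smooth_continuous[OF smooth_per_smooth[OF assms(2)]]] by blast
  show ?thesis
  proof (rule dominated_mult[OF assms(1)])
    show "norm (cut m p * h p) \<le> K" if "p \<in> cell" for m p
      using mult_mono[OF cut_bounded K(2)[OF that], of m p] by (simp add: norm_mult)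
    show "AE p in M. (\<lambda>m. cut m p * h p) \<longlonglongrightarrow> h p"
      using cut_tendsto
    proof eventually_elim
      case (elim p)
      from tendsto_mult[OF elim tendsto_const[of "h p"]] show ?case by simp
    qed
  qed (use hm in auto)
qed

text \<open>The second estimate is the first one reflected at the plate z = a, where sin(nu a) =
  0.\<close>

lemma abs_sin_le: "\<bar>sin (nu j * z)\<bar> \<le> nu j * \<bar>z\<bar>" "\<bar>sin (nu j * z)\<bar> \<le> nu j * \<bar>a - z\<bar>"
proof -
  have nn: "nu j \<ge> 0" using a by (simp add: nu_def)
  have 1: "\<bar>sin (nu j * t)\<bar> \<le> nu j * \<bar>t\<bar>" for t
    using abs_sin_x_le_abs_x[of "nu j * t"] nn by (simp add: abs_mult)
  then show "\<bar>sin (nu j * z)\<bar> \<le> nu j * \<bar>z\<bar>" .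
  have "sin (nu j * z) = sin (nu j * a - nu j * (a - z))" by (simp add: algebra_simps)
  also have "\<dots> = - cos (nu j * a) * sin (nu j * (a - z))" by (subst sin_diff) (simp add: sin_nu_a)
  finally have "\<bar>sin (nu j * z)\<bar> \<le> \<bar>sin (nu j * (a - z))\<bar>"
    by (simp add: abs_mult mult_left_le_one_le)
  also note 1[of "a - z"]
  finally show "\<bar>sin (nu j * z)\<bar> \<le> nu j * \<bar>a - z\<bar>" .
qed

lemma SS_bounds:
  "norm (SS j p) \<le> nrm (snd (snd j)) * nu j * \<bar>snd (snd p)\<bar>"
  "norm (SS j p) \<le> nrm (snd (snd j)) * nu j * \<bar>a - snd (snd p)\<bar>"
proof -
  have "norm (SS j p) = nrm (snd (snd j)) * \<bar>sin (nu j * snd (snd p))\<bar>"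
    using nrm_pos[of "snd (snd j)"] by (simp add: SS_def norm_mult)
  then show "norm (SS j p) \<le> nrm (snd (snd j)) * nu j * \<bar>snd (snd p)\<bar>"
    "norm (SS j p) \<le> nrm (snd (snd j)) * nu j * \<bar>a - snd (snd p)\<bar>"
    using abs_sin_le[of j "snd (snd p)"] nrm_pos[of "snd (snd j)"] by (simp_all add: mult.assoc)
qed

text \<open>The derivative of the cutoff is of size \<open>1/dist\<close> near the plates, where sine modes vanish
  linearly.\<close>

lemma cut'_SS_bound:
  "norm (cut' m p * SS j p) \<le> nrm (snd (snd j)) * nu j *
     (\<bar>(m * snd (snd p)) * flat' (m * snd (snd p))\<bar> + \<bar>(m * (a - snd (snd p))) * flat' (m * (a - snd (snd p)))\<bar>)"
proof -
  define z where "z = snd (snd p)"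
  define K where "K = nrm (snd (snd j)) * nu j"
  have K: "K \<ge> 0" using nrm_pos[of "snd (snd j)"] a by (simp add: K_def nu_def)
  have "norm (cut' m p) \<le> \<bar>m * flat' (m * z)\<bar> * 1 + 1 * \<bar>m * flat' (m * (a - z))\<bar>"
    unfolding cut'_def z_def[symmetric] norm_of_real
    by (rule order_trans[OF abs_triangle_ineq4], rule add_mono)
      (auto simp: abs_mult flat_bounds intro!: mult_mono mult_left_le mult_right_le_one_le mult_left_le_one_le)
  then have "norm (cut' m p * SS j p) \<le> (\<bar>m * flat' (m * z)\<bar> + \<bar>m * flat' (m * (a - z))\<bar>) * norm (SS j p)"
    by (simp add: norm_mult mult_right_mono)
  also have "\<dots> \<le> \<bar>m * flat' (m * z)\<bar> * (K * \<bar>z\<bar>) + \<bar>m * flat' (m * (a - z))\<bar> * (K * \<bar>a - z\<bar>)"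
    unfolding distrib_right using SS_bounds[of j p]
    by (intro add_mono mult_left_mono) (auto simp: K_def z_def)
  also have "\<dots> = K * (\<bar>(m * z) * flat' (m * z)\<bar> + \<bar>(m * (a - z)) * flat' (m * (a - z))\<bar>)"
    by (simp add: abs_mult distrib_left mult.commute mult.left_commute)
  finally show ?thesis by (simp add: K_def z_def)
qed

lemma smooth_cut': "smooth (cut' m)"
  using smooth_pds(3)[OF smooth_cut[of m]] by (simp add: cut_pd)

text \<open>The boundary layer contributes nothing in the limit: the cutoff derivative times a sine
  mode is uniformly bounded and tends to 0 at every interior point, so dominated convergence applies
  to any L2 factor, even one that has no trace at the plates.\<close>

lemma cut'_limit:
  assumes "f \<in> L2 L a"
  shows "(\<lambda>m. \<integral>p. f p * (cut' m p * SS j p) \<partial>M) \<longlonglongrightarrow> 0"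
proof -
  define K where "K = nrm (snd (snd j)) * nu j"
  have K: "K \<ge> 0" using nrm_pos[of "snd (snd j)"] a by (simp add: K_def nu_def)
  have "(\<lambda>m. \<integral>p. f p * (cut' m p * SS j p) \<partial>M) \<longlonglongrightarrow> (\<integral>p. f p * 0 \<partial>M)"
  proof (rule dominated_mult[OF assms])
    \<comment> \<open>A contribution of at most 3 from each plate.\<close>
    show "norm (cut' m p * SS j p) \<le> K * (3 + 3)" for m p
      by (rule order_trans[OF cut'_SS_bound]) (intro mult_mono add_mono flat'_bound; use K in \<open>simp add: K_def\<close>)
    show "(\<lambda>p. cut' m p * SS j p) \<in> borel_measurable M" for m
      by (intro continuous_measurable_M smooth_continuous smooth_mult smooth_cut' smooth_SS)
    show "AE p in M. (\<lambda>m. cut' m p * SS j p) \<longlonglongrightarrow> 0"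
      using AE_interior
    proof eventually_elim
      case (elim p)
      have "(\<lambda>m. K * (\<bar>(real m * snd (snd p)) * flat' (real m * snd (snd p))\<bar> +
          \<bar>(real m * (a - snd (snd p))) * flat' (real m * (a - snd (snd p)))\<bar>)) \<longlonglongrightarrow> K * (\<bar>0\<bar> + \<bar>0\<bar>)"
        using elim by (intro tendsto_intros filterlim_compose[OF flat'_tendsto filterlim_nat_mult]) auto
      then have "(\<lambda>m. K * (\<bar>(real m * snd (snd p)) * flat' (real m * snd (snd p))\<bar> +
          \<bar>(real m * (a - snd (snd p))) * flat' (real m * (a - snd (snd p)))\<bar>)) \<longlonglongrightarrow> 0" by simp
      then show ?case
        by (rule Lim_null_comparison[rotated]) (rule always_eventually, rule allI, unfold K_def, rule cut'_SS_bound)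
    qed
  qed auto
  then show ?thesis by simp
qed

section \<open>Completeness of the modes\<close>

text \<open>The positive part of g is the density of a finite measure, which is inner regular; the
  set where g > 0 is exhausted by compact sets on which the integral of g is 0.\<close>

lemma nonpos_if_compact_integrals_zero:
  fixes g :: "pt \<Rightarrow> real"
  assumes g: "integrable M g" and zero: "\<And>K. compact K \<Longrightarrow> K \<subseteq> cell \<Longrightarrow> (\<integral>p. g p * indicator K p \<partial>M) = 0"
  shows "AE p in M. g p \<le> 0"
proof -
  define g' where "g' = (\<lambda>p. indicator cell p *\<^sub>R g p)"
  have int: "integrable lborel g'" using g unfolding integrable_M g'_def .
  have [measurable]: "g' \<in> borel_measurable borel" using borel_measurable_integrable[OF int] by simp
  note [measurable] = cell_borel
  define B where "B = {p \<in> space lborel. p \<in> cell \<and> g' p > 0}"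
  have B: "B \<in> sets borel" unfolding B_def by measurable
  \<comment> \<open>\<open>ennreal\<close> sends negative values to 0, so the density is the
    positive part.\<close>
  define N where "N = density lborel (\<lambda>p. ennreal (g' p))"
  have N: "emeasure N A = (\<integral>\<^sup>+p. ennreal (g' p) * indicator A p \<partial>lborel)" if "A \<in> sets borel" for A
    unfolding N_def using that by (simp add: emeasure_density)
  have "emeasure N (space N) = (\<integral>\<^sup>+p. ennreal (g' p) \<partial>lborel)"
    using N[of UNIV] by (simp add: N_def)
  also have "\<dots> \<le> (\<integral>\<^sup>+p. ennreal (norm (g' p)) \<partial>lborel)"
    by (intro nn_integral_mono ennreal_leI) auto
  also have "\<dots> < \<infinity>" using int by (simp add: integrable_iff_bounded)
  finally have fin: "emeasure N (space N) \<noteq> \<infinity>" by simp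
  have "emeasure N B = (SUP K \<in> {K. K \<subseteq> B \<and> compact K}. emeasure N K)"
    by (rule inner_regular) (use fin B in \<open>auto simp: N_def\<close>)
  also have "\<dots> = 0"
  proof -
    have "emeasure N K = 0" if K: "K \<subseteq> B" "compact K" for K
    proof -
      have Kb: "K \<in> sets borel" using K(2) by (rule borel_compact)
      have eq: "ennreal (g' p) * indicator K p = ennreal (g' p * indicator K p)" for p
        by (auto simp: indicator_def)
      have "emeasure N K = (\<integral>\<^sup>+p. ennreal (g' p * indicator K p) \<partial>lborel)"
        using N[OF Kb] by (simp add: eq)
      also have "\<dots> = ennreal (\<integral>p. g' p * indicator K p \<partial>lborel)"
      proof (rule nn_integral_eq_integral)
        show "integrable lborel (\<lambda>p. g' p * indicator K p)"
          using integrable_mult_indicator[OF _ int, of K] Kb by (simp add: mult.commute)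
        show "AE p in lborel. 0 \<le> g' p * indicator K p"
          using K(1) by (intro AE_I2) (auto simp: B_def indicator_def)
      qed
      also have "(\<integral>p. g' p * indicator K p \<partial>lborel) = (\<integral>p. g p * indicator K p \<partial>M)"
        by (simp add: integral_M g'_def mult.assoc)
      also have "\<dots> = 0" using K by (intro zero) (auto simp: B_def)
      finally show ?thesis by simp
    qed
    then have "(SUP K \<in> {K. K \<subseteq> B \<and> compact K}. emeasure N K) \<le> 0"
      by (intro SUP_least) simp
    then show ?thesis by simp
  qed
  finally have "(\<integral>\<^sup>+p. ennreal (g' p) * indicator B p \<partial>lborel) = 0" using N[OF B] by simp
  then have "AE p in lborel. ennreal (g' p) * indicator B p = 0"
    using B by (subst (asm) nn_integral_0_iff_AE) auto
  then have "AE p in lborel. p \<in> cell \<longrightarrow> g p \<le> 0"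
    by eventually_elim (auto simp: B_def g'_def indicator_def ennreal_eq_0_iff split: if_splits)
  then show ?thesis
    unfolding slab_def using cell_borel by (subst AE_restrict_space_iff) auto
qed

text \<open>The one-sided statement is applied to plus and minus the real and imaginary
  parts.\<close>

lemma zero_if_compact_integrals_zero:
  fixes f :: sfield
  assumes f: "integrable M f" and zero: "\<And>K. compact K \<Longrightarrow> K \<subseteq> cell \<Longrightarrow> (\<integral>p. f p * indicator K p \<partial>M) = 0"
  shows "AE p in M. f p = 0"
proof -
  have int: "integrable M (\<lambda>p. f p * indicator K p)" if "compact K" "K \<subseteq> cell" for K
  proof -
    have "K \<in> sets M" using sets_M[OF borel_compact[OF that(1)]] that(2) by (simp add: Int_absorb2)
    from integrable_mult_indicator[OF this f] show ?thesis
    proof -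
      have "(\<lambda>p. indicat_real K p *\<^sub>R f p) = (\<lambda>p. f p * indicator K p)"
        by (intro ext) (simp add: indicator_def)
      then show "integrable M (\<lambda>p. indicat_real K p *\<^sub>R f p) \<Longrightarrow> ?thesis" by simp
    qed
  qed
  have re: "(\<integral>p. Re (f p) * indicator K p \<partial>M) = 0" and im: "(\<integral>p. Im (f p) * indicator K p \<partial>M) = 0"
    if K: "compact K" "K \<subseteq> cell" for K
  proof -
    have "Re (f p) * indicator K p = Re (f p * indicator K p)" "Im (f p) * indicator K p = Im (f p * indicator K p)" for p
      by (auto simp: indicator_def)
    then show "(\<integral>p. Re (f p) * indicator K p \<partial>M) = 0" "(\<integral>p. Im (f p) * indicator K p \<partial>M) = 0"
      using zero[OF K] integral_Re[OF int[OF K]] integral_Im[OF int[OF K]] by simp_all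
  qed
  have "AE p in M. Re (f p) \<le> 0" "AE p in M. - Re (f p) \<le> 0" "AE p in M. Im (f p) \<le> 0" "AE p in M. - Im (f p) \<le> 0"
  proof -
    have ri: "integrable M (\<lambda>p. Re (f p))" "integrable M (\<lambda>p. Im (f p))" using f by simp_all
    show "AE p in M. Re (f p) \<le> 0" by (rule nonpos_if_compact_integrals_zero[OF ri(1) re])
    show "AE p in M. Im (f p) \<le> 0" by (rule nonpos_if_compact_integrals_zero[OF ri(2) im])
    show "AE p in M. - Re (f p) \<le> 0"
      by (rule nonpos_if_compact_integrals_zero) (use ri re in simp_all)
    show "AE p in M. - Im (f p) \<le> 0"
      by (rule nonpos_if_compact_integrals_zero) (use ri im in simp_all)
  qed
  then show ?thesis by eventually_elim (simp add: complex_eq_iff)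
qed

text \<open>Glues the lateral faces and straightens z by the cosine. Real polynomials in the
  coordinates of \<open>tau\<close> are trigonometric polynomials in x and y times polynomials in
  cos(pi z / a), that is, finite combinations of cosine modes.\<close>

definition tau :: "pt \<Rightarrow> complex \<times> complex \<times> real" where
  "tau p = (cis (2 * pi / L * fst p), cis (2 * pi / L * fst (snd p)), cos (pi / a * snd (snd p)))"

lemma continuous_tau: "continuous_on A tau"
  unfolding tau_def cis_conv_exp by (intro continuous_intros)

text \<open>Arguments with equal values differ by an integer multiple of the period, which is too
  long for two points of one half-open period.\<close>

lemma cis_inj:
  assumes "cis (2 * pi / L * x) = cis (2 * pi / L * y)" "x \<in> {0..<L}" "y \<in> {0..<L}" shows "x = y"
proof -
  have "sin (2 * pi / L * x) = sin (2 * pi / L * y) \<and> cos (2 * pi / L * x) = cos (2 * pi / L * y)"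
    using assms(1) by (simp add: complex_eq_iff)
  then obtain n :: int where n: "2 * pi / L * x = 2 * pi / L * y + 2 * pi * n"
    unfolding sin_cos_eq_iff by blast
  have "x = y + L * n"
  proof -
    have "2 * pi / L * x = 2 * pi / L * (y + L * n)" using n L by (simp add: field_simps)
    then show ?thesis using L by simp
  qed
  moreover from this have "\<bar>L * n\<bar> < L * 1" using assms(2,3) by auto
  then have "\<bar>real_of_int n\<bar> < 1" using L by (simp add: abs_mult)
  then have "n = 0" by linarith
  ultimately show ?thesis by simp
qed

text \<open>Each lateral coordinate ranges over one half-open period, and pi z / a stays in [0, pi],
  where the cosine is injective.\<close>

lemma tau_inj: "inj_on tau cell"
proof (rule inj_onI)
  fix p q assume pq: "p \<in> cell" "q \<in> cell" "tau p = tau q"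
  then have mem: "fst p \<in> {0..<L}" "fst q \<in> {0..<L}" "fst (snd p) \<in> {0..<L}" "fst (snd q) \<in> {0..<L}"
      "snd (snd p) \<in> {0..a}" "snd (snd q) \<in> {0..a}"
    and eq: "cis (2 * pi / L * fst p) = cis (2 * pi / L * fst q)" "cos (pi / a * snd (snd p)) = cos (pi / a * snd (snd q))"
      "cis (2 * pi / L * fst (snd p)) = cis (2 * pi / L * fst (snd q))"
    by (simp_all only: mem_Times_iff tau_def prod.inject)
  have "fst p = fst q" "fst (snd p) = fst (snd q)"
    using cis_inj[OF eq(1) mem(1,2)] cis_inj[OF eq(3) mem(3,4)] by blast+
  moreover have "snd (snd p) = snd (snd q)"
  proof -
    have "pi / a * snd (snd p) = pi / a * snd (snd q)"
    proof (rule cos_inj_pi)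
      show "0 \<le> pi / a * snd (snd p)" "0 \<le> pi / a * snd (snd q)" using mem a by auto
      have "pi / a * t \<le> pi / a * a" if "t \<in> {0..a}" for t
        using that a by (intro mult_left_mono) auto
      then show "pi / a * snd (snd p) \<le> pi" "pi / a * snd (snd q) \<le> pi" using mem a by auto
    qed (rule eq(2))
    then show ?thesis using a by simp
  qed
  ultimately show "p = q" by (simp add: prod_eq_iff)
qed

text \<open>Multipliers are closed under sums and products, so polynomials in the coordinates of \<open>tau\<close> are
  multipliers as soon as linear functions are.\<close>

definition bdd :: "sfield \<Rightarrow> bool" where
  "bdd h \<longleftrightarrow> h \<in> borel_measurable M \<and> (\<exists>K. \<forall>p\<in>cell. norm (h p) \<le> K)"

text \<open>Multiplication by g preserves orthogonality of f h to all cosine modes. Letting h range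
  over all bounded factors, instead of fixing h = 1, is what allows multipliers to be
  composed.\<close>

definition multiplier :: "sfield \<Rightarrow> sfield \<Rightarrow> bool" where
  "multiplier f g \<longleftrightarrow> bdd g \<and>
     (\<forall>h. bdd h \<longrightarrow> (\<forall>j. (\<integral>p. f p * h p * CC j p \<partial>M) = 0) \<longrightarrow> (\<forall>j. (\<integral>p. f p * (h p * g p) * CC j p \<partial>M) = 0))"

lemma bddI: "h \<in> borel_measurable M \<Longrightarrow> (\<And>p. p \<in> cell \<Longrightarrow> norm (h p) \<le> K) \<Longrightarrow> bdd h"
  unfolding bdd_def by (intro conjI exI[of _ K] ballI)

lemma bddE:
  assumes "bdd h"
  obtains K where "h \<in> borel_measurable M" "\<forall>p\<in>cell. norm (h p) \<le> K"
  using assms unfolding bdd_def by blast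

lemma bdd_mult: "bdd g \<Longrightarrow> bdd h \<Longrightarrow> bdd (\<lambda>p. g p * h p)"
proof -
  assume "bdd g" "bdd h"
  obtain K1 where g[measurable]: "g \<in> borel_measurable M" and K1: "\<forall>p\<in>cell. norm (g p) \<le> K1"
    using \<open>bdd g\<close> by (rule bddE)
  obtain K2 where h[measurable]: "h \<in> borel_measurable M" and K2: "\<forall>p\<in>cell. norm (h p) \<le> K2"
    using \<open>bdd h\<close> by (rule bddE)
  have "norm (g p * h p) \<le> K1 * K2" if "p \<in> cell" for p
    unfolding norm_mult using bspec[OF K1 that] bspec[OF K2 that]
    by (rule mult_mono) (use order_trans[OF norm_ge_zero bspec[OF K1 that]] in simp_all)
  moreover have "(\<lambda>p. g p * h p) \<in> borel_measurable M" by measurable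
  ultimately show ?thesis by (intro bddI)
qed

lemma bdd_add: "bdd g \<Longrightarrow> bdd h \<Longrightarrow> bdd (\<lambda>p. g p + h p)"
proof -
  assume "bdd g" "bdd h"
  obtain K1 where g[measurable]: "g \<in> borel_measurable M" and K1: "\<forall>p\<in>cell. norm (g p) \<le> K1"
    using \<open>bdd g\<close> by (rule bddE)
  obtain K2 where h[measurable]: "h \<in> borel_measurable M" and K2: "\<forall>p\<in>cell. norm (h p) \<le> K2"
    using \<open>bdd h\<close> by (rule bddE)
  have "norm (g p + h p) \<le> K1 + K2" if "p \<in> cell" for p
    by (rule order_trans[OF norm_triangle_ineq add_mono[OF bspec[OF K1 that] bspec[OF K2 that]]])
  moreover have "(\<lambda>p. g p + h p) \<in> borel_measurable M" by measurable
  ultimately show ?thesis by (intro bddI)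
qed

lemma bdd_continuous: "continuous_on UNIV h \<Longrightarrow> bdd h"
proof -
  assume h: "continuous_on UNIV h"
  obtain K where "K > 0" "\<And>p. p \<in> cell \<Longrightarrow> norm (h p) \<le> K" using continuous_bounded[OF h] by blast
  from bddI[OF continuous_measurable_M[OF h] this(2)] show "bdd h" .
qed

lemma bdd_L2: "f \<in> L2 L a \<Longrightarrow> bdd h \<Longrightarrow> (\<lambda>p. f p * h p) \<in> L2 L a"
proof -
  assume f: "f \<in> L2 L a" and h: "bdd h"
  obtain K where K: "h \<in> borel_measurable M" "\<forall>p\<in>cell. norm (h p) \<le> K"
    using h by (rule bddE)
  from L2_mult_bounded[OF f K(1) bspec[OF K(2)]] show ?thesis by (simp add: mult.commute)
qed

lemma multiplier_const: "multiplier f (\<lambda>p. c)"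
proof -
  have "(\<integral>p. f p * (h p * c) * CC j p \<partial>M) = c * (\<integral>p. f p * h p * CC j p \<partial>M)" for h j
    by (subst Bochner_Integration.integral_mult_right_zero[symmetric]) (simp add: ac_simps)
  then show ?thesis unfolding multiplier_def by (simp add: bdd_continuous)
qed

lemma multiplier_mult: "multiplier f g \<Longrightarrow> multiplier f h \<Longrightarrow> multiplier f (\<lambda>p. g p * h p)"
proof -
  assume g: "multiplier f g" and h: "multiplier f h"
  show ?thesis
    unfolding multiplier_def
  proof (intro conjI impI allI)
    show "bdd (\<lambda>p. g p * h p)" using g h by (simp add: multiplier_def bdd_mult)
    fix k j assume k: "bdd k" and z: "\<forall>j. (\<integral>p. f p * k p * CC j p \<partial>M) = 0"
    have b: "bdd (\<lambda>p. k p * g p)" using g k by (simp add: multiplier_def bdd_mult)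
    have "\<forall>j. (\<integral>p. f p * (k p * g p) * CC j p \<partial>M) = 0"
      using g k z unfolding multiplier_def by blast
    with h b have "(\<integral>p. f p * (k p * g p * h p) * CC j p \<partial>M) = 0"
      unfolding multiplier_def by blast
    then show "(\<integral>p. f p * (k p * (g p * h p)) * CC j p \<partial>M) = 0"
      by (simp only: mult.assoc)
  qed
qed

lemma multiplier_add:
  assumes f: "f \<in> L2 L a" and g: "multiplier f g" and h: "multiplier f h"
  shows "multiplier f (\<lambda>p. g p + h p)"
proof -
  have b: "bdd g" "bdd h" using g h by (auto simp: multiplier_def)
  have "(\<integral>p. f p * (k p * (g p + h p)) * CC j p \<partial>M) =
      (\<integral>p. f p * (k p * g p) * CC j p \<partial>M) + (\<integral>p. f p * (k p * h p) * CC j p \<partial>M)" if "bdd k" for k j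
  proof -
    have "integrable M (\<lambda>p. f p * (k p * g p) * CC j p)" "integrable M (\<lambda>p. f p * (k p * h p) * CC j p)"
      using that b f by (auto intro!: integrable_mult_L2 bdd_L2 bdd_mult L2_CC)
    then show ?thesis by (subst Bochner_Integration.integral_add[symmetric]) (simp_all add: algebra_simps)
  qed
  with g h b show ?thesis by (auto simp: multiplier_def bdd_add)
qed

text \<open>It suffices that g sends each mode to a combination of modes; two terms cover the index
  shifts by exponentials and the product formula for cosines.\<close>

lemma multiplier_mode:
  assumes f: "f \<in> L2 L a" and g: "continuous_on UNIV g"
    and "\<And>j. \<exists>c d i k. (\<lambda>p. g p * CC j p) = (\<lambda>p. c * CC i p + d * CC k p)"
  shows "multiplier f g"
  unfolding multiplier_def
proof (intro conjI allI impI bdd_continuous[OF g])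
  fix h j assume h: "bdd h" and z: "\<forall>j. (\<integral>p. f p * h p * CC j p \<partial>M) = 0"
  obtain c d i k where e: "(\<lambda>p. g p * CC j p) = (\<lambda>p. c * CC i p + d * CC k p)" using assms(3) by blast
  have int: "integrable M (\<lambda>p. f p * h p * CC i p)" for i
    using f h by (intro integrable_mult_L2 bdd_L2 L2_CC)
  have "(\<integral>p. f p * (h p * g p) * CC j p \<partial>M) = (\<integral>p. c * (f p * h p * CC i p) + d * (f p * h p * CC k p) \<partial>M)"
  proof (rule Bochner_Integration.integral_cong[OF refl])
    fix p
    have "f p * (h p * g p) * CC j p = f p * h p * (g p * CC j p)" by (simp add: ac_simps)
    also have "\<dots> = f p * h p * (c * CC i p + d * CC k p)" using fun_cong[OF e, of p] by simp
    finally show "f p * (h p * g p) * CC j p = c * (f p * h p * CC i p) + d * (f p * h p * CC k p)"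
      by (simp add: algebra_simps)
  qed
  also have "\<dots> = 0" using z int by simp
  finally show "(\<integral>p. f p * (h p * g p) * CC j p \<partial>M) = 0" .
qed

lemma cis_CC:
  "cis (2 * pi / L * fst p) * CC (m, k, n) p = CC (m + 1, k, n) p"
  "cnj (cis (2 * pi / L * fst p)) * CC (m, k, n) p = CC (m - 1, k, n) p"
  "cis (2 * pi / L * fst (snd p)) * CC (m, k, n) p = CC (m, k + 1, n) p"
  "cnj (cis (2 * pi / L * fst (snd p))) * CC (m, k, n) p = CC (m, k - 1, n) p"
proof -
  have c: "cis (2 * pi / L * x) * cis (2 * pi * of_int i / L * x) = cis (2 * pi * of_int (i + 1) / L * x)"
    "cis (- (2 * pi / L * x)) * cis (2 * pi * of_int i / L * x) = cis (2 * pi * of_int (i - 1) / L * x)" for x i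
    unfolding cis_mult by (simp_all add: ring_distribs add_divide_distrib diff_divide_distrib add.commute)
  show "cis (2 * pi / L * fst p) * CC (m, k, n) p = CC (m + 1, k, n) p"
    "cnj (cis (2 * pi / L * fst p)) * CC (m, k, n) p = CC (m - 1, k, n) p"
    "cis (2 * pi / L * fst (snd p)) * CC (m, k, n) p = CC (m, k + 1, n) p"
    "cnj (cis (2 * pi / L * fst (snd p))) * CC (m, k, n) p = CC (m, k - 1, n) p"
    unfolding CC_def kx_def ky_def nu_def fst_conv snd_conv c[symmetric] cis_cnj
    by (simp_all only: ac_simps)
qed

text \<open>Product-to-sum formulas for cos w cos nw and sin w cos nw. The constants c and d correct
  for the normalisation, which differs at n = 0, where a single term remains.\<close>

lemma cos_CC: "\<exists>c d i k. (\<lambda>p. of_real (cos (pi / a * snd (snd p))) * CC j p) = (\<lambda>p. c * CC i p + d * CC k p)"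
  and sin_CC: "\<exists>c d i k. (\<lambda>p. of_real (sin (pi / a * snd (snd p))) * CC j p) = (\<lambda>p. c * SS i p + d * SS k p)"
proof -
  obtain m l n where j: "j = (m, l, n)" by (cases j)
  define w where "w p = pi / a * snd (snd p)" for p :: pt
  define E :: sfield where "E p = cis (kx j * fst p) * cis (ky j * fst (snd p))" for p
  have C: "CC (m, l, n') p = of_real (nrm n' * cos (real n' * w p)) * E p" for n' p
    by (simp add: CC_def E_def j kx_def ky_def nu_def w_def ac_simps)
  have S: "SS (m, l, n') p = of_real (nrm n' * sin (real n' * w p)) * E p" for n' p
    by (simp add: SS_def E_def j kx_def ky_def nu_def w_def ac_simps)
  \<comment> \<open>Truncated subtraction: for n = 0 this is 0, but then d = 0 removes the
    term.\<close>
  define k :: nat where "k = n - 1"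
  define c where "c = (if n = 0 then nrm 0 / nrm 1 else nrm n / nrm (n + 1) / 2)"
  define d where "d = (if n = 0 then 0 else nrm n / nrm k / 2)"
  have c: "c * nrm (n + 1) = (if n = 0 then nrm 0 else nrm n / 2)" and d: "d * nrm k = (if n = 0 then 0 else nrm n / 2)"
    using nrm_pos[of "n + 1"] nrm_pos[of k] nrm_pos[of 1] by (auto simp: c_def d_def)
  have k: "n \<noteq> 0 \<Longrightarrow> real k = real n - 1" by (simp add: k_def of_nat_diff)
  have cosr: "cos (w p) * (nrm n * cos (real n * w p)) = c * nrm (n + 1) * cos ((n + 1) * w p) + d * nrm k * cos (k * w p)" for p
  proof (cases "n = 0")
    case False
    have "cos ((real n + 1) * w p) + cos ((real n - 1) * w p) = 2 * (cos (w p) * cos (real n * w p))"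
      by (simp add: distrib_right left_diff_distrib cos_add cos_diff)
    then have "cos (w p) * (nrm n * cos (real n * w p)) = nrm n / 2 * (cos ((real n + 1) * w p) + cos ((real n - 1) * w p))"
      by simp
    then show ?thesis unfolding c d using False k[OF False] by (simp only: if_False distrib_left of_nat_add of_nat_1)
  qed (use c d in simp)
  have sinr: "sin (w p) * (nrm n * cos (real n * w p)) = c * nrm (n + 1) * sin ((n + 1) * w p) + - d * nrm k * sin (k * w p)" for p
  proof (cases "n = 0")
    case False
    have "sin ((real n + 1) * w p) - sin ((real n - 1) * w p) = 2 * (sin (w p) * cos (real n * w p))"
      by (simp add: distrib_right left_diff_distrib sin_add sin_diff)
    then have "sin (w p) * (nrm n * cos (real n * w p)) = nrm n / 2 * (sin ((real n + 1) * w p) - sin ((real n - 1) * w p))"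
      by simp
    then show ?thesis unfolding minus_mult_left[symmetric] c d using False k[OF False]
      by (simp only: if_False of_nat_add of_nat_1) (simp add: right_diff_distrib)
  qed (use c d in simp)
  have "of_real (cos (w p)) * CC j p = of_real c * CC (m, l, n + 1) p + of_real d * CC (m, l, k) p" for p
  proof -
    have "of_real (cos (w p)) * CC j p = of_real (cos (w p) * (nrm n * cos (real n * w p))) * E p"
      by (simp add: j C)
    also have "\<dots> = of_real c * CC (m, l, n + 1) p + of_real d * CC (m, l, k) p"
      unfolding cosr C by (simp only: of_real_add of_real_mult distrib_right mult.assoc)
    finally show ?thesis .
  qed
  then show "\<exists>c d i k. (\<lambda>p. of_real (cos (pi / a * snd (snd p))) * CC j p) = (\<lambda>p. c * CC i p + d * CC k p)"
    unfolding w_def by blast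
  have "of_real (sin (w p)) * CC j p = of_real c * SS (m, l, n + 1) p + of_real (- d) * SS (m, l, k) p" for p
  proof -
    have "of_real (sin (w p)) * CC j p = of_real (sin (w p) * (nrm n * cos (real n * w p))) * E p"
      by (simp add: j C)
    also have "\<dots> = of_real c * SS (m, l, n + 1) p + of_real (- d) * SS (m, l, k) p"
      unfolding sinr S by (simp only: of_real_add of_real_mult distrib_right mult.assoc)
    finally show ?thesis .
  qed
  then show "\<exists>c d i k. (\<lambda>p. of_real (sin (pi / a * snd (snd p))) * CC j p) = (\<lambda>p. c * SS i p + d * SS k p)"
    unfolding w_def by blast
qed

lemma multiplier_linear:
  assumes f: "f \<in> L2 L a" and l: "bounded_linear (l :: complex \<times> complex \<times> real \<Rightarrow> real)"
  shows "multiplier f (\<lambda>p. of_real (l (tau p)))"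
proof -
  define X Y Z where "X = (\<lambda>p::pt. cis (2 * pi / L * fst p))" "Y = (\<lambda>p::pt. cis (2 * pi / L * fst (snd p)))"
    "Z = (\<lambda>p::pt. complex_of_real (cos (pi / a * snd (snd p))))"
  have cont: "continuous_on UNIV X" "continuous_on UNIV Y" "continuous_on UNIV Z"
    unfolding X_Y_Z_def cis_conv_exp by (intro continuous_intros)+
  have ex: "\<exists>c d i k. (\<lambda>p. G p * CC j p) = (\<lambda>p. c * CC i p + d * CC k p)" if "\<And>p. G p * CC j p = CC i' p" for G j i'
    using that by (intro exI[of _ 1] exI[of _ 0] exI[of _ i']) simp
  have mX: "multiplier f X" "multiplier f (\<lambda>p. cnj (X p))"
    using cont cis_CC(1,2) by (auto intro!: multiplier_mode[OF f] ex continuous_intros simp: X_Y_Z_def)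
  have mY: "multiplier f Y" "multiplier f (\<lambda>p. cnj (Y p))"
    using cont cis_CC(3,4) by (auto intro!: multiplier_mode[OF f] ex continuous_intros simp: X_Y_Z_def)
  have mZ: "multiplier f Z"
    using cont cos_CC by (auto intro!: multiplier_mode[OF f] simp: X_Y_Z_def)
  interpret l: bounded_linear l by fact
  \<comment> \<open>Chosen so that A X + cnj (A X) = 2 Re (A X) equals l(1,0,0) Re X + l(i,0,0) Im
    X; a real-linear functional is thereby written in X and its conjugate, both of which shift the
    index of a mode.\<close>
  define A where "A = Complex (l (1,0,0) / 2) (- l (\<i>,0,0) / 2)"
  define B where "B = Complex (l (0,1,0) / 2) (- l (0,\<i>,0) / 2)"
  have "of_real (l (tau p)) = (A * X p + cnj A * cnj (X p)) + (B * Y p + cnj B * cnj (Y p)) + of_real (l (0,0,1)) * Z p" for p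
  proof -
    obtain u v t where t: "tau p = (u, v, t)" by (cases "tau p")
    then have XYZ: "X p = u" "Y p = v" "Z p = of_real t" by (auto simp: tau_def X_Y_Z_def)
    have "(u, v, t) = (Re u *\<^sub>R (1,0,0) + Im u *\<^sub>R (\<i>,0,0)) + (Re v *\<^sub>R (0,1,0) + Im v *\<^sub>R (0,\<i>,0)) + t *\<^sub>R (0,0,1)"
      by (simp add: complex_eq_iff)
    then have "l (u, v, t) = l ((Re u *\<^sub>R (1,0,0) + Im u *\<^sub>R (\<i>,0,0)) + (Re v *\<^sub>R (0,1,0) + Im v *\<^sub>R (0,\<i>,0)) + t *\<^sub>R (0,0,1))"
      by simp
    then have "l (u, v, t) = (Re u * l (1,0,0) + Im u * l (\<i>,0,0)) + (Re v * l (0,1,0) + Im v * l (0,\<i>,0)) + t * l (0,0,1)"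
      by (simp only: l.add l.scaleR real_scaleR_def)
    then show ?thesis
      unfolding t XYZ by (simp add: A_def B_def complex_eq_iff)
  qed
  then have e: "(\<lambda>p. complex_of_real (l (tau p))) = (\<lambda>p. (A * X p + cnj A * cnj (X p)) + (B * Y p + cnj B * cnj (Y p)) + of_real (l (0,0,1)) * Z p)"
    by blast
  show ?thesis unfolding e
    by (intro multiplier_add[OF f] multiplier_mult multiplier_const mX mY mZ)
qed

lemma multiplier_polynomial:
  assumes f: "f \<in> L2 L a" and "real_polynomial_function q"
  shows "multiplier f (\<lambda>p. of_real (q (tau p)))"
  using assms(2)
proof induction
  case (linear l)
  then show ?case by (rule multiplier_linear[OF f])
next
  case (const c)
  show ?case by (rule multiplier_const)
next
  case (add g h)
  then show ?case using multiplier_add[OF f] by (simp only: of_real_add)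
next
  case (mult g h)
  then show ?case using multiplier_mult by (simp only: of_real_mult)
qed

text \<open>Stone-Weierstrass on a compact set containing the range of \<open>tau\<close> carries
  orthogonality from polynomials over to continuous functions.\<close>

lemma continuous_tau_integral_zero:
  assumes f: "f \<in> L2 L a" and z: "\<And>j. ip f (CC j) = 0" and g: "continuous_on UNIV (g :: complex \<times> complex \<times> real \<Rightarrow> real)"
  shows "(\<integral>p. f p * of_real (g (tau p)) \<partial>M) = 0"
proof -
  have z': "(\<integral>p. f p * CC j p \<partial>M) = 0" for j
    using z[of "neg j"] by (simp add: s_inner_def cnj_CC)
  have poly: "(\<integral>p. f p * of_real (q (tau p)) \<partial>M) = 0" if "real_polynomial_function q" for q
  proof -
    have "\<forall>j. (\<integral>p. f p * 1 * CC j p \<partial>M) = 0" using z' by simp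
    moreover have "bdd (\<lambda>p. 1)" by (intro bdd_continuous continuous_on_const)
    \<comment> \<open>The mode with index (0,0,0) is a nonzero constant, so testing with it leaves
      the bare integral.\<close>
    ultimately have "(\<integral>p. f p * (1 * of_real (q (tau p))) * CC (0,0,0) p \<partial>M) = 0"
      using multiplier_polynomial[OF f that] unfolding multiplier_def by blast
    then show ?thesis using nrm_pos[of 0] by (simp add: CC_def kx_def ky_def nu_def)
  qed
  define K where "K = cball (0::complex) 1 \<times> cball (0::complex) 1 \<times> cball (0::real) 1"
  have K: "compact K" unfolding K_def by (intro compact_Times compact_cball)
  have tauK: "tau p \<in> K" for p by (simp add: K_def tau_def)
  have "\<exists>q. real_polynomial_function q \<and> (\<forall>x\<in>K. \<bar>g x - q x\<bar> < 1 / Suc n)" for n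
  proof -
    have "0 < 1 / real (Suc n)" by simp
    from Stone_Weierstrass_real_polynomial_function[OF K continuous_on_subset[OF g subset_UNIV] this]
    obtain q where "real_polynomial_function q" "\<And>x. x \<in> K \<Longrightarrow> \<bar>g x - q x\<bar> < 1 / real (Suc n)" by blast
    then show ?thesis by blast
  qed
  then obtain q where q: "\<And>n. real_polynomial_function (q n)" "\<And>n x. x \<in> K \<Longrightarrow> \<bar>g x - q n x\<bar> < 1 / Suc n"
    by metis
  have cont: "continuous_on UNIV (\<lambda>p. complex_of_real (h (tau p)))" if "continuous_on UNIV h" for h
    by (intro continuous_on_of_real continuous_on_compose2[OF that continuous_tau]) auto
  obtain G where "G > 0" and G: "\<And>p. p \<in> cell \<Longrightarrow> norm (complex_of_real (g (tau p))) \<le> G"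
    using continuous_bounded[OF cont[OF g]] by blast
  have "(\<lambda>n. \<integral>p. f p * of_real (q n (tau p)) \<partial>M) \<longlonglongrightarrow> (\<integral>p. f p * of_real (g (tau p)) \<partial>M)"
  proof (rule dominated_mult[OF f])
    show "(\<lambda>p. complex_of_real (q n (tau p))) \<in> borel_measurable M" for n
      using q(1) by (intro continuous_measurable_M cont) (simp add: continuous_on_polymonial_function real_polynomial_function_eq)
    show "(\<lambda>p. complex_of_real (g (tau p))) \<in> borel_measurable M"
      by (intro continuous_measurable_M cont g)
    show "norm (complex_of_real (q n (tau p))) \<le> G + 1" if "p \<in> cell" for n p
    proof -
      have "\<bar>g (tau p) - q n (tau p)\<bar> < 1 / Suc n" using q(2)[OF tauK] .
      also have "\<dots> \<le> 1" by simp
      finally show ?thesis using G[OF that] by simp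
    qed
    have "(\<lambda>n. q n (tau p)) \<longlonglongrightarrow> g (tau p)" for p
    proof -
      have "(\<lambda>n. q n (tau p) - g (tau p)) \<longlonglongrightarrow> 0"
      proof (rule Lim_null_comparison)
        show "\<forall>\<^sub>F n in sequentially. norm (q n (tau p) - g (tau p)) \<le> 1 / Suc n"
          by (rule always_eventually, rule allI)
            (use less_imp_le[OF q(2)[OF tauK]] in \<open>simp add: abs_minus_commute\<close>)
      qed (rule LIMSEQ_inverse_real_of_nat[unfolded inverse_eq_divide])
      then show ?thesis by (rule LIM_zero_cancel)
    qed
    then show "AE p in M. (\<lambda>n. complex_of_real (q n (tau p))) \<longlonglongrightarrow> complex_of_real (g (tau p))"
      by (intro AE_I2 tendsto_of_real)
  qed
  then show ?thesis unfolding poly[OF q(1)] by (simp add: LIMSEQ_const_iff)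
qed

text \<open>A compact subset of the cell has a compact image under \<open>tau\<close>, whose
  indicator is a limit of continuous functions of the distance to it; injectivity of
  \<open>tau\<close> pulls this back to the indicator of the original set.\<close>

theorem CC_complete:
  assumes f: "f \<in> L2 L a" and z: "\<And>j. ip f (CC j) = 0"
  shows "AE p in M. f p = 0"
proof (rule zero_if_compact_integrals_zero[OF integrable_L2[OF f]])
  fix K assume K: "compact K" "K \<subseteq> cell"
  show "(\<integral>p. f p * indicator K p \<partial>M) = 0"
  proof (cases "K = {}")
    case False
    define T where "T = tau ` K"
    have T: "compact T" "T \<noteq> {}" unfolding T_def using False by (simp_all add: compact_continuous_image[OF continuous_tau K(1)])
    \<comment> \<open>Equal to 1 on T and, at every point off the closed set T, equal to 0 once n is
      large.\<close>
    define g where "g n x = max 0 (1 - real n * infdist x T)" for n and x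
    have g: "continuous_on UNIV (g n)" for n
      unfolding g_def by (intro continuous_intros)
    have g01: "0 \<le> g n x" "g n x \<le> 1" for n x using infdist_nonneg[of x T] by (auto simp: g_def)
    have "(\<lambda>n. \<integral>p. f p * of_real (g n (tau p)) \<partial>M) \<longlonglongrightarrow> (\<integral>p. f p * indicator K p \<partial>M)"
    proof (rule dominated_mult[OF f])
      show "(\<lambda>p. complex_of_real (g n (tau p))) \<in> borel_measurable M" for n
        by (intro continuous_measurable_M continuous_on_of_real continuous_on_compose2[OF g continuous_tau]) auto
      show "indicator K \<in> borel_measurable M"
        using sets_M[OF borel_compact[OF K(1)]] K(2) by (simp add: Int_absorb2)
      show "norm (complex_of_real (g n (tau p))) \<le> 1" for n p using g01 by simp
      show "AE p in M. (\<lambda>n. complex_of_real (g n (tau p))) \<longlonglongrightarrow> indicator K p"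
      proof (rule AE_I2)
        fix p assume p: "p \<in> space M"
        show "(\<lambda>n. complex_of_real (g n (tau p))) \<longlonglongrightarrow> indicator K p"
        proof (cases "p \<in> K")
          case True
          then show ?thesis by (simp add: g_def T_def)
        next
          case notK: False
          have "tau p \<notin> T"
          proof
            assume "tau p \<in> T"
            then obtain q where q: "q \<in> K" "tau p = tau q" unfolding T_def by blast
            have "p = q" using inj_onD[OF tau_inj q(2)] p q(1) K(2) by (simp add: space_M subset_iff)
            then show False using notK q(1) by simp
          qed
          then have pos: "infdist (tau p) T > 0"
            using infdist_pos_not_in_closed[OF compact_imp_closed[OF T(1)] T(2)] by simp
          have "\<forall>\<^sub>F n in sequentially. 1 \<le> real n * infdist (tau p) T"
            using filterlim_nat_mult[OF pos] by (simp add: filterlim_at_top)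
          then have "\<forall>\<^sub>F n in sequentially. 0 = complex_of_real (g n (tau p))"
            by eventually_elim (simp add: g_def)
          then show ?thesis using notK by (auto intro: Lim_transform_eventually[OF tendsto_const])
        qed
      qed
    qed
    then show ?thesis unfolding continuous_tau_integral_zero[OF f z g] by (simp add: LIMSEQ_const_iff)
  qed simp
qed

text \<open>sin(pi z / a) times a cosine mode is a combination of sine modes, so f sin(pi z / a) is
  orthogonal to all cosine modes. The factor is positive between the plates and can be
  cancelled.\<close>

theorem SS_complete:
  assumes f: "f \<in> L2 L a" and z: "\<And>j. ip f (SS j) = 0"
  shows "AE p in M. f p = 0"
proof -
  define s where "s p = complex_of_real (sin (pi / a * snd (snd p)))" for p :: pt
  have s: "bdd s" unfolding s_def by (intro bdd_continuous continuous_intros)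
  have z': "(\<integral>p. f p * SS j p \<partial>M) = 0" for j
    using z[of "neg j"] by (simp add: s_inner_def cnj_SS)
  have "ip (\<lambda>p. f p * s p) (CC j) = 0" for j
  proof -
    obtain c d i k where e: "(\<lambda>p. s p * CC (neg j) p) = (\<lambda>p. c * SS i p + d * SS k p)"
      using sin_CC[of "neg j"] unfolding s_def by blast
    have "ip (\<lambda>p. f p * s p) (CC j) = (\<integral>p. f p * (s p * CC (neg j) p) \<partial>M)"
      by (simp add: s_inner_def cnj_CC mult.assoc)
    also have "\<dots> = (\<integral>p. c * (f p * SS i p) + d * (f p * SS k p) \<partial>M)"
      by (intro Bochner_Integration.integral_cong refl, subst fun_cong[OF e]) (simp add: algebra_simps)
    also have "\<dots> = 0" using integrable_mult_L2[OF f L2_SS] z' by simp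
    finally show ?thesis .
  qed
  from CC_complete[OF bdd_L2[OF f s] this] AE_interior show ?thesis
  proof eventually_elim
    case (elim p)
    have "sin (pi / a * snd (snd p)) > 0"
    proof (rule sin_gt_zero)
      show "0 < pi / a * snd (snd p)" using elim a by simp
      have "pi / a * snd (snd p) < pi / a * a" using elim a by (intro mult_strict_left_mono) auto
      then show "pi / a * snd (snd p) < pi" using a by simp
    qed
    then show ?case using elim by (simp add: s_def)
  qed
qed

text \<open>The fundamental lemma of the calculus of variations, deduced from completeness: cosine
  modes times cutoffs are test functions.\<close>

lemma zero_if_test_integrals_zero:
  assumes f: "f \<in> L2 L a" and z: "\<And>h. h \<in> test L a \<Longrightarrow> (\<integral>p. f p * h p \<partial>M) = 0"
  shows "AE p in M. f p = 0"
proof (rule CC_complete[OF f])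
  fix j
  have "(\<lambda>m. \<integral>p. f p * (cut m p * CC (neg j) p) \<partial>M) \<longlonglongrightarrow> (\<integral>p. f p * CC (neg j) p \<partial>M)"
    by (intro cut_limit f smooth_per_CC)
  moreover have "(\<integral>p. f p * (cut m p * CC (neg j) p) \<partial>M) = 0" for m
    by (intro z cut_test smooth_per_CC)
  ultimately show "ip f (CC j) = 0"
    by (simp add: s_inner_def cnj_CC LIMSEQ_const_iff)
qed

end

section \<open>Expansions in an orthonormal basis\<close>

text \<open>An increasing exhaustion by finite sets, so that multiple Fourier series become
  sequences of partial sums.\<close>

definition box_index :: "nat \<Rightarrow> index set" where
  "box_index N = {- int N..int N} \<times> {- int N..int N} \<times> {..N}"

lemma finite_box_index [simp]: "finite (box_index N)"
  by (simp add: box_index_def)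

lemma box_index_mono: "m \<le> n \<Longrightarrow> box_index m \<subseteq> box_index n"
  by (auto simp: box_index_def)

lemma box_index_exhausts: "\<forall>\<^sub>F N in sequentially. j \<in> box_index N"
proof -
  obtain p q n where j: "j = (p, q, n)" by (cases j)
  have "j \<in> box_index N" if "N \<ge> nat \<bar>p\<bar> + nat \<bar>q\<bar> + n" for N
    using that by (auto simp: box_index_def j)
  then show ?thesis unfolding eventually_sequentially by blast
qed

text \<open>Square summability, phrased through partial sums over boxes: Bessel bounds exactly
  these, and Riesz-Fischer starts from them.\<close>

definition sq_bounded :: "(index \<Rightarrow> complex) \<Rightarrow> bool" where
  "sq_bounded c \<longleftrightarrow> (\<exists>K. \<forall>N. (\<Sum>j\<in>box_index N. (norm (c j))\<^sup>2) \<le> K)"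

lemma sq_bounded_comparison:
  assumes "sq_bounded c" "sq_bounded d" "\<And>j. (norm (e j))\<^sup>2 \<le> K * (norm (c j))\<^sup>2 + K * (norm (d j))\<^sup>2" "K \<ge> 0"
  shows "sq_bounded e"
proof -
  obtain A B where A: "\<And>N. (\<Sum>j\<in>box_index N. (norm (c j))\<^sup>2) \<le> A" and B: "\<And>N. (\<Sum>j\<in>box_index N. (norm (d j))\<^sup>2) \<le> B"
    using assms(1,2) unfolding sq_bounded_def by blast
  have "(\<Sum>j\<in>box_index N. (norm (e j))\<^sup>2) \<le> K * A + K * B" for N
  proof -
    have "(\<Sum>j\<in>box_index N. (norm (e j))\<^sup>2) \<le> (\<Sum>j\<in>box_index N. K * (norm (c j))\<^sup>2 + K * (norm (d j))\<^sup>2)"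
      by (intro sum_mono assms)
    also have "\<dots> = K * (\<Sum>j\<in>box_index N. (norm (c j))\<^sup>2) + K * (\<Sum>j\<in>box_index N. (norm (d j))\<^sup>2)"
      by (simp add: sum.distrib sum_distrib_left)
    also have "\<dots> \<le> K * A + K * B"
      using A B assms(4) by (intro add_mono mult_left_mono)
    finally show ?thesis .
  qed
  then show ?thesis unfolding sq_bounded_def by blast
qed

lemma sq_bounded_add: "sq_bounded c \<Longrightarrow> sq_bounded d \<Longrightarrow> sq_bounded (\<lambda>j. c j + d j)"
proof (rule sq_bounded_comparison[where K=2])
  fix j
  have "(norm (c j + d j))\<^sup>2 \<le> (norm (c j) + norm (d j))\<^sup>2"
    by (intro power_mono norm_triangle_ineq) auto
  also have "\<dots> \<le> 2 * (norm (c j))\<^sup>2 + 2 * (norm (d j))\<^sup>2"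
    using sum_squares_bound[of "norm (c j)" "norm (d j)"] by (simp add: power2_sum)
  finally show "(norm (c j + d j))\<^sup>2 \<le> 2 * (norm (c j))\<^sup>2 + 2 * (norm (d j))\<^sup>2" .
qed auto

lemma sq_bounded_mult:
  assumes "sq_bounded c" "\<And>j. norm (s j) \<le> 1" shows "sq_bounded (\<lambda>j. c j * s j)"
proof (rule sq_bounded_comparison[OF assms(1) assms(1), where K=1])
  fix j
  have "(norm (c j * s j))\<^sup>2 \<le> (norm (c j))\<^sup>2"
    unfolding norm_mult by (intro power_mono mult_left_le assms) auto
  then show "(norm (c j * s j))\<^sup>2 \<le> 1 * (norm (c j))\<^sup>2 + 1 * (norm (c j))\<^sup>2"
    using zero_le_power2[of "norm (c j)"] by linarith
qed auto

text \<open>The expansion theory shared by the sine and cosine families. Both keep the same index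
  set so that coefficients of different components of a field can be combined index by
  index.\<close>

locale mode_basis = slab_domain +
  fixes \<phi> :: "index \<Rightarrow> sfield"
  assumes L2_mode: "\<phi> j \<in> L2 L a"
    and orthogonal_modes: "i \<noteq> j \<Longrightarrow> ip (\<phi> i) (\<phi> j) = 0"
    and normal_modes: "\<phi> j \<noteq> (\<lambda>p. 0) \<Longrightarrow> ip (\<phi> j) (\<phi> j) = 1"
    and complete_modes: "f \<in> L2 L a \<Longrightarrow> (\<And>j. ip f (\<phi> j) = 0) \<Longrightarrow> AE p in slab L a. f p = 0"
begin

text \<open>Some \<open>\<phi> j\<close> may be zero (sine modes with \<open>n = 0\<close>); coefficient families must vanish there.\<close>

definition adapted :: "(index \<Rightarrow> complex) \<Rightarrow> bool" where
  "adapted c \<longleftrightarrow> (\<forall>j. \<phi> j = (\<lambda>p. 0) \<longrightarrow> c j = 0)"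

definition coeff :: "sfield \<Rightarrow> index \<Rightarrow> complex" where
  "coeff f j = ip f (\<phi> j)"

definition psum :: "(index \<Rightarrow> complex) \<Rightarrow> index set \<Rightarrow> sfield" where
  "psum c B = (\<lambda>p. \<Sum>j\<in>B. c j * \<phi> j p)"

lemma L2_psum: "psum c B \<in> L2 L a"
  unfolding psum_def by (intro L2_sum L2_cmult L2_mode)

lemma adapted_coeff: "adapted (coeff f)"
  by (simp add: adapted_def coeff_def s_inner_def)

lemma ip_psum_left: "h \<in> L2 L a \<Longrightarrow> ip (psum c B) h = (\<Sum>j\<in>B. c j * ip (\<phi> j) h)"
  unfolding psum_def by (subst ip_sum_left) (auto intro: L2_cmult L2_mode simp: ip_cmult_left)

lemma coeff_psum:
  assumes "adapted c" "finite B"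
  shows "coeff (psum c B) i = (if i \<in> B then c i else 0)"
proof -
  \<comment> \<open>If mode i is identically zero, both sides vanish because c is adapted.\<close>
  have "c j * ip (\<phi> j) (\<phi> i) = (if j = i then c i else 0)" for j
    using orthogonal_modes[of j i] normal_modes[of i] assms(1) by (auto simp: adapted_def)
  then show ?thesis
    using assms(2) by (simp add: coeff_def ip_psum_left L2_mode)
qed

lemma nm_psum:
  assumes "adapted c" "finite B"
  shows "(nm (psum c B))\<^sup>2 = (\<Sum>j\<in>B. (norm (c j))\<^sup>2)"
proof -
  have "c j * ip (\<phi> j) (psum c B) = of_real ((norm (c j))\<^sup>2)" if "j \<in> B" for j
  proof -
    have "ip (\<phi> j) (psum c B) = cnj (c j)"
      using coeff_psum[OF assms, of j] that ip_cnj[of "psum c B" "\<phi> j"] by (simp add: coeff_def)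
    then show ?thesis by (simp only: complex_norm_square)
  qed
  then have "ip (psum c B) (psum c B) = of_real (\<Sum>j\<in>B. (norm (c j))\<^sup>2)"
    by (simp add: ip_psum_left L2_psum del: of_real_power)
  then show ?thesis by (simp only: ip_self of_real_eq_iff)
qed

text \<open>Expands the squared norm of f minus its projection onto finitely many modes.\<close>

lemma Bessel:
  assumes f: "f \<in> L2 L a" and B: "finite B"
  shows "(\<Sum>j\<in>B. (norm (coeff f j))\<^sup>2) \<le> (nm f)\<^sup>2"
proof -
  let ?s = "psum (coeff f) B"
  have s: "?s \<in> L2 L a" by (rule L2_psum)
  define b where "b = (\<Sum>j\<in>B. (norm (coeff f j))\<^sup>2)"
  have "ip ?s f = (\<Sum>j\<in>B. coeff f j * cnj (coeff f j))"
    using ip_cnj[of f] by (simp add: ip_psum_left f coeff_def)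
  then have sf: "ip ?s f = of_real b" by (simp add: b_def complex_norm_square del: of_real_power)
  then have fs: "ip f ?s = of_real b" using ip_cnj[of ?s f] by simp
  have ss: "ip ?s ?s = of_real b" unfolding ip_self nm_psum[OF adapted_coeff B] b_def ..
  have e: "ip (\<lambda>p. f p - ?s p) g = ip f g - ip ?s g" if "g \<in> L2 L a" for g
    by (rule ip_diff_left[OF f s that])
  have d: "(\<lambda>p. f p - ?s p) \<in> L2 L a" by (rule L2_diff[OF f s])
  have "of_real ((nm (\<lambda>p. f p - ?s p))\<^sup>2) = cnj (ip f (\<lambda>p. f p - ?s p)) - cnj (ip ?s (\<lambda>p. f p - ?s p))"
    using e[OF d] ip_cnj[of "\<lambda>p. f p - ?s p" "\<lambda>p. f p - ?s p"] by (simp only: ip_self complex_cnj_diff[symmetric])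
  also have "\<dots> = ip f f - ip ?s f - (ip f ?s - ip ?s ?s)"
    unfolding ip_cnj using e[OF f] e[OF s] by simp
  also have "\<dots> = of_real ((nm f)\<^sup>2 - b)" unfolding sf fs ss by (simp add: ip_self)
  finally have "(nm (\<lambda>p. f p - ?s p))\<^sup>2 = (nm f)\<^sup>2 - b" by (simp only: of_real_eq_iff)
  then show ?thesis using zero_le_power2[of "nm (\<lambda>p. f p - ?s p)"] by (simp add: b_def)
qed

lemma sq_bounded_coeff: "f \<in> L2 L a \<Longrightarrow> sq_bounded (coeff f)"
  unfolding sq_bounded_def using Bessel[of f] by (intro exI[of _ "(nm f)\<^sup>2"]) auto

text \<open>By Pythagoras the squared distance of two partial sums is a difference of terms of a
  bounded increasing sequence.\<close>

lemma Riesz_Fischer: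
  assumes c: "adapted c" and b: "sq_bounded c"
  shows "\<exists>f. l2conv (\<lambda>N. psum c (box_index N)) f"
proof (rule L2_complete)
  define s where "s N = (\<Sum>j\<in>box_index N. (norm (c j))\<^sup>2)" for N
  have mono: "incseq s"
    unfolding s_def incseq_def by (intro allI impI sum_mono2 finite_box_index box_index_mono) auto
  obtain K where "\<And>N. s N \<le> K" using b unfolding sq_bounded_def s_def by blast
  then obtain l where "s \<longlonglongrightarrow> l" using incseq_convergent[OF mono] by blast
  then have "convergent s" by (rule convergentI)
  then have Cauchy: "Cauchy s" by (rule convergent_Cauchy)
  have diff: "(nm (\<lambda>p. psum c (box_index n) p - psum c (box_index m) p))\<^sup>2 = s n - s m" if "m \<le> n" for m n
  proof -
    have sub: "box_index m \<subseteq> box_index n" using that by (rule box_index_mono)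
    have "(\<lambda>p. psum c (box_index n) p - psum c (box_index m) p) = psum c (box_index n - box_index m)"
      unfolding psum_def by (simp add: sum_diff[OF finite_box_index sub])
    then show ?thesis
      unfolding s_def by (simp add: nm_psum[OF c] sum_diff[OF finite_box_index sub])
  qed
  fix e :: real assume e: "e > 0"
  then have "e\<^sup>2 > 0" by simp
  then obtain N where N: "\<And>m n. m \<ge> N \<Longrightarrow> n \<ge> N \<Longrightarrow> \<bar>s m - s n\<bar> < e\<^sup>2"
    using Cauchy unfolding Cauchy_def dist_real_def by blast
  have "nm (\<lambda>p. psum c (box_index n) p - psum c (box_index m) p) < e" if "m \<ge> N" "n \<ge> N" "m \<le> n" for m n
  proof -
    have "(nm (\<lambda>p. psum c (box_index n) p - psum c (box_index m) p))\<^sup>2 < e\<^sup>2"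
      using diff[OF that(3)] N[OF that(2,1)] by simp
    then show ?thesis by (rule power2_less_imp_less[OF _ less_imp_le[OF e]])
  qed
  then have "nm (\<lambda>p. psum c (box_index m) p - psum c (box_index n) p) < e" if "m \<ge> N" "n \<ge> N" for m n
    using that nm_minus_commute[of "psum c (box_index n)" "psum c (box_index m)"] linear[of m n] by metis
  then show "\<exists>N. \<forall>m\<ge>N. \<forall>n\<ge>N. nm (\<lambda>p. psum c (box_index m) p - psum c (box_index n) p) < e"
    by (intro exI[of _ N] allI impI)
qed (rule L2_psum)

text \<open>Every index eventually lies in the boxes, so its coefficient along the partial sums is
  eventually constant.\<close>

lemma coeff_limit:
  assumes "adapted c" "l2conv (\<lambda>N. psum c (box_index N)) f"
  shows "coeff f i = c i"
proof -
  have "(\<lambda>N. coeff (psum c (box_index N)) i) \<longlonglongrightarrow> coeff f i"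
    unfolding coeff_def by (rule l2conv_ip[OF assms(2) L2_mode])
  moreover have "\<forall>\<^sub>F N in sequentially. coeff (psum c (box_index N)) i = c i"
    using box_index_exhausts[of i] by eventually_elim (simp add: coeff_psum[OF assms(1)])
  ultimately show ?thesis
    by (rule tendsto_unique[OF sequentially_bot _ tendsto_eventually])
qed

lemma coeff_add: "f \<in> L2 L a \<Longrightarrow> g \<in> L2 L a \<Longrightarrow> coeff (\<lambda>p. c * f p + d * g p) j = c * coeff f j + d * coeff g j"
  unfolding coeff_def by (simp add: ip_add_left L2_cmult L2_mode ip_cmult_left)

lemma coeff_cong_AE: "f \<in> L2 L a \<Longrightarrow> g \<in> L2 L a \<Longrightarrow> AE p in M. f p = g p \<Longrightarrow> coeff f j = coeff g j"
  unfolding coeff_def by (rule ip_cong_AE[OF _ _ L2_mode])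

lemma AE_eq_if_coeff_eq:
  assumes f: "f \<in> L2 L a" and g: "g \<in> L2 L a" and "\<And>j. coeff f j = coeff g j"
  shows "AE p in M. f p = g p"
proof -
  have "AE p in M. f p - g p = 0"
    by (rule complete_modes[OF L2_diff[OF f g]])
      (use assms in \<open>simp add: ip_diff_left[OF f g L2_mode] coeff_def\<close>)
  then show ?thesis by simp
qed

lemma l2conv_cong_AE: "l2conv X f \<Longrightarrow> g \<in> L2 L a \<Longrightarrow> AE p in M. f p = g p \<Longrightarrow> l2conv X g"
proof -
  assume X: "l2conv X f" and g: "g \<in> L2 L a" and fg: "AE p in M. f p = g p"
  have "nm (\<lambda>p. X n p - f p) = nm (\<lambda>p. X n p - g p)" for n
  proof -
    have "X n \<in> L2 L a" "f \<in> L2 L a" using X by (simp_all add: l2conv_def)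
    note [measurable] = this[THEN L2_measurable] L2_measurable[OF g]
    have "(\<integral>p. (norm (X n p - f p))\<^sup>2 \<partial>M) = (\<integral>p. (norm (X n p - g p))\<^sup>2 \<partial>M)"
    proof (rule integral_cong_AE)
      show "AE p in M. (norm (X n p - f p))\<^sup>2 = (norm (X n p - g p))\<^sup>2"
        using fg by eventually_elim simp
    qed measurable
    then show ?thesis by (simp add: L2_norm_def)
  qed
  with X g show ?thesis by (simp add: l2conv_def)
qed

text \<open>Riesz-Fischer produces some limit of the partial sums; it has the coefficients of f, so
  completeness identifies it with f almost everywhere.\<close>

lemma expansion:
  assumes f: "f \<in> L2 L a"
  shows "l2conv (\<lambda>N. psum (coeff f) (box_index N)) f"
proof -
  obtain g where g: "l2conv (\<lambda>N. psum (coeff f) (box_index N)) g"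
    using Riesz_Fischer[OF adapted_coeff sq_bounded_coeff[OF f]] by blast
  have "g \<in> L2 L a" using g by (simp add: l2conv_def)
  from AE_eq_if_coeff_eq[OF this f coeff_limit[OF adapted_coeff g]]
  show ?thesis by (rule l2conv_cong_AE[OF g f])
qed

lemma Parseval:
  assumes f: "f \<in> L2 L a" and g: "g \<in> L2 L a"
  shows "(\<lambda>N. \<Sum>j\<in>box_index N. coeff f j * cnj (coeff g j)) \<longlonglongrightarrow> ip f g"
proof -
  have "(\<lambda>N. ip (psum (coeff f) (box_index N)) g) \<longlonglongrightarrow> ip f g"
    by (rule l2conv_ip[OF expansion[OF f] g])
  then show ?thesis by (simp add: ip_psum_left[OF g] coeff_def ip_cnj)
qed

text \<open>A chosen representative that depends on the coefficients alone: equal coefficient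
  families give literally equal functions.\<close>

definition syn :: "(index \<Rightarrow> complex) \<Rightarrow> sfield" where
  "syn c = (SOME f. l2conv (\<lambda>N. psum c (box_index N)) f)"

lemma syn:
  assumes "adapted c" "sq_bounded c"
  shows "l2conv (\<lambda>N. psum c (box_index N)) (syn c)" "syn c \<in> L2 L a" "coeff (syn c) j = c j"
proof -
  show l: "l2conv (\<lambda>N. psum c (box_index N)) (syn c)"
    unfolding syn_def by (rule someI_ex[OF Riesz_Fischer[OF assms]])
  then show "syn c \<in> L2 L a" by (simp add: l2conv_def)
  show "coeff (syn c) j = c j" by (rule coeff_limit[OF assms(1) l])
qed

end

context slab_domain
begin

sublocale C: mode_basis L a CC
proof unfold_locales
  show "AE p in M. f p = 0" if "f \<in> L2 L a" "\<And>j. ip f (CC j) = 0" for f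
    using that by (rule CC_complete)
qed (simp_all add: ip_CC L2_CC)

sublocale S: mode_basis L a SS
proof unfold_locales
  show "ip (SS i) (SS j) = 0" if "i \<noteq> j" for i j
    using ip_SS[of j i] that SS_zero[of j] by (cases "snd (snd j) = 0") (auto simp: s_inner_def)
  show "ip (SS j) (SS j) = 1" if "SS j \<noteq> (\<lambda>p. 0)" for j
    using ip_SS[of j j] that SS_zero[of j] by auto
  show "AE p in M. f p = 0" if "f \<in> L2 L a" "\<And>j. ip f (SS j) = 0" for f
    using that by (rule SS_complete)
qed (rule L2_SS)

lemma C_adapted: "C.adapted c"
proof -
  have "CC j \<noteq> (\<lambda>p. 0)" for j
    using ip_CC[of j j] by (auto simp: s_inner_def)
  then show ?thesis by (simp add: C.adapted_def)
qed

lemma S_adapted_iff: "S.adapted c \<longleftrightarrow> (\<forall>j. snd (snd j) = 0 \<longrightarrow> c j = 0)"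
proof -
  have "SS j = (\<lambda>p. 0) \<longleftrightarrow> snd (snd j) = 0" for j
    using SS_zero[of j] ip_SS[of j j] by (cases "snd (snd j) = 0") (auto simp: s_inner_def)
  then show ?thesis by (simp add: S.adapted_def)
qed

lemma S_coeff_0: "snd (snd j) = 0 \<Longrightarrow> S.coeff f j = 0"
  using S.adapted_coeff[of f] by (simp add: S_adapted_iff)

end

section \<open>Vector fields and weak derivatives\<close>

lemma norm_vec_sq: "(norm (v :: complex ^ 3))\<^sup>2 = (\<Sum>i\<in>UNIV. (norm (v $ i))\<^sup>2)"
  by (simp add: norm_vec_def L2_set_def sum_nonneg)

lemma measurable_vec_iff:
  fixes E :: "'a \<Rightarrow> complex ^ 3"
  shows "E \<in> borel_measurable N \<longleftrightarrow> (\<forall>i. (\<lambda>p. E p $ i) \<in> borel_measurable N)"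
proof (intro iffI allI)
  show "(\<lambda>p. E p $ i) \<in> borel_measurable N" if "E \<in> borel_measurable N" for i
    by (rule borel_measurable_continuous_on[OF _ that]) (intro continuous_intros)
  assume "\<forall>i. (\<lambda>p. E p $ i) \<in> borel_measurable N"
  then have [measurable]: "(\<lambda>p. E p $ i) \<in> borel_measurable N" for i by blast
  have "(\<lambda>p. E p \<bullet> axis i u) \<in> borel_measurable N" for i and u :: complex
    unfolding inner_axis by measurable
  then show "E \<in> borel_measurable N"
    by (subst borel_measurable_euclidean_space) (auto simp: Basis_vec_def)
qed

section \<open>Closures, smooth fields and test fields\<close>

lemma norm_closureD:
  assumes "f \<in> norm_closure N X A" and "\<And>h. 0 \<le> N h"
  shows "f \<in> X" "\<exists>g. (\<forall>n. g n \<in> A) \<and> (\<lambda>n::nat. N (\<lambda>p. f p - g n p)) \<longlonglongrightarrow> 0"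
proof -
  show "f \<in> X" using assms(1) by (simp add: norm_closure_def)
  have "\<forall>n. \<exists>g\<in>A. N (\<lambda>p. f p - g p) < inverse (real (Suc n))"
    using assms(1) by (simp add: norm_closure_def)
  then obtain g where g: "\<And>n. g n \<in> A" "\<And>n. N (\<lambda>p. f p - g n p) < inverse (real (Suc n))"
    by metis
  have "(\<lambda>n. N (\<lambda>p. f p - g n p)) \<longlonglongrightarrow> 0"
  proof (rule Lim_null_comparison)
    show "\<forall>\<^sub>F n in sequentially. norm (N (\<lambda>p. f p - g n p)) \<le> inverse (real (Suc n))"
      by (rule always_eventually, rule allI)
        (use less_imp_le[OF g(2)] assms(2) in simp)
  qed (rule LIMSEQ_inverse_real_of_nat)
  with g(1) show "\<exists>g. (\<forall>n. g n \<in> A) \<and> (\<lambda>n::nat. N (\<lambda>p. f p - g n p)) \<longlonglongrightarrow> 0"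
    by blast
qed

lemma norm_closureI:
  assumes "f \<in> X" "\<And>n. g n \<in> A" "(\<lambda>n::nat. N (\<lambda>p. f p - g n p)) \<longlonglongrightarrow> 0"
  shows "f \<in> norm_closure N X A"
  unfolding norm_closure_def
proof (intro CollectI conjI allI impI)
  fix e :: real assume "e > 0"
  then have "\<forall>\<^sub>F n in sequentially. N (\<lambda>p. f p - g n p) < e"
    using order_tendstoD(2)[OF assms(3)] by simp
  then obtain n where "N (\<lambda>p. f p - g n p) < e"
    unfolding eventually_sequentially by blast
  with assms(2) show "\<exists>g\<in>A. N (\<lambda>p. f p - g p) < e" by blast
qed (rule assms(1))

lemma grad_nth [simp]: "grad f p $ 1 = pdx f p" "grad f p $ 2 = pdy f p" "grad f p $ 3 = pdz f p"
  by (simp_all add: grad_def)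

lemma curl_nth [simp]:
  "curl E p $ 1 = pdy (\<lambda>q. E q $ 3) p - pdz (\<lambda>q. E q $ 2) p"
  "curl E p $ 2 = pdz (\<lambda>q. E q $ 1) p - pdx (\<lambda>q. E q $ 3) p"
  "curl E p $ 3 = pdx (\<lambda>q. E q $ 2) p - pdy (\<lambda>q. E q $ 1) p"
  by (simp_all add: curl_def)

lemma smooth_per_v_iff: "E \<in> smooth_per_v L \<longleftrightarrow>
    (\<lambda>p. E p $ 1) \<in> smooth_per L \<and> (\<lambda>p. E p $ 2) \<in> smooth_per L \<and> (\<lambda>p. E p $ 3) \<in> smooth_per L"
  by (simp add: smooth_per_v_def forall_3)

lemma smooth_per_vD: "E \<in> smooth_per_v L \<Longrightarrow> (\<lambda>p. E p $ i) \<in> smooth_per L"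
  by (simp add: smooth_per_v_def)

lemma smooth_per_v_smooth: "E \<in> smooth_per_v L \<Longrightarrow> smooth (\<lambda>p. E p $ i)"
  by (intro smooth_per_smooth smooth_per_vD)

lemma smooth_per_grad: "u \<in> smooth_per L \<Longrightarrow> grad u \<in> smooth_per_v L"
  by (simp add: smooth_per_v_iff smooth_per_pds)

lemma smooth_per_curl: "E \<in> smooth_per_v L \<Longrightarrow> curl E \<in> smooth_per_v L"
  by (simp add: smooth_per_v_iff smooth_per_diff smooth_per_pds)

lemma smooth_per_divergence: "E \<in> smooth_per_v L \<Longrightarrow> divergence E \<in> smooth_per L"
  unfolding divergence_def by (intro smooth_per_add smooth_per_pds smooth_per_vD)

lemma test_smooth_per: "f \<in> test L a \<Longrightarrow> f \<in> smooth_per L"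
  by (simp add: test_def)

lemma test_v_smooth: "F \<in> test_v L a \<Longrightarrow> F \<in> smooth_per_v L"
  unfolding test_v_def smooth_per_v_def using test_smooth_per by blast

lemma test_plates:
  assumes "f \<in> test L a" "z = 0 \<or> z = a" shows "f (x, y, z) = 0"
proof -
  obtain \<delta> where "\<delta> > 0" "\<forall>x y z. z < \<delta> \<or> a - \<delta> < z \<longrightarrow> f (x, y, z) = 0"
    using assms(1) by (auto simp: test_def)
  then show ?thesis using assms(2) by (metis diff_gt_0_iff_gt diff_less_eq less_add_same_cancel1)
qed

lemma test_v_plates: "F \<in> test_v L a \<Longrightarrow> z = 0 \<or> z = a \<Longrightarrow> F (x, y, z) $ i = 0"
  unfolding test_v_def using test_plates[of "\<lambda>p. F p $ i"] by blast

lemma zero_test: "(\<lambda>p. 0) \<in> test L a"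
  by (auto simp: test_def smooth_per_const intro: exI[of _ 1])

lemma axis_test_v: "h \<in> test L a \<Longrightarrow> (\<lambda>p. axis i (h p)) \<in> test_v L a"
proof -
  assume h: "h \<in> test L a"
  have "(\<lambda>p. axis i (h p) $ k) \<in> test L a" for k
    by (cases "k = i") (simp_all add: axis_def h zero_test)
  then show ?thesis by (simp add: test_v_def)
qed

context slab_domain
begin

section \<open>The Hilbert space of vector fields\<close>

abbreviation vL2 :: "vfield set" where "vL2 \<equiv> L2 L a"

abbreviation vip :: "vfield \<Rightarrow> vfield \<Rightarrow> complex" where "vip \<equiv> v_inner L a"

abbreviation vnm :: "vfield \<Rightarrow> real" where "vnm \<equiv> L2_norm L a"

lemma vL2_iff: "E \<in> vL2 \<longleftrightarrow> (\<forall>i. (\<lambda>p. E p $ i) \<in> L2 L a)"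
proof
  assume E: "E \<in> vL2"
  show "\<forall>i. (\<lambda>p. E p $ i) \<in> L2 L a"
  proof
    fix i
    show "(\<lambda>p. E p $ i) \<in> L2 L a"
    proof (rule L2_by_bound)
      show "(\<lambda>p. E p $ i) \<in> borel_measurable M"
        using L2_measurable[OF E] measurable_vec_iff by blast
      show "integrable M (\<lambda>p. (norm (E p))\<^sup>2)" using E by (simp add: L2_iff)
      show "(norm (E p $ i))\<^sup>2 \<le> (norm (E p))\<^sup>2" for p
        by (intro power_mono Finite_Cartesian_Product.norm_nth_le norm_ge_zero)
    qed
  qed
next
  assume E: "\<forall>i. (\<lambda>p. E p $ i) \<in> L2 L a"
  show "E \<in> vL2"
  proof (rule L2_by_bound)
    show "E \<in> borel_measurable M" using E L2_measurable measurable_vec_iff by blast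
    show "integrable M (\<lambda>p. \<Sum>i\<in>UNIV. (norm (E p $ i))\<^sup>2)"
      using E by (intro Bochner_Integration.integrable_sum) (simp add: L2_iff)
    show "(norm (E p))\<^sup>2 \<le> (\<Sum>i\<in>UNIV. (norm (E p $ i))\<^sup>2)" for p by (simp add: norm_vec_sq)
  qed
qed

lemma vL2_nth: "E \<in> vL2 \<Longrightarrow> (\<lambda>p. E p $ i) \<in> L2 L a"
  using vL2_iff by blast

lemma vL2_diff: "E \<in> vL2 \<Longrightarrow> F \<in> vL2 \<Longrightarrow> (\<lambda>p. E p - F p) \<in> vL2"
  by (simp add: vL2_iff L2_diff)

lemma vL2_smooth: "E \<in> smooth_per_v L \<Longrightarrow> E \<in> vL2"
  by (simp add: vL2_iff smooth_per_vD L2_smooth_per)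

lemma v_inner_sum: "E \<in> vL2 \<Longrightarrow> F \<in> vL2 \<Longrightarrow> vip E F = (\<Sum>i\<in>UNIV. ip (\<lambda>p. E p $ i) (\<lambda>p. F p $ i))"
  unfolding v_inner_def s_inner_def
  by (rule Bochner_Integration.integral_sum) (intro ip_integrable vL2_nth)

lemma pairing_sum: "E \<in> vL2 \<Longrightarrow> F \<in> vL2 \<Longrightarrow> pairing L a E F = (\<Sum>i\<in>UNIV. \<integral>p. E p $ i * F p $ i \<partial>M)"
  unfolding pairing_def
  by (rule Bochner_Integration.integral_sum) (intro integrable_mult_L2 vL2_nth)

lemma vnm_sq: "E \<in> vL2 \<Longrightarrow> (vnm E)\<^sup>2 = (\<Sum>i\<in>UNIV. (nm (\<lambda>p. E p $ i))\<^sup>2)"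
proof -
  assume E: "E \<in> vL2"
  have "(vnm E)\<^sup>2 = (\<integral>p. (\<Sum>i\<in>UNIV. (norm (E p $ i))\<^sup>2) \<partial>M)"
    by (simp add: L2_norm_def norm_vec_sq[symmetric])
  also have "\<dots> = (\<Sum>i\<in>UNIV. \<integral>p. (norm (E p $ i))\<^sup>2 \<partial>M)"
    using vL2_nth[OF E] by (intro Bochner_Integration.integral_sum) (simp add: L2_iff)
  finally show ?thesis by (simp only: nm_sq)
qed

lemma vnm_nonneg: "0 \<le> vnm E"
  by (simp add: L2_norm_def)

lemma nm_nth_le: "E \<in> vL2 \<Longrightarrow> nm (\<lambda>p. E p $ i) \<le> vnm E"
proof -
  assume E: "E \<in> vL2"
  have "(nm (\<lambda>p. E p $ i))\<^sup>2 \<le> (vnm E)\<^sup>2"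
    unfolding vnm_sq[OF E] by (rule member_le_sum) auto
  then show ?thesis by (rule power2_le_imp_le[OF _ vnm_nonneg])
qed

text \<open>Componentwise, because tangential and normal components are expanded in different bases;
  \<open>vconv_if_vnm\<close> and \<open>vnm_if_vconv\<close> relate it to the vector norm.\<close>

definition vconv :: "(nat \<Rightarrow> vfield) \<Rightarrow> vfield \<Rightarrow> bool" where
  "vconv X E \<longleftrightarrow> (\<forall>i. l2conv (\<lambda>n p. X n p $ i) (\<lambda>p. E p $ i))"

lemma vconvI: "(\<And>i. l2conv (\<lambda>n p. X n p $ i) (\<lambda>p. E p $ i)) \<Longrightarrow> vconv X E"
  by (simp add: vconv_def)

lemma vconv_vL2: "vconv X E \<Longrightarrow> E \<in> vL2" "vconv X E \<Longrightarrow> X n \<in> vL2"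
  by (auto simp: vconv_def l2conv_def vL2_iff)

lemma vconv_pairing:
  assumes "vconv X E" "F \<in> vL2" shows "(\<lambda>n. pairing L a (X n) F) \<longlonglongrightarrow> pairing L a E F"
proof -
  have "(\<lambda>n. \<Sum>i\<in>UNIV. \<integral>p. X n p $ i * F p $ i \<partial>M) \<longlonglongrightarrow> (\<Sum>i\<in>UNIV. \<integral>p. E p $ i * F p $ i \<partial>M)"
    using assms by (intro tendsto_sum l2conv_integral vL2_nth) (simp add: vconv_def)
  then show ?thesis using vconv_vL2[OF assms(1)] assms(2) by (simp add: pairing_sum)
qed

lemma vconv_inner:
  assumes "vconv X E" "F \<in> vL2" shows "(\<lambda>n. vip (X n) F) \<longlonglongrightarrow> vip E F"
proof -
  have "(\<lambda>n. \<Sum>i\<in>UNIV. ip (\<lambda>p. X n p $ i) (\<lambda>p. F p $ i)) \<longlonglongrightarrow> (\<Sum>i\<in>UNIV. ip (\<lambda>p. E p $ i) (\<lambda>p. F p $ i))"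
    using assms by (intro tendsto_sum l2conv_ip vL2_nth) (simp add: vconv_def)
  then show ?thesis using vconv_vL2[OF assms(1)] assms(2) by (simp add: v_inner_sum)
qed

lemma vconv_if_vnm:
  assumes "\<And>n. X n \<in> vL2" "E \<in> vL2" "(\<lambda>n. vnm (\<lambda>p. E p - X n p)) \<longlonglongrightarrow> 0"
  shows "vconv X E"
proof (rule vconvI)
  fix i
  have "(\<lambda>n. nm (\<lambda>p. X n p $ i - E p $ i)) \<longlonglongrightarrow> 0"
  proof (rule Lim_null_comparison[OF _ assms(3)], rule always_eventually, rule allI)
    fix n
    show "norm (nm (\<lambda>p. X n p $ i - E p $ i)) \<le> vnm (\<lambda>p. E p - X n p)"
      using nm_nth_le[OF vL2_diff[OF assms(2,1)], of n i] nm_minus_commute[of "\<lambda>p. X n p $ i" "\<lambda>p. E p $ i"] nm_nonneg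
      by simp
  qed
  then show "l2conv (\<lambda>n p. X n p $ i) (\<lambda>p. E p $ i)"
    using vL2_nth[OF assms(1)] vL2_nth[OF assms(2)] by (simp add: l2conv_def)
qed

lemma vnm_if_vconv:
  assumes "vconv X E" shows "(\<lambda>n. vnm (\<lambda>p. E p - X n p)) \<longlonglongrightarrow> 0"
proof -
  have d: "(\<lambda>p. E p - X n p) \<in> vL2" for n by (intro vL2_diff vconv_vL2[OF assms])
  have "(\<lambda>n. \<Sum>i\<in>UNIV. (nm (\<lambda>p. X n p $ i - E p $ i))\<^sup>2) \<longlonglongrightarrow> (\<Sum>i\<in>(UNIV::3 set). 0\<^sup>2)"
    using assms by (intro tendsto_sum tendsto_power) (simp add: vconv_def l2conv_def)
  then have "(\<lambda>n. (vnm (\<lambda>p. E p - X n p))\<^sup>2) \<longlonglongrightarrow> 0"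
    by (simp add: vnm_sq[OF d] nm_minus_commute[of "\<lambda>p. E p $ _"])
  from tendsto_real_sqrt[OF this] show ?thesis by (simp add: vnm_nonneg)
qed

lemma vip_cnj: "cnj (vip E F) = vip F E"
  unfolding v_inner_def by (subst Bochner_Integration.integral_cnj[symmetric]) (simp add: mult.commute)

lemma vip_cong_AE:
  assumes "E \<in> vL2" "E' \<in> vL2" "F \<in> vL2" "AE p in M. E p = E' p" shows "vip E F = vip E' F"
proof -
  have "ip (\<lambda>p. E p $ i) (\<lambda>p. F p $ i) = ip (\<lambda>p. E' p $ i) (\<lambda>p. F p $ i)" for i
    using assms(4) by (intro ip_cong_AE vL2_nth assms) (auto elim!: eventually_mono)
  then show ?thesis using assms by (simp add: v_inner_sum)
qed

lemma vip_cong_AE_right: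
  assumes "E \<in> vL2" "F \<in> vL2" "F' \<in> vL2" "AE p in M. F p = F' p" shows "vip E F = vip E F'"
  using vip_cong_AE[OF assms(2,3,1,4)] vip_cnj by metis

subsection \<open>Green's identities\<close>

lemma integral_divergence:
  assumes V: "A \<in> smooth_per L" "B \<in> smooth_per L" "C \<in> smooth_per L"
    and plates: "\<And>x y. C (x, y, 0) = 0" "\<And>x y. C (x, y, a) = 0"
  shows "(\<integral>p. pdx A p + pdy B p + pdz C p \<partial>M) = 0"
proof -
  have "integrable M (pdx A)" "integrable M (pdy B)" "integrable M (pdz C)"
    using smooth_per_pds(1)[OF V(1)] smooth_per_pds(2)[OF V(2)] smooth_per_pds(3)[OF V(3)]
    by (simp_all add: integrable_L2 L2_smooth_per)
  then show ?thesis
    using integral_pd_smooth_per(1)[OF V(1)] integral_pd_smooth_per(2)[OF V(2)]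
      integral_pd_smooth_per(3)[OF V(3) plates] by simp
qed

text \<open>The boundary term is the product of u and the normal component of F, and either factor
  may make it vanish: test fields do so through F, test functions and Dirichlet functions through
  u.\<close>

lemma Green_grad:
  assumes u: "u \<in> smooth_per L" and F: "F \<in> smooth_per_v L"
    and plates: "\<And>x y z. z = 0 \<or> z = a \<Longrightarrow> u (x, y, z) * F (x, y, z) $ 3 = 0"
  shows "(\<integral>p. u p * divergence F p \<partial>M) = - pairing L a (grad u) F"
proof -
  note Fi = smooth_per_vD[OF F]
  have i1: "integrable M (\<lambda>p. u p * divergence F p)"
    by (intro integrable_mult_L2 L2_smooth_per u smooth_per_divergence F)
  have i2: "integrable M (\<lambda>p. \<Sum>i\<in>UNIV. grad u p $ i * F p $ i)"
    by (intro Bochner_Integration.integrable_sum integrable_mult_L2 L2_smooth_per Fi smooth_per_vD smooth_per_grad u)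
  have "0 = (\<integral>p. pdx (\<lambda>p. u p * F p $ 1) p + pdy (\<lambda>p. u p * F p $ 2) p + pdz (\<lambda>p. u p * F p $ 3) p \<partial>M)"
    by (rule integral_divergence[symmetric]) (use u Fi plates in \<open>auto intro: smooth_per_mult\<close>)
  also have "\<dots> = (\<integral>p. u p * divergence F p + (\<Sum>i\<in>UNIV. grad u p $ i * F p $ i) \<partial>M)"
    by (simp add: smooth_pd_mult smooth_per_smooth[OF u] smooth_per_v_smooth[OF F] sum_3 divergence_def algebra_simps)
  also have "\<dots> = (\<integral>p. u p * divergence F p \<partial>M) + pairing L a (grad u) F"
    unfolding pairing_def by (rule Bochner_Integration.integral_add[OF i1 i2])
  finally show ?thesis by (simp add: eq_neg_iff_add_eq_0)
qed

text \<open>The divergence theorem for the cross product of E and F, whose normal component involves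
  tangential components only. A PEC field E can therefore be paired with any smooth periodic
  F.\<close>

lemma Green_curl:
  assumes E: "E \<in> smooth_per_v L" and F: "F \<in> smooth_per_v L"
    and plates: "\<And>x y z. z = 0 \<or> z = a \<Longrightarrow>
       E (x, y, z) $ 1 * F (x, y, z) $ 2 - E (x, y, z) $ 2 * F (x, y, z) $ 1 = 0"
  shows "pairing L a (curl E) F = pairing L a E (curl F)"
proof -
  note Ei = smooth_per_vD[OF E] and Fi = smooth_per_vD[OF F]
  note sE = smooth_per_v_smooth[OF E] and sF = smooth_per_v_smooth[OF F]
  have i: "integrable M (\<lambda>p. \<Sum>i\<in>UNIV. G p $ i * H p $ i)" if "G \<in> smooth_per_v L" "H \<in> smooth_per_v L" for G H
    by (intro Bochner_Integration.integrable_sum integrable_mult_L2 L2_smooth_per smooth_per_vD that)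
  have "0 = (\<integral>p. pdx (\<lambda>p. E p $ 2 * F p $ 3 - E p $ 3 * F p $ 2) p + pdy (\<lambda>p. E p $ 3 * F p $ 1 - E p $ 1 * F p $ 3) p
      + pdz (\<lambda>p. E p $ 1 * F p $ 2 - E p $ 2 * F p $ 1) p \<partial>M)"
    by (rule integral_divergence[symmetric]) (intro smooth_per_diff smooth_per_mult Ei Fi | use plates in simp)+
  also have "\<dots> = (\<integral>p. (\<Sum>i\<in>UNIV. curl E p $ i * F p $ i) - (\<Sum>i\<in>UNIV. E p $ i * curl F p $ i) \<partial>M)"
    by (simp add: smooth_pd_diff smooth_mult smooth_pd_mult sE sF sum_3 algebra_simps)
  also have "\<dots> = pairing L a (curl E) F - pairing L a E (curl F)"
    unfolding pairing_def
    by (intro Bochner_Integration.integral_diff i E F smooth_per_curl)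
  finally show ?thesis by simp
qed

subsection \<open>Weak derivatives\<close>

text \<open>Test fields with a single nonzero component reduce this to the scalar fundamental
  lemma.\<close>

lemma vL2_zero_if_pairing_zero:
  assumes "G \<in> vL2" "\<And>F. F \<in> test_v L a \<Longrightarrow> pairing L a G F = 0"
  shows "AE p in M. G p = 0"
proof -
  have "AE p in M. G p $ i = 0" for i
  proof (rule zero_if_test_integrals_zero[OF vL2_nth[OF assms(1)]])
    fix h assume h: "h \<in> test L a"
    have e: "(\<Sum>k\<in>UNIV. G p $ k * axis i (h p) $ k) = G p $ i * h p" for p
      by (simp add: axis_def if_distrib[of "\<lambda>x. _ * x"] cong: if_cong)
    from assms(2)[OF axis_test_v[OF h, of i]] show "(\<integral>p. G p $ i * h p \<partial>M) = 0"
      unfolding pairing_def e .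
  qed
  then have "AE p in M. \<forall>i\<in>UNIV. G p $ i = 0"
    by (intro AE_finite_allI) auto
  then show ?thesis by eventually_elim (simp add: vec_eq_iff)
qed

lemma pairing_diff:
  "E \<in> vL2 \<Longrightarrow> E' \<in> vL2 \<Longrightarrow> F \<in> vL2 \<Longrightarrow> pairing L a (\<lambda>p. E p - E' p) F = pairing L a E F - pairing L a E' F"
proof -
  assume E: "E \<in> vL2" "E' \<in> vL2" and F: "F \<in> vL2"
  have "(\<integral>p. (E p - E' p) $ i * F p $ i \<partial>M) = (\<integral>p. E p $ i * F p $ i \<partial>M) - (\<integral>p. E' p $ i * F p $ i \<partial>M)" for i
    unfolding vector_minus_component left_diff_distrib
    by (intro Bochner_Integration.integral_diff integrable_mult_L2 vL2_nth E F)
  then show ?thesis using E F by (simp add: pairing_sum vL2_diff sum_subtractf)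
qed

lemma test_v_vL2: "F \<in> test_v L a \<Longrightarrow> F \<in> vL2"
  by (rule vL2_smooth[OF test_v_smooth])

lemma weak_grad_vL2: "is_weak_grad L a u G \<Longrightarrow> G \<in> vL2"
  by (simp add: is_weak_grad_def)

lemma weak_curl_vL2: "is_weak_curl L a E C \<Longrightarrow> C \<in> vL2"
  by (simp add: is_weak_curl_def)

lemma AE_eq_if_pairing_eq:
  assumes G: "G \<in> vL2" and H: "H \<in> vL2"
    and "\<And>F. F \<in> test_v L a \<Longrightarrow> pairing L a G F = pairing L a H F"
  shows "AE p in M. G p = H p"
proof -
  have "AE p in M. G p - H p = 0"
    by (rule vL2_zero_if_pairing_zero[OF vL2_diff[OF G H]]) (simp add: assms pairing_diff test_v_vL2)
  then show ?thesis by simp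
qed

lemma weak_grad_unique: "is_weak_grad L a u G \<Longrightarrow> is_weak_grad L a u H \<Longrightarrow> AE p in M. G p = H p"
  by (rule AE_eq_if_pairing_eq) (simp_all add: is_weak_grad_def)

lemma weak_curl_unique: "is_weak_curl L a E G \<Longrightarrow> is_weak_curl L a E H \<Longrightarrow> AE p in M. G p = H p"
  by (rule AE_eq_if_pairing_eq) (simp_all add: is_weak_curl_def)

lemma weak_grad_smooth: "u \<in> smooth_per L \<Longrightarrow> is_weak_grad L a u (grad u)"
proof -
  assume u: "u \<in> smooth_per L"
  have "(\<integral>p. u p * divergence F p \<partial>M) = - pairing L a (grad u) F" if F: "F \<in> test_v L a" for F
    using test_v_plates[OF F] by (intro Green_grad u test_v_smooth[OF F]) simp
  then show ?thesis by (simp add: is_weak_grad_def vL2_smooth smooth_per_grad u)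
qed

lemma weak_curl_smooth: "E \<in> smooth_per_v L \<Longrightarrow> is_weak_curl L a E (curl E)"
proof -
  assume E: "E \<in> smooth_per_v L"
  have "pairing L a E (curl F) = pairing L a (curl E) F" if F: "F \<in> test_v L a" for F
    using test_v_plates[OF F] by (intro Green_curl[symmetric] E test_v_smooth[OF F]) simp
  then show ?thesis by (simp add: is_weak_curl_def vL2_smooth smooth_per_curl E)
qed

lemma weak_grad_diff:
  assumes "u \<in> L2 L a" "v \<in> L2 L a" "is_weak_grad L a u G" "is_weak_grad L a v H"
  shows "is_weak_grad L a (\<lambda>p. u p - v p) (\<lambda>p. G p - H p)"
  unfolding is_weak_grad_def
proof (intro conjI ballI)
  show "(\<lambda>p. G p - H p) \<in> vL2" by (intro vL2_diff weak_grad_vL2[OF assms(3)] weak_grad_vL2[OF assms(4)])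
  fix F assume F: "F \<in> test_v L a"
  have d: "divergence F \<in> L2 L a" by (intro L2_smooth_per smooth_per_divergence test_v_smooth[OF F])
  have "(\<integral>p. (u p - v p) * divergence F p \<partial>M) = (\<integral>p. u p * divergence F p \<partial>M) - (\<integral>p. v p * divergence F p \<partial>M)"
    unfolding left_diff_distrib by (intro Bochner_Integration.integral_diff integrable_mult_L2 assms d)
  also have "\<dots> = - pairing L a (\<lambda>p. G p - H p) F"
    using assms(3,4) F by (simp add: pairing_diff weak_grad_vL2[OF assms(3)] weak_grad_vL2[OF assms(4)] test_v_vL2 is_weak_grad_def)
  finally show "(\<integral>p. (u p - v p) * divergence F p \<partial>M) = - pairing L a (\<lambda>p. G p - H p) F" .
qed

lemma weak_curl_diff:
  assumes "E \<in> vL2" "E' \<in> vL2" "is_weak_curl L a E G" "is_weak_curl L a E' H"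
  shows "is_weak_curl L a (\<lambda>p. E p - E' p) (\<lambda>p. G p - H p)"
  unfolding is_weak_curl_def
proof (intro conjI ballI)
  show "(\<lambda>p. G p - H p) \<in> vL2" by (intro vL2_diff weak_curl_vL2[OF assms(3)] weak_curl_vL2[OF assms(4)])
  fix F assume F: "F \<in> test_v L a"
  have c: "curl F \<in> vL2" by (intro vL2_smooth smooth_per_curl test_v_smooth[OF F])
  show "pairing L a (\<lambda>p. E p - E' p) (curl F) = pairing L a (\<lambda>p. G p - H p) F"
    using assms F by (simp add: pairing_diff c weak_curl_vL2[OF assms(3)] weak_curl_vL2[OF assms(4)] test_v_vL2 is_weak_curl_def)
qed

lemma is_weak_grad_weak_grad: "\<exists>G. is_weak_grad L a u G \<Longrightarrow> is_weak_grad L a u (weak_grad L a u)"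
  unfolding weak_grad_def by (rule someI_ex[of "is_weak_grad L a u"])

lemma is_weak_curl_weak_curl: "\<exists>C. is_weak_curl L a E C \<Longrightarrow> is_weak_curl L a E (weak_curl L a E)"
  unfolding weak_curl_def by (rule someI_ex[of "is_weak_curl L a E"])

lemma vnm_cong_AE:
  assumes "E \<in> vL2" "F \<in> vL2" "AE p in M. E p = F p" shows "vnm E = vnm F"
proof -
  note [measurable] = assms(1,2)[THEN L2_measurable]
  have "(\<integral>p. (norm (E p))\<^sup>2 \<partial>M) = (\<integral>p. (norm (F p))\<^sup>2 \<partial>M)"
  proof (rule integral_cong_AE)
    show "AE p in M. (norm (E p))\<^sup>2 = (norm (F p))\<^sup>2"
      using assms(3) by eventually_elim simp
  qed measurable
  then show ?thesis by (simp add: L2_norm_def)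
qed

lemma weak_grad_closed:
  assumes "l2conv g u" "vconv X G" "\<And>n. is_weak_grad L a (g n) (X n)"
  shows "is_weak_grad L a u G"
  unfolding is_weak_grad_def
proof (intro conjI ballI)
  show "G \<in> vL2" using vconv_vL2[OF assms(2)] by blast
  fix F assume F: "F \<in> test_v L a"
  have "(\<lambda>n. \<integral>p. g n p * divergence F p \<partial>M) \<longlonglongrightarrow> (\<integral>p. u p * divergence F p \<partial>M)"
    by (intro l2conv_integral assms L2_smooth_per smooth_per_divergence test_v_smooth[OF F])
  also have "(\<lambda>n. \<integral>p. g n p * divergence F p \<partial>M) = (\<lambda>n. - pairing L a (X n) F)"
    using assms(3) F by (simp add: is_weak_grad_def)
  finally have "(\<lambda>n. - pairing L a (X n) F) \<longlonglongrightarrow> (\<integral>p. u p * divergence F p \<partial>M)" .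
  moreover have "(\<lambda>n. - pairing L a (X n) F) \<longlonglongrightarrow> - pairing L a G F"
    by (intro tendsto_minus vconv_pairing assms test_v_vL2 F)
  ultimately show "(\<integral>p. u p * divergence F p \<partial>M) = - pairing L a G F"
    by (rule LIMSEQ_unique)
qed

lemma weak_curl_closed:
  assumes "vconv Y E" "vconv X C" "\<And>n. is_weak_curl L a (Y n) (X n)"
  shows "is_weak_curl L a E C"
  unfolding is_weak_curl_def
proof (intro conjI ballI)
  show "C \<in> vL2" using vconv_vL2[OF assms(2)] by blast
  fix F assume F: "F \<in> test_v L a"
  have "(\<lambda>n. pairing L a (Y n) (curl F)) \<longlonglongrightarrow> pairing L a E (curl F)"
    by (intro vconv_pairing assms vL2_smooth smooth_per_curl test_v_smooth[OF F])
  also have "(\<lambda>n. pairing L a (Y n) (curl F)) = (\<lambda>n. pairing L a (X n) F)"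
    using assms(3) F by (simp add: is_weak_curl_def)
  finally have "(\<lambda>n. pairing L a (X n) F) \<longlonglongrightarrow> pairing L a E (curl F)" .
  moreover have "(\<lambda>n. pairing L a (X n) F) \<longlonglongrightarrow> pairing L a C F"
    by (intro vconv_pairing assms test_v_vL2 F)
  ultimately show "pairing L a E (curl F) = pairing L a C F"
    by (rule LIMSEQ_unique)
qed

section \<open>Graph-norm closures as limits of sequences\<close>

lemma sqrt_sum_tendsto_0:
  fixes x y :: "nat \<Rightarrow> real"
  assumes "(\<lambda>n. sqrt ((x n)\<^sup>2 + (y n)\<^sup>2)) \<longlonglongrightarrow> 0"
  shows "x \<longlonglongrightarrow> 0" "y \<longlonglongrightarrow> 0"
proof -
  show "x \<longlonglongrightarrow> 0"
    by (rule Lim_null_comparison[OF _ assms], rule always_eventually, rule allI, unfold real_norm_def,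
        rule real_sqrt_sum_squares_ge1[of "\<bar>x _\<bar>", unfolded power2_abs])
  show "y \<longlonglongrightarrow> 0"
    by (rule Lim_null_comparison[OF _ assms], rule always_eventually, rule allI, unfold real_norm_def,
        rule real_sqrt_sum_squares_ge2[of "\<bar>y _\<bar>", unfolded power2_abs])
qed

lemma sqrt_sum_tendsto_0_iff:
  fixes x y :: "nat \<Rightarrow> real"
  assumes "x \<longlonglongrightarrow> 0" "y \<longlonglongrightarrow> 0"
  shows "(\<lambda>n. sqrt ((x n)\<^sup>2 + (y n)\<^sup>2)) \<longlonglongrightarrow> 0"
  using tendsto_real_sqrt[OF tendsto_add[OF tendsto_power[OF assms(1), of 2] tendsto_power[OF assms(2), of 2]]] by simp

text \<open>Replaces the closure in the graph norm by joint convergence of functions and classical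
  gradients. The norm contains a chosen weak gradient of a difference, so the link is uniqueness
  almost everywhere. In the second part, membership in \<open>H1\<close> comes from closedness of
  the weak gradient.\<close>

lemma graph_closure_grad:
  assumes A: "A \<subseteq> smooth_per L"
  shows "u \<in> norm_closure (H1_norm L a) (H1 L a) A \<Longrightarrow>
      \<exists>g. (\<forall>n. g n \<in> A) \<and> l2conv g u \<and> vconv (\<lambda>n. grad (g n)) (weak_grad L a u)"
    and "(\<And>n. g n \<in> A) \<Longrightarrow> l2conv g u \<Longrightarrow> vconv (\<lambda>n. grad (g n)) G \<Longrightarrow>
      u \<in> norm_closure (H1_norm L a) (H1 L a) A \<and> is_weak_grad L a u G"
proof -
  have key: "vnm (weak_grad L a (\<lambda>p. u p - g p)) = vnm (\<lambda>p. G p - grad g p)"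
    if "u \<in> L2 L a" "is_weak_grad L a u G" "g \<in> A" for u G g
  proof -
    have g: "g \<in> smooth_per L" using that(3) A by blast
    have w: "is_weak_grad L a (\<lambda>p. u p - g p) (\<lambda>p. G p - grad g p)"
      by (intro weak_grad_diff that L2_smooth_per g weak_grad_smooth)
    note w' = is_weak_grad_weak_grad[OF exI[of "is_weak_grad L a (\<lambda>p. u p - g p)", OF w]]
    show ?thesis
      by (rule vnm_cong_AE[OF weak_grad_vL2[OF w'] weak_grad_vL2[OF w] weak_grad_unique[OF w' w]])
  qed
  show "\<exists>g. (\<forall>n. g n \<in> A) \<and> l2conv g u \<and> vconv (\<lambda>n. grad (g n)) (weak_grad L a u)"
    if "u \<in> norm_closure (H1_norm L a) (H1 L a) A"
  proof -
    have nn: "0 \<le> H1_norm L a h" for h by (simp add: H1_norm_def)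
    from norm_closureD(1)[OF that nn] have u: "u \<in> H1 L a" .
    from norm_closureD(2)[OF that nn] obtain g where g: "\<And>n. g n \<in> A"
      and lim: "(\<lambda>n::nat. H1_norm L a (\<lambda>p. u p - g n p)) \<longlonglongrightarrow> 0" by blast
    have gs: "g n \<in> smooth_per L" for n using g A by blast
    have uL: "u \<in> L2 L a" and w: "is_weak_grad L a u (weak_grad L a u)"
      using u is_weak_grad_weak_grad[of u] by (simp_all add: H1_def)
    from lim have "(\<lambda>n. sqrt ((nm (\<lambda>p. u p - g n p))\<^sup>2 + (vnm (\<lambda>p. weak_grad L a u p - grad (g n) p))\<^sup>2)) \<longlonglongrightarrow> 0"
      unfolding H1_norm_def key[OF uL w g] .
    note l = sqrt_sum_tendsto_0[OF this]
    have "l2conv g u"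
      unfolding l2conv_def using l(1) uL L2_smooth_per[OF gs] nm_minus_commute[of u] by simp
    moreover have "vconv (\<lambda>n. grad (g n)) (weak_grad L a u)"
      by (rule vconv_if_vnm[OF _ weak_grad_vL2[OF w] l(2)]) (intro vL2_smooth smooth_per_grad gs)
    ultimately show ?thesis using g by blast
  qed
  show "u \<in> norm_closure (H1_norm L a) (H1 L a) A \<and> is_weak_grad L a u G"
    if g: "\<And>n. g n \<in> A" and lu: "l2conv g u" and lG: "vconv (\<lambda>n. grad (g n)) G"
  proof -
    have gs: "g n \<in> smooth_per L" for n using g A by blast
    have w: "is_weak_grad L a u G"
      by (rule weak_grad_closed[OF lu lG]) (rule weak_grad_smooth[OF gs])
    have uL: "u \<in> L2 L a" using lu by (simp add: l2conv_def)
    have "(\<lambda>n. H1_norm L a (\<lambda>p. u p - g n p)) \<longlonglongrightarrow> 0"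
      unfolding H1_norm_def key[OF uL w g]
    proof (rule sqrt_sum_tendsto_0_iff)
      show "(\<lambda>n. nm (\<lambda>p. u p - g n p)) \<longlonglongrightarrow> 0" using lu nm_minus_commute[of u] by (simp add: l2conv_def)
    qed (rule vnm_if_vconv[OF lG])
    moreover have "u \<in> H1 L a" using uL w unfolding H1_def by blast
    ultimately show ?thesis using norm_closureI[OF _ g] w by simp
  qed
qed

lemma graph_closure_curl:
  assumes A: "A \<subseteq> smooth_per_v L"
  shows "E \<in> norm_closure (H_curl_norm L a) (H_curl L a) A \<Longrightarrow>
      \<exists>g. (\<forall>n. g n \<in> A) \<and> vconv g E \<and> vconv (\<lambda>n. curl (g n)) (weak_curl L a E)"
    and "(\<And>n. g n \<in> A) \<Longrightarrow> vconv g E \<Longrightarrow> vconv (\<lambda>n. curl (g n)) C \<Longrightarrow>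
      E \<in> norm_closure (H_curl_norm L a) (H_curl L a) A \<and> is_weak_curl L a E C"
proof -
  have key: "vnm (weak_curl L a (\<lambda>p. E p - g p)) = vnm (\<lambda>p. C p - curl g p)"
    if "E \<in> vL2" "is_weak_curl L a E C" "g \<in> A" for E C g
  proof -
    have g: "g \<in> smooth_per_v L" using that(3) A by blast
    have w: "is_weak_curl L a (\<lambda>p. E p - g p) (\<lambda>p. C p - curl g p)"
      by (intro weak_curl_diff that vL2_smooth g weak_curl_smooth)
    note w' = is_weak_curl_weak_curl[OF exI[of "is_weak_curl L a (\<lambda>p. E p - g p)", OF w]]
    show ?thesis
      by (rule vnm_cong_AE[OF weak_curl_vL2[OF w'] weak_curl_vL2[OF w] weak_curl_unique[OF w' w]])
  qed
  show "\<exists>g. (\<forall>n. g n \<in> A) \<and> vconv g E \<and> vconv (\<lambda>n. curl (g n)) (weak_curl L a E)"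
    if "E \<in> norm_closure (H_curl_norm L a) (H_curl L a) A"
  proof -
    have nn: "0 \<le> H_curl_norm L a h" for h by (simp add: H_curl_norm_def)
    from norm_closureD(1)[OF that nn] have E: "E \<in> H_curl L a" .
    from norm_closureD(2)[OF that nn] obtain g where g: "\<And>n. g n \<in> A"
      and lim: "(\<lambda>n::nat. H_curl_norm L a (\<lambda>p. E p - g n p)) \<longlonglongrightarrow> 0" by blast
    have gs: "g n \<in> smooth_per_v L" for n using g A by blast
    have EL: "E \<in> vL2" and w: "is_weak_curl L a E (weak_curl L a E)"
      using E is_weak_curl_weak_curl[of E] by (simp_all add: H_curl_def)
    from lim have "(\<lambda>n. sqrt ((vnm (\<lambda>p. E p - g n p))\<^sup>2 + (vnm (\<lambda>p. weak_curl L a E p - curl (g n) p))\<^sup>2)) \<longlonglongrightarrow> 0"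
      unfolding H_curl_norm_def key[OF EL w g] .
    note l = sqrt_sum_tendsto_0[OF this]
    have "vconv g E"
      by (rule vconv_if_vnm[OF vL2_smooth[OF gs] EL l(1)])
    moreover have "vconv (\<lambda>n. curl (g n)) (weak_curl L a E)"
      by (rule vconv_if_vnm[OF _ weak_curl_vL2[OF w] l(2)]) (intro vL2_smooth smooth_per_curl gs)
    ultimately show ?thesis using g by blast
  qed
  show "E \<in> norm_closure (H_curl_norm L a) (H_curl L a) A \<and> is_weak_curl L a E C"
    if g: "\<And>n. g n \<in> A" and lE: "vconv g E" and lC: "vconv (\<lambda>n. curl (g n)) C"
  proof -
    have gs: "g n \<in> smooth_per_v L" for n using g A by blast
    have w: "is_weak_curl L a E C"
      by (rule weak_curl_closed[OF lE lC]) (rule weak_curl_smooth[OF gs])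
    have EL: "E \<in> vL2" using vconv_vL2[OF lE] by blast
    have "(\<lambda>n. H_curl_norm L a (\<lambda>p. E p - g n p)) \<longlonglongrightarrow> 0"
      unfolding H_curl_norm_def key[OF EL w g]
      by (rule sqrt_sum_tendsto_0_iff[OF vnm_if_vconv[OF lE] vnm_if_vconv[OF lC]])
    moreover have "E \<in> H_curl L a" using EL w unfolding H_curl_def by blast
    ultimately show ?thesis using norm_closureI[OF _ g] w by simp
  qed
qed

end

section \<open>Conjugation and finite sums of smooth fields\<close>

lemma has_derivative_cnj: "(f has_derivative f') F \<Longrightarrow> ((\<lambda>p. cnj (f p)) has_derivative (\<lambda>h. cnj (f' h))) F"
  by (rule bounded_linear.has_derivative[OF bounded_linear_cnj])

lemma pd_cnj: "smooth f \<Longrightarrow> pd d (\<lambda>p. cnj (f p)) = (\<lambda>p. cnj (pd d f p))"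
proof -
  assume f: "smooth f"
  have "(f has_derivative frechet_derivative f (at p)) (at p)" for p
    using smooth_differentiable[OF f] by (simp add: frechet_derivative_works[symmetric])
  from pd_eqI[OF has_derivative_cnj[OF this]] show ?thesis by (simp add: pd_def)
qed

lemma smooth_cnj: "smooth f \<Longrightarrow> smooth (\<lambda>p. cnj (f p))"
proof -
  have "Ck n (\<lambda>p. cnj (f p))" if "smooth f" for n f
    using that
  proof (induction n arbitrary: f)
    case 0
    then show ?case using smooth_continuous[OF 0] by (auto intro: continuous_intros)
  next
    case (Suc n)
    have "(\<lambda>p. cnj (f p)) differentiable (at p)" for p
      using smooth_differentiable[OF Suc.prems, of p] has_derivative_cnj unfolding differentiable_def by blast
    then show ?case
      using Suc.IH[OF smooth_pd[OF Suc.prems]] by (simp add: pd_cnj[OF Suc.prems] differentiable_on_def)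
  qed
  then show "smooth f \<Longrightarrow> smooth (\<lambda>p. cnj (f p))" by (simp add: smooth_def)
qed

lemma smooth_per_cnj: "f \<in> smooth_per L \<Longrightarrow> (\<lambda>p. cnj (f p)) \<in> smooth_per L"
  using smooth_cnj[of f] by (simp add: smooth_per_def smooth_def lat_periodic_def)

text \<open>\<open>pairing\<close> is bilinear and \<open>v_inner\<close> sesquilinear; conjugating
  the second field passes from one to the other.\<close>

definition cnjv :: "vfield \<Rightarrow> vfield" where
  "cnjv E = (\<lambda>p. \<chi> i. cnj (E p $ i))"

lemma cnjv_nth [simp]: "cnjv E p $ i = cnj (E p $ i)"
  by (simp add: cnjv_def)

lemma smooth_per_cnjv: "E \<in> smooth_per_v L \<Longrightarrow> cnjv E \<in> smooth_per_v L"
  by (simp add: smooth_per_v_def smooth_per_cnj)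

lemma curl_cnjv: "E \<in> smooth_per_v L \<Longrightarrow> curl (cnjv E) = cnjv (curl E)"
  by (simp add: fun_eq_iff vec_eq_iff forall_3 pd_cnj smooth_per_v_smooth)

lemma grad_cnj: "f \<in> smooth_per L \<Longrightarrow> grad (\<lambda>p. cnj (f p)) = cnjv (grad f)"
  by (simp add: fun_eq_iff vec_eq_iff forall_3 pd_cnj smooth_per_smooth)

lemma smooth_per_v_sum: "(\<And>j. j \<in> B \<Longrightarrow> X j \<in> smooth_per_v L) \<Longrightarrow> (\<lambda>p. \<Sum>j\<in>B. X j p) \<in> smooth_per_v L"
  by (simp add: smooth_per_v_def smooth_per_sum sum_component)

lemma pd_nth_sum:
  assumes "\<And>j. X j \<in> smooth_per_v L"
  shows "pd d (\<lambda>q. \<Sum>j\<in>B. X j q $ k) = (\<lambda>q. \<Sum>j\<in>B. pd d (\<lambda>q. X j q $ k) q)"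
  by (rule pd_sum) (rule smooth_per_v_smooth[OF assms])

lemma curl_sum: "(\<And>j. X j \<in> smooth_per_v L) \<Longrightarrow> curl (\<lambda>p. \<Sum>j\<in>B. X j p) = (\<lambda>p. \<Sum>j\<in>B. curl (X j) p)"
  by (simp add: fun_eq_iff vec_eq_iff forall_3 sum_component pd_nth_sum[of X L] sum_subtractf)

lemma divergence_sum: "(\<And>j. X j \<in> smooth_per_v L) \<Longrightarrow> divergence (\<lambda>p. \<Sum>j\<in>B. X j p) = (\<lambda>p. \<Sum>j\<in>B. divergence (X j) p)"
  by (simp add: divergence_def fun_eq_iff sum_component pd_nth_sum[of X L] sum.distrib)

lemma grad_lincomb:
  assumes "\<And>j. f j \<in> smooth_per L"
  shows "grad (\<lambda>p. \<Sum>j\<in>B. c j * f j p) = (\<lambda>p. \<Sum>j\<in>B. c j *s grad (f j) p)"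
proof -
  have "pd d (\<lambda>p. \<Sum>j\<in>B. c j * f j p) = (\<lambda>p. \<Sum>j\<in>B. c j * pd d (f j) p)" for d
    using pd_sum[of B "\<lambda>j p. c j * f j p" d] smooth_per_smooth[OF assms] by (simp add: pd_cmult smooth_cmult)
  then show ?thesis by (simp add: fun_eq_iff vec_eq_iff forall_3 sum_component)
qed

context slab_domain
begin

lemma vip_pairing: "vip E F = pairing L a E (cnjv F)"
  by (simp add: v_inner_def pairing_def)

lemma vL2_cmult: "E \<in> vL2 \<Longrightarrow> (\<lambda>p. c *s E p) \<in> vL2"
  by (simp add: vL2_iff L2_cmult)

lemma vip_cmult_left: "vip (\<lambda>p. c *s E p) F = c * vip E F"
  by (simp add: v_inner_def mult.assoc sum_distrib_left[symmetric])

lemma vip_sum_left: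
  assumes "\<And>j. X j \<in> vL2" "F \<in> vL2" "finite B"
  shows "vip (\<lambda>p. \<Sum>j\<in>B. X j p) F = (\<Sum>j\<in>B. vip (X j) F)"
proof -
  have "(\<lambda>p. \<Sum>j\<in>B. X j p) \<in> vL2"
    unfolding vL2_iff sum_component by (intro allI L2_sum vL2_nth assms(1))
  then have "vip (\<lambda>p. \<Sum>j\<in>B. X j p) F = (\<Sum>i\<in>UNIV. \<Sum>j\<in>B. ip (\<lambda>p. X j p $ i) (\<lambda>p. F p $ i))"
    using assms by (simp add: v_inner_sum sum_component ip_sum_left vL2_nth)
  also have "\<dots> = (\<Sum>j\<in>B. vip (X j) F)"
    using assms by (subst sum.swap) (simp add: v_inner_sum)
  finally show ?thesis .
qed

subsection \<open>The scalar operators in the mode bases\<close>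

lemma pd_modes2:
  "divergence (grad (CC j)) = (\<lambda>p. - of_real (lam j) * CC j p)"
  "divergence (grad (SS j)) = (\<lambda>p. - of_real (lam j) * SS j p)"
proof -
  show "divergence (grad (CC j)) = (\<lambda>p. - of_real (lam j) * CC j p)"
    unfolding divergence_def grad_nth CC_pd SS_pd pd_cmult[OF smooth_CC] pd_cmult[OF smooth_SS]
    by (simp add: fun_eq_iff lam_def algebra_simps power2_eq_square)
  show "divergence (grad (SS j)) = (\<lambda>p. - of_real (lam j) * SS j p)"
    unfolding divergence_def grad_nth CC_pd SS_pd pd_cmult[OF smooth_CC] pd_cmult[OF smooth_SS]
    by (simp add: fun_eq_iff lam_def algebra_simps power2_eq_square)
qed

lemma cnj_CC_fun: "(\<lambda>p. cnj (CC j p)) = CC (neg j)" and cnj_SS_fun: "(\<lambda>p. cnj (SS j p)) = SS (neg j)"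
  by (simp_all add: cnj_CC cnj_SS)

text \<open>The natural boundary condition in weak form: the weak gradient is tested with the
  cut-off gradient of a cosine mode. The normal component of that gradient is a sine, so the
  boundary layer disappears although v is an arbitrary element of \<open>H1\<close>.\<close>

lemma Neumann_mode:
  assumes v: "v \<in> L2 L a" and G: "is_weak_grad L a v G"
  shows "vip G (grad (CC j)) = of_real (lam j) * C.coeff v j"
proof -
  define i where "i = neg j"
  define F where "F m = (\<lambda>p. \<chi> k. cut m p * grad (CC i) p $ k)" for m
  note GL = weak_grad_vL2[OF G]
  note si = smooth_per_vD[OF smooth_per_grad[OF smooth_per_CC]]
  have F: "F m \<in> test_v L a" for m
    unfolding test_v_def F_def by (simp add: cut_test si)
  \<comment> \<open>The derivative of the cutoff meets only the normal component of the mode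
    gradient, a multiple of \<open>SS\<close>, which is the situation of
    \<open>cut'_limit\<close>.\<close>
  have divF: "divergence (F m) p = - of_real (lam i) * (cut m p * CC i p) - of_real (nu i) * (cut' m p * SS i p)" for m p
  proof -
    have "divergence (F m) p = cut m p * divergence (grad (CC i)) p + cut' m p * pdz (CC i) p"
      unfolding divergence_def F_def
      by (simp add: smooth_pd_mult smooth_cut smooth_per_smooth[OF si] cut_pd smooth_pds smooth_CC algebra_simps)
    then show ?thesis by (simp add: pd_modes2 CC_pd)
  qed
  have lim1: "(\<lambda>m. \<integral>p. v p * divergence (F m) p \<partial>M) \<longlonglongrightarrow> - of_real (lam i) * (\<integral>p. v p * CC i p \<partial>M) - of_real (nu i) * 0"
  proof -
    have "(\<integral>p. v p * divergence (F m) p \<partial>M) = - of_real (lam i) * (\<integral>p. v p * (cut m p * CC i p) \<partial>M)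
        - of_real (nu i) * (\<integral>p. v p * (cut' m p * SS i p) \<partial>M)" for m
    proof -
      have int: "integrable M (\<lambda>p. v p * (cut m p * CC i p))" "integrable M (\<lambda>p. v p * (cut' m p * SS i p))"
        by (intro integrable_mult_L2 v L2_continuous smooth_continuous smooth_mult smooth_cut smooth_CC smooth_cut' smooth_SS)+
      have "(\<integral>p. v p * divergence (F m) p \<partial>M) =
          (\<integral>p. - of_real (lam i) * (v p * (cut m p * CC i p)) - of_real (nu i) * (v p * (cut' m p * SS i p)) \<partial>M)"
        unfolding divF by (simp add: algebra_simps)
      then show ?thesis using int by simp
    qed
    then show ?thesis
      by (simp only:) (intro tendsto_diff tendsto_mult tendsto_const cut_limit cut'_limit v smooth_per_CC)
  qed
  have lim2: "(\<lambda>m. - pairing L a G (F m)) \<longlonglongrightarrow> - pairing L a G (grad (CC i))"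
  proof -
    have "(\<lambda>m. \<Sum>k\<in>UNIV. \<integral>p. G p $ k * (cut m p * grad (CC i) p $ k) \<partial>M) \<longlonglongrightarrow>
        (\<Sum>k\<in>UNIV. \<integral>p. G p $ k * grad (CC i) p $ k \<partial>M)"
      by (intro tendsto_sum cut_limit vL2_nth GL si)
    then show ?thesis
      using GL test_v_vL2[OF F] vL2_smooth[OF smooth_per_grad[OF smooth_per_CC]]
      by (intro tendsto_minus) (simp add: pairing_sum F_def)
  qed
  have "(\<lambda>m. \<integral>p. v p * divergence (F m) p \<partial>M) = (\<lambda>m. - pairing L a G (F m))"
    using G F by (simp add: is_weak_grad_def)
  with lim1 have "(\<lambda>m. - pairing L a G (F m)) \<longlonglongrightarrow> - of_real (lam i) * (\<integral>p. v p * CC i p \<partial>M) - of_real (nu i) * 0" by simp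
  from LIMSEQ_unique[OF this lim2] have "pairing L a G (grad (CC i)) = of_real (lam i) * (\<integral>p. v p * CC i p \<partial>M)"
    by simp
  moreover have "vip G (grad (CC j)) = pairing L a G (grad (CC i))"
    unfolding vip_pairing grad_cnj[OF smooth_per_CC, symmetric] cnj_CC_fun i_def ..
  moreover have "(\<integral>p. v p * CC i p \<partial>M) = C.coeff v j"
    by (simp add: C.coeff_def s_inner_def cnj_CC i_def)
  ultimately show ?thesis by (simp add: i_def)
qed

abbreviation Dirichlet_smooth :: "sfield set" where
  "Dirichlet_smooth \<equiv> {u \<in> smooth_per L. \<forall>x y. \<forall>z\<in>{0, a}. u (x, y, z) = 0}"

lemma Dirichlet_smooth_sub: "Dirichlet_smooth \<subseteq> smooth_per L"
  by blast

lemma H1_D_weak: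
  assumes "v \<in> H1_D L a"
  shows "v \<in> L2 L a" "is_weak_grad L a v (weak_grad L a v)"
proof -
  have "v \<in> H1 L a" using assms by (simp add: H1_D_def norm_closure_def)
  then show "v \<in> L2 L a" "is_weak_grad L a v (weak_grad L a v)"
    using is_weak_grad_weak_grad[of v] by (simp_all add: H1_def)
qed

text \<open>The normal component of the gradient of a sine mode is a cosine, which does not vanish
  at the plates, so the boundary term has to be removed by v: Green's identity is used for smooth
  functions vanishing at the plates, and both sides pass to the limit.\<close>

lemma Dirichlet_mode:
  assumes v: "v \<in> H1_D L a"
  shows "vip (weak_grad L a v) (grad (SS j)) = of_real (lam j) * S.coeff v j"
proof -
  define i where "i = neg j"
  obtain g where g: "\<And>n. g n \<in> Dirichlet_smooth" and lv: "l2conv g v"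
    and lG: "vconv (\<lambda>n. grad (g n)) (weak_grad L a v)"
    using graph_closure_grad(1)[OF Dirichlet_smooth_sub v[unfolded H1_D_def]] by blast
  have "pairing L a (grad (g n)) (grad (SS i)) = of_real (lam i) * (\<integral>p. g n p * SS i p \<partial>M)" for n
  proof -
    have gn: "g n \<in> smooth_per L" "\<And>x y z. z = 0 \<or> z = a \<Longrightarrow> g n (x, y, z) = 0" using g[of n] by auto
    have "(\<integral>p. g n p * divergence (grad (SS i)) p \<partial>M) = - pairing L a (grad (g n)) (grad (SS i))"
      by (rule Green_grad[OF gn(1) smooth_per_grad[OF smooth_per_SS]]) (simp add: gn(2))
    moreover have "(\<integral>p. g n p * divergence (grad (SS i)) p \<partial>M) = (\<integral>p. - of_real (lam i) * (g n p * SS i p) \<partial>M)"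
      unfolding pd_modes2 by (simp add: mult.left_commute)
    ultimately show ?thesis by simp
  qed
  moreover have "(\<lambda>n. pairing L a (grad (g n)) (grad (SS i))) \<longlonglongrightarrow> pairing L a (weak_grad L a v) (grad (SS i))"
    by (intro vconv_pairing lG vL2_smooth smooth_per_grad smooth_per_SS)
  moreover have "(\<lambda>n. of_real (lam i) * (\<integral>p. g n p * SS i p \<partial>M)) \<longlonglongrightarrow> of_real (lam i) * (\<integral>p. v p * SS i p \<partial>M)"
    by (intro tendsto_mult tendsto_const l2conv_integral lv L2_SS)
  ultimately have "pairing L a (weak_grad L a v) (grad (SS i)) = of_real (lam i) * (\<integral>p. v p * SS i p \<partial>M)"
    using LIMSEQ_unique by simp
  moreover have "vip (weak_grad L a v) (grad (SS j)) = pairing L a (weak_grad L a v) (grad (SS i))"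
    unfolding vip_pairing grad_cnj[OF smooth_per_SS, symmetric] cnj_SS_fun i_def ..
  moreover have "(\<integral>p. v p * SS i p \<partial>M) = S.coeff v j"
    by (simp add: S.coeff_def s_inner_def cnj_SS i_def)
  ultimately show ?thesis by (simp add: i_def)
qed

lemma lam_nonneg: "0 \<le> lam j"
  by (simp add: lam_def)

text \<open>From lam <= 1 + lam^2: control of c and of \<open>lam\<close> times c gives control of
  first derivatives, whose symbols are kx, ky and nu.\<close>

lemma sq_bounded_le_lam:
  assumes c: "sq_bounded c" and d: "sq_bounded (\<lambda>j. of_real (lam j) * c j)"
    and s: "\<And>j. (norm (s j))\<^sup>2 \<le> lam j"
  shows "sq_bounded (\<lambda>j. s j * c j)"
proof (rule sq_bounded_comparison[OF c d, where K=1])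
  fix j
  have "lam j \<le> 1 + (lam j)\<^sup>2"
    using sum_squares_bound[of 1 "lam j"] lam_nonneg[of j] by simp
  with s[of j] have "(norm (s j))\<^sup>2 * (norm (c j))\<^sup>2 \<le> (1 + (lam j)\<^sup>2) * (norm (c j))\<^sup>2"
    by (intro mult_right_mono) auto
  then show "(norm (s j * c j))\<^sup>2 \<le> 1 * (norm (c j))\<^sup>2 + 1 * (norm (of_real (lam j) * c j))\<^sup>2"
    by (simp add: norm_mult power_mult_distrib algebra_simps)
qed auto

lemma le_lam: "(norm (\<i> * complex_of_real (kx j)))\<^sup>2 \<le> lam j" "(norm (\<i> * complex_of_real (ky j)))\<^sup>2 \<le> lam j"
  "(norm (complex_of_real (nu j)))\<^sup>2 \<le> lam j" "(norm (- complex_of_real (nu j)))\<^sup>2 \<le> lam j"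
  by (simp_all add: norm_mult lam_def)

lemma nu_zero: "snd (snd j) = 0 \<Longrightarrow> nu j = 0"
  by (simp add: nu_def)

lemma l2conv_C: "sq_bounded c \<Longrightarrow> l2conv (\<lambda>N. C.psum c (box_index N)) (C.syn c)"
  by (rule C.syn(1)[OF C_adapted])

lemma l2conv_S: "sq_bounded c \<Longrightarrow> (\<And>j. snd (snd j) = 0 \<Longrightarrow> c j = 0) \<Longrightarrow> l2conv (\<lambda>N. S.psum c (box_index N)) (S.syn c)"
  by (rule S.syn(1)) (simp_all add: S_adapted_iff)

lemma vconv_vector:
  assumes "l2conv (\<lambda>n p. X n p $ 1) f" "l2conv (\<lambda>n p. X n p $ 2) g" "l2conv (\<lambda>n p. X n p $ 3) h"
  shows "vconv X (\<lambda>p. vector [f p, g p, h p])"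
  using assms by (simp add: vconv_def forall_3)

text \<open>The z-derivative of a cosine series is a sine series, whose coefficients must vanish for
  plate number 0; they do, because nu = 0 there.\<close>

lemma grad_psum_C_conv:
  assumes "sq_bounded c" "sq_bounded (\<lambda>j. of_real (lam j) * c j)"
  shows "\<exists>G. vconv (\<lambda>N. grad (C.psum c (box_index N))) G"
proof -
  have g: "(\<lambda>p. grad (C.psum c B) p $ 1) = C.psum (\<lambda>j. \<i> * of_real (kx j) * c j) B"
    "(\<lambda>p. grad (C.psum c B) p $ 2) = C.psum (\<lambda>j. \<i> * of_real (ky j) * c j) B"
    "(\<lambda>p. grad (C.psum c B) p $ 3) = S.psum (\<lambda>j. - of_real (nu j) * c j) B" for B
    unfolding C.psum_def S.psum_def grad_lincomb[OF smooth_per_CC]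
    by (simp_all add: sum_component CC_pd mult_ac)
  note b = sq_bounded_le_lam[OF assms]
  show ?thesis
  proof (rule exI, rule vconv_vector, unfold g)
    show "l2conv (\<lambda>N. C.psum (\<lambda>j. \<i> * of_real (kx j) * c j) (box_index N)) (C.syn (\<lambda>j. \<i> * of_real (kx j) * c j))"
      by (rule l2conv_C[OF b[OF le_lam(1)]])
    show "l2conv (\<lambda>N. C.psum (\<lambda>j. \<i> * of_real (ky j) * c j) (box_index N)) (C.syn (\<lambda>j. \<i> * of_real (ky j) * c j))"
      by (rule l2conv_C[OF b[OF le_lam(2)]])
    show "l2conv (\<lambda>N. S.psum (\<lambda>j. - of_real (nu j) * c j) (box_index N)) (S.syn (\<lambda>j. - of_real (nu j) * c j))"
      by (rule l2conv_S[OF b[OF le_lam(4)]]) (simp add: nu_zero)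
  qed
qed

lemma grad_psum_S_conv:
  assumes "sq_bounded c" "sq_bounded (\<lambda>j. of_real (lam j) * c j)" "S.adapted c"
  shows "\<exists>G. vconv (\<lambda>N. grad (S.psum c (box_index N))) G"
proof -
  have g: "(\<lambda>p. grad (S.psum c B) p $ 1) = S.psum (\<lambda>j. \<i> * of_real (kx j) * c j) B"
    "(\<lambda>p. grad (S.psum c B) p $ 2) = S.psum (\<lambda>j. \<i> * of_real (ky j) * c j) B"
    "(\<lambda>p. grad (S.psum c B) p $ 3) = C.psum (\<lambda>j. of_real (nu j) * c j) B" for B
    unfolding C.psum_def S.psum_def grad_lincomb[OF smooth_per_SS]
    by (simp_all add: sum_component SS_pd mult_ac)
  have z: "snd (snd j) = 0 \<Longrightarrow> c j = 0" for j using assms(3) by (simp add: S_adapted_iff)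
  note b = sq_bounded_le_lam[OF assms(1,2)]
  show ?thesis
  proof (rule exI, rule vconv_vector, unfold g)
    show "l2conv (\<lambda>N. S.psum (\<lambda>j. \<i> * of_real (kx j) * c j) (box_index N)) (S.syn (\<lambda>j. \<i> * of_real (kx j) * c j))"
      by (rule l2conv_S[OF b[OF le_lam(1)]]) (simp add: z)
    show "l2conv (\<lambda>N. S.psum (\<lambda>j. \<i> * of_real (ky j) * c j) (box_index N)) (S.syn (\<lambda>j. \<i> * of_real (ky j) * c j))"
      by (rule l2conv_S[OF b[OF le_lam(2)]]) (simp add: z)
    show "l2conv (\<lambda>N. C.psum (\<lambda>j. of_real (nu j) * c j) (box_index N)) (C.syn (\<lambda>j. of_real (nu j) * c j))"
      by (rule l2conv_C[OF b[OF le_lam(3)]])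
  qed
qed

end

text \<open>The argument common to Dirichlet and Neumann. Testing with modes forces the coefficients
  of f; conversely the form is computed on partial sums, and Parseval identifies the limit with the
  inner product. Assumption \<open>lim\<close> isolates what depends on the boundary condition: u
  lies in the form domain, and the gradients of its partial sums converge to its weak
  gradient.\<close>

lemma (in mode_basis) form_operator_modes:
  assumes V: "\<And>v. v \<in> V \<Longrightarrow> v \<in> L2 L a" "\<And>v. v \<in> V \<Longrightarrow> is_weak_grad L a v (weak_grad L a v)"
    and modes: "\<And>j. \<phi> j \<in> V" "\<And>j. \<phi> j \<in> smooth_per L"
    and q: "\<And>v j. v \<in> V \<Longrightarrow> vip (weak_grad L a v) (grad (\<phi> j)) = of_real (lam j) * coeff v j"
    and lim: "\<And>u f. u \<in> L2 L a \<Longrightarrow> f \<in> L2 L a \<Longrightarrow> (\<And>j. coeff f j = of_real (lam j) * coeff u j) \<Longrightarrow>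
        u \<in> V \<and> (\<exists>G. is_weak_grad L a u G \<and> vconv (\<lambda>N. grad (psum (coeff u) (box_index N))) G)"
  shows "(u, f) \<in> form_operator ip (L2 L a) V (q_grad L a) \<longleftrightarrow>
    u \<in> L2 L a \<and> f \<in> L2 L a \<and> (\<forall>j. coeff f j = of_real (lam j) * coeff u j)"
proof
  assume "(u, f) \<in> form_operator ip (L2 L a) V (q_grad L a)"
  then have u: "u \<in> V" and f: "f \<in> L2 L a" and eq: "\<And>v. v \<in> V \<Longrightarrow> q_grad L a u v = ip f v"
    by (auto simp: form_operator_def)
  have "coeff f j = of_real (lam j) * coeff u j" for j
  proof -
    have "coeff f j = q_grad L a u (\<phi> j)" by (simp add: eq[OF modes(1)] coeff_def)
    also have "\<dots> = vip (weak_grad L a u) (grad (\<phi> j))"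
      unfolding q_grad_def
      by (rule vip_cong_AE_right[OF _ _ _ weak_grad_unique[OF V(2)[OF modes(1)] weak_grad_smooth[OF modes(2)]]])
        (intro weak_grad_vL2[OF V(2)] u modes vL2_smooth smooth_per_grad)+
    finally show ?thesis by (simp add: q[OF u])
  qed
  with V(1)[OF u] f show "u \<in> L2 L a \<and> f \<in> L2 L a \<and> (\<forall>j. coeff f j = of_real (lam j) * coeff u j)" by blast
next
  assume *: "u \<in> L2 L a \<and> f \<in> L2 L a \<and> (\<forall>j. coeff f j = of_real (lam j) * coeff u j)"
  then have u: "u \<in> L2 L a" and f: "f \<in> L2 L a" and c: "\<And>j. coeff f j = of_real (lam j) * coeff u j" by auto
  obtain G where uV: "u \<in> V" and G: "is_weak_grad L a u G" and lG: "vconv (\<lambda>N. grad (psum (coeff u) (box_index N))) G"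
    using lim[OF u f c] by blast
  have "q_grad L a u v = ip f v" if v: "v \<in> V" for v
  proof -
    define W where "W = weak_grad L a v"
    have W: "W \<in> vL2" unfolding W_def by (rule weak_grad_vL2[OF V(2)[OF v]])
    have gp: "grad (\<phi> j) \<in> vL2" for j by (intro vL2_smooth smooth_per_grad modes)
    have "q_grad L a u v = vip G W"
      unfolding q_grad_def W_def[symmetric]
      by (rule vip_cong_AE[OF _ _ W weak_grad_unique[OF V(2)[OF uV] G]])
        (intro weak_grad_vL2[OF V(2)] uV weak_grad_vL2[OF G])+
    moreover have "(\<lambda>N. vip (grad (psum (coeff u) (box_index N))) W) \<longlonglongrightarrow> vip G W"
      by (rule vconv_inner[OF lG W])
    \<comment> \<open>Conjugate symmetry puts the mode into the second slot, where assumption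
      \<open>q\<close> evaluates the form for the fixed v.\<close>
    moreover have "vip (grad (psum (coeff u) (box_index N))) W = (\<Sum>j\<in>box_index N. coeff f j * cnj (coeff v j))" for N
    proof -
      have "vip (grad (psum (coeff u) (box_index N))) W = (\<Sum>j\<in>box_index N. vip (\<lambda>p. coeff u j *s grad (\<phi> j) p) W)"
        unfolding psum_def grad_lincomb[OF modes(2)] by (intro vip_sum_left vL2_cmult gp W finite_box_index)
      also have "\<dots> = (\<Sum>j\<in>box_index N. coeff u j * cnj (vip W (grad (\<phi> j))))"
        by (simp add: vip_cmult_left vip_cnj)
      also have "\<dots> = (\<Sum>j\<in>box_index N. coeff f j * cnj (coeff v j))"
        by (simp add: W_def q[OF v] c mult_ac)
      finally show ?thesis .
    qed
    ultimately have "(\<lambda>N. \<Sum>j\<in>box_index N. coeff f j * cnj (coeff v j)) \<longlonglongrightarrow> q_grad L a u v" by simp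
    from LIMSEQ_unique[OF this Parseval[OF f V(1)[OF v]]] show ?thesis .
  qed
  with uV f show "(u, f) \<in> form_operator ip (L2 L a) V (q_grad L a)" by (simp add: form_operator_def)
qed

context slab_domain
begin

text \<open>Membership in \<open>H1\<close> follows from closedness of the weak gradient along the
  partial sums.\<close>

lemma L_N_modes: "(u, f) \<in> L_N L a \<longleftrightarrow> u \<in> L2 L a \<and> f \<in> L2 L a \<and> (\<forall>j. C.coeff f j = of_real (lam j) * C.coeff u j)"
  unfolding L_N_def
proof (rule C.form_operator_modes)
  show w: "v \<in> L2 L a" "is_weak_grad L a v (weak_grad L a v)" if "v \<in> H1 L a" for v
    using that is_weak_grad_weak_grad[of v] by (simp_all add: H1_def)
  show "CC j \<in> H1 L a" for j
    unfolding H1_def using L2_CC weak_grad_smooth[OF smooth_per_CC] by blast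
  show "vip (weak_grad L a v) (grad (CC j)) = of_real (lam j) * C.coeff v j" if "v \<in> H1 L a" for v j
    by (rule Neumann_mode[OF w[OF that]])
  fix u f assume u: "u \<in> L2 L a" and f: "f \<in> L2 L a" and c: "\<And>j. C.coeff f j = of_real (lam j) * C.coeff u j"
  have "sq_bounded (\<lambda>j. of_real (lam j) * C.coeff u j)"
    using C.sq_bounded_coeff[OF f] by (simp add: c[symmetric])
  then obtain G where G: "vconv (\<lambda>N. grad (C.psum (C.coeff u) (box_index N))) G"
    using grad_psum_C_conv[OF C.sq_bounded_coeff[OF u]] by blast
  have "is_weak_grad L a u G"
    by (rule weak_grad_closed[OF C.expansion[OF u] G])
      (intro weak_grad_smooth; unfold C.psum_def; intro smooth_per_sum smooth_per_cmult smooth_per_CC)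
  then show "u \<in> H1 L a \<and> (\<exists>G. is_weak_grad L a u G \<and> vconv (\<lambda>N. grad (C.psum (C.coeff u) (box_index N))) G)"
    unfolding H1_def using u G by blast
qed (rule smooth_per_CC)

lemma psum_S_Dirichlet: "S.psum c B \<in> Dirichlet_smooth"
proof -
  have "S.psum c B \<in> smooth_per L"
    unfolding S.psum_def by (intro smooth_per_sum smooth_per_cmult smooth_per_SS)
  then show ?thesis by (simp add: S.psum_def SS_plates)
qed

text \<open>Partial sums of sines vanish at the plates, so their graph limit stays in the closure
  that defines the Dirichlet domain.\<close>

lemma L_D_modes: "(u, f) \<in> L_D L a \<longleftrightarrow> u \<in> L2 L a \<and> f \<in> L2 L a \<and> (\<forall>j. S.coeff f j = of_real (lam j) * S.coeff u j)"
  unfolding L_D_def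
proof (rule S.form_operator_modes)
  \<comment> \<open>Constant sequences put the sine modes themselves into the closure.\<close>
  have const: "l2conv (\<lambda>n. g) g" "vconv (\<lambda>n. grad g) (grad g)" if "g \<in> smooth_per L" for g
    using L2_smooth_per[OF that] vL2_nth[OF vL2_smooth[OF smooth_per_grad[OF that]]]
    by (auto simp: l2conv_def vconv_def L2_norm_def)
  have "SS j \<in> Dirichlet_smooth" for j by (simp add: smooth_per_SS SS_plates)
  then show "SS j \<in> H1_D L a" for j
    unfolding H1_D_def
    using graph_closure_grad(2)[OF Dirichlet_smooth_sub _ const(1)[OF smooth_per_SS] const(2)[OF smooth_per_SS]] by blast
  fix u f assume u: "u \<in> L2 L a" and f: "f \<in> L2 L a" and c: "\<And>j. S.coeff f j = of_real (lam j) * S.coeff u j"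
  have "sq_bounded (\<lambda>j. of_real (lam j) * S.coeff u j)"
    using S.sq_bounded_coeff[OF f] by (simp add: c[symmetric])
  then obtain G where G: "vconv (\<lambda>N. grad (S.psum (S.coeff u) (box_index N))) G"
    using grad_psum_S_conv[OF S.sq_bounded_coeff[OF u] _ S.adapted_coeff] by blast
  from graph_closure_grad(2)[OF Dirichlet_smooth_sub psum_S_Dirichlet S.expansion[OF u] G]
  show "u \<in> H1_D L a \<and> (\<exists>G. is_weak_grad L a u G \<and> vconv (\<lambda>N. grad (S.psum (S.coeff u) (box_index N))) G)"
    unfolding H1_D_def using G by blast
qed (use H1_D_weak Dirichlet_mode smooth_per_SS in blast)+

lemma CC_zero: "CC (0, 0, 0) = (\<lambda>p. of_real (nrm 0))"
  by (simp add: CC_def kx_def ky_def nu_def)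

text \<open>The constants are the multiples of the cosine mode with index (0,0,0).\<close>

lemma H_N'_modes: "u \<in> H_N' L a \<longleftrightarrow> u \<in> L2 L a \<and> C.coeff u (0, 0, 0) = 0"
proof -
  have e: "s_inner L a u (\<lambda>p. c) = cnj (c / of_real (nrm 0)) * C.coeff u (0, 0, 0)" for c
  proof -
    have "ip u (\<lambda>p. c) = cnj (ip (\<lambda>p. (c / of_real (nrm 0)) * CC (0,0,0) p) u)"
      using nrm_pos[of 0] by (simp add: CC_zero ip_cnj)
    also have "\<dots> = cnj (c / of_real (nrm 0)) * cnj (ip (CC (0,0,0)) u)"
      by (simp only: ip_cmult_left complex_cnj_mult)
    finally show ?thesis by (simp only: ip_cnj C.coeff_def)
  qed
  have "(\<forall>c. s_inner L a u (\<lambda>p. c) = 0) \<longleftrightarrow> C.coeff u (0,0,0) = 0"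
    unfolding e using nrm_pos[of 0] by (auto dest: spec[of _ 1])
  then show ?thesis by (simp add: H_N'_def)
qed

lemma L_N'_modes: "(u, f) \<in> L_N' L a \<longleftrightarrow> u \<in> H_N' L a \<and> f \<in> H_N' L a \<and> (\<forall>j. C.coeff f j = of_real (lam j) * C.coeff u j)"
  by (auto simp: L_N'_def L_N_modes H_N'_modes)

end

section \<open>The Maxwell operator\<close>

definition dot :: "complex ^ 3 \<Rightarrow> complex ^ 3 \<Rightarrow> complex" where
  "dot x y = (\<Sum>i\<in>UNIV. x $ i * cnj (y $ i))"

lemma dot_3: "dot x y = x $ 1 * cnj (y $ 1) + x $ 2 * cnj (y $ 2) + x $ 3 * cnj (y $ 3)"
  by (simp add: dot_def sum_3)

lemma dot_self_zero: "dot x x = 0 \<Longrightarrow> x = 0"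
proof -
  assume "dot x x = 0"
  have "dot x x = of_real (\<Sum>i\<in>UNIV. (norm (x $ i))\<^sup>2)"
    by (simp add: dot_def complex_norm_square del: of_real_power)
  with \<open>dot x x = 0\<close> have "(norm x)\<^sup>2 = 0"
    unfolding norm_vec_sq by (simp only: of_real_eq_0_iff)
  then show "x = 0" by simp
qed

context slab_domain
begin

text \<open>Parities fitted to a perfect conductor: the tangential components vanish at the plates,
  and every term of the divergence is a multiple of the same sine mode.\<close>

definition FF :: "index \<Rightarrow> complex ^ 3 \<Rightarrow> vfield" where
  "FF j x = (\<lambda>p. vector [x $ 1 * SS j p, x $ 2 * SS j p, x $ 3 * CC j p])"

text \<open>Fields of the opposite parities, which is where the curl sends \<open>FF\<close>
  fields.\<close>

definition GG :: "index \<Rightarrow> complex ^ 3 \<Rightarrow> vfield" where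
  "GG j x = (\<lambda>p. vector [x $ 1 * CC j p, x $ 2 * CC j p, x $ 3 * SS j p])"

definition rot :: "index \<Rightarrow> complex ^ 3 \<Rightarrow> complex ^ 3" where
  "rot j x = vector [\<i> * of_real (ky j) * x $ 3 - of_real (nu j) * x $ 2,
     of_real (nu j) * x $ 1 - \<i> * of_real (kx j) * x $ 3,
     \<i> * of_real (kx j) * x $ 2 - \<i> * of_real (ky j) * x $ 1]"

text \<open>The first equation says that \<open>FF j x\<close> is divergence-free, the second excludes \<open>h0\<close>.\<close>

definition adm :: "index \<Rightarrow> complex ^ 3 \<Rightarrow> bool" where
  "adm j x \<longleftrightarrow> of_real (kx j) * x $ 1 + of_real (ky j) * x $ 2 + \<i> * of_real (nu j) * x $ 3 = 0 \<and>
     (j = (0, 0, 0) \<longrightarrow> x $ 3 = 0)"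

lemma adm_lincomb: "adm j x \<Longrightarrow> adm j y \<Longrightarrow> adm j (c *s x + d *s y)"
proof -
  assume xy: "adm j x" "adm j y"
  have "of_real (kx j) * (c *s x + d *s y) $ 1 + of_real (ky j) * (c *s x + d *s y) $ 2 + \<i> * of_real (nu j) * (c *s x + d *s y) $ 3
    = c * (of_real (kx j) * x $ 1 + of_real (ky j) * x $ 2 + \<i> * of_real (nu j) * x $ 3)
    + d * (of_real (kx j) * y $ 1 + of_real (ky j) * y $ 2 + \<i> * of_real (nu j) * y $ 3)"
    by (simp add: algebra_simps)
  with xy show ?thesis by (simp add: adm_def)
qed

definition hat :: "vfield \<Rightarrow> index \<Rightarrow> complex ^ 3" where
  "hat E j = vector [S.coeff (\<lambda>p. E p $ 1) j, S.coeff (\<lambda>p. E p $ 2) j, C.coeff (\<lambda>p. E p $ 3) j]"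

abbreviation PEC :: "vfield set" where
  "PEC \<equiv> {E \<in> smooth_per_v L. \<forall>x y. \<forall>z\<in>{0, a}. E (x, y, z) $ 1 = 0 \<and> E (x, y, z) $ 2 = 0}"

lemma FF_nth [simp]: "FF j x p $ 1 = x $ 1 * SS j p" "FF j x p $ 2 = x $ 2 * SS j p" "FF j x p $ 3 = x $ 3 * CC j p"
  by (simp_all add: FF_def)

lemma GG_nth [simp]: "GG j x p $ 1 = x $ 1 * CC j p" "GG j x p $ 2 = x $ 2 * CC j p" "GG j x p $ 3 = x $ 3 * SS j p"
  by (simp_all add: GG_def)

lemma hat_nth [simp]: "hat E j $ 1 = S.coeff (\<lambda>p. E p $ 1) j" "hat E j $ 2 = S.coeff (\<lambda>p. E p $ 2) j"
    "hat E j $ 3 = C.coeff (\<lambda>p. E p $ 3) j"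
  by (simp_all add: hat_def)

lemma FF_cmult: "FF j (c *s x) = (\<lambda>p. c *s FF j x p)"
  by (simp add: fun_eq_iff vec_eq_iff forall_3)

lemma smooth_FF: "FF j x \<in> smooth_per_v L"
  by (simp add: smooth_per_v_iff smooth_per_cmult smooth_per_CC smooth_per_SS)

lemma curl_FF: "curl (FF j x) = GG j (rot j x)"
  by (simp add: fun_eq_iff vec_eq_iff forall_3 pd_cmult smooth_CC smooth_SS CC_pd SS_pd rot_def algebra_simps)

lemma curl_GG: "curl (GG j y) = FF j (vector [\<i> * of_real (ky j) * y $ 3 + of_real (nu j) * y $ 2,
     - of_real (nu j) * y $ 1 - \<i> * of_real (kx j) * y $ 3,
     \<i> * of_real (kx j) * y $ 2 - \<i> * of_real (ky j) * y $ 1])"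
  by (simp add: fun_eq_iff vec_eq_iff forall_3 pd_cmult smooth_CC smooth_SS CC_pd SS_pd algebra_simps)

text \<open>On divergence-free fields curl curl is minus the Laplacian; the divergence condition
  cancels the mixed products of wave numbers.\<close>

lemma curl_curl_FF:
  assumes "adm j x" shows "curl (curl (FF j x)) = FF j (of_real (lam j) *s x)"
proof -
  define k l n where "k = complex_of_real (kx j)" "l = complex_of_real (ky j)" "n = complex_of_real (nu j)"
  \<comment> \<open>The divergence condition solved for the term with the normal component;
    substituting it settles each of the three components.\<close>
  have e: "\<i> * n * x $ 3 = - (k * x $ 1 + l * x $ 2)"
    by (rule eq_neg_iff_add_eq_0[THEN iffD2]) (use assms in \<open>simp add: adm_def k_l_n_def add.commute\<close>)
  have lam: "complex_of_real (lam j) = k * k + l * l + n * n"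
    by (simp add: lam_def k_l_n_def power2_eq_square)
  have i: "\<i> * (\<i> * y) = - y" for y by (simp flip: mult.assoc)
  have 1: "\<i> * l * (\<i> * k * x $ 2 - \<i> * l * x $ 1) + n * (n * x $ 1 - \<i> * k * x $ 3) = (k * k + l * l + n * n) * x $ 1"
  proof -
    have "\<i> * l * (\<i> * k * x $ 2 - \<i> * l * x $ 1) + n * (n * x $ 1 - \<i> * k * x $ 3) =
        - l * k * x $ 2 + l * l * x $ 1 + n * n * x $ 1 - k * (\<i> * n * x $ 3)"
      by (simp add: algebra_simps i)
    then show ?thesis unfolding e by (simp add: algebra_simps)
  qed
  have 2: "- n * (\<i> * l * x $ 3 - n * x $ 2) - \<i> * k * (\<i> * k * x $ 2 - \<i> * l * x $ 1) = (k * k + l * l + n * n) * x $ 2"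
  proof -
    have "- n * (\<i> * l * x $ 3 - n * x $ 2) - \<i> * k * (\<i> * k * x $ 2 - \<i> * l * x $ 1) =
        - l * (\<i> * n * x $ 3) + n * n * x $ 2 + k * k * x $ 2 - k * l * x $ 1"
      by (simp add: algebra_simps i)
    then show ?thesis unfolding e by (simp add: algebra_simps)
  qed
  have 3: "\<i> * k * (n * x $ 1 - \<i> * k * x $ 3) - \<i> * l * (\<i> * l * x $ 3 - n * x $ 2) = (k * k + l * l + n * n) * x $ 3"
  proof -
    have "n * n * x $ 3 = - \<i> * n * (\<i> * n * x $ 3)" by (simp add: algebra_simps i)
    also have "\<dots> = \<i> * n * (k * x $ 1 + l * x $ 2)" unfolding e by (simp add: algebra_simps)
    finally have "n * n * x $ 3 = \<i> * n * (k * x $ 1 + l * x $ 2)" .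
    then show ?thesis by (simp add: algebra_simps i)
  qed
  show ?thesis
    unfolding curl_FF curl_GG rot_def k_l_n_def[symmetric] lam
    by (rule arg_cong[where f="FF j"]) (unfold vec_eq_iff forall_3 vector_3 vector_smult_component, intro conjI 1 2 3)
qed

lemma divergence_FF: "adm j x \<Longrightarrow> divergence (FF j x) = (\<lambda>p. 0)"
proof -
  assume x: "adm j x"
  have "divergence (FF j x) p = \<i> * (of_real (kx j) * x $ 1 + of_real (ky j) * x $ 2 + \<i> * of_real (nu j) * x $ 3) * SS j p" for p
    by (simp add: divergence_def pd_cmult smooth_CC smooth_SS CC_pd SS_pd algebra_simps)
  then show ?thesis using x by (simp add: adm_def fun_eq_iff)
qed

lemma FF_PEC: "FF j x \<in> PEC"
  by (simp add: smooth_FF SS_plates)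

lemma PEC_sub: "PEC \<subseteq> smooth_per_v L"
  by blast

lemma vconv_const: "E \<in> vL2 \<Longrightarrow> vconv (\<lambda>n. E) E"
  by (simp add: vconv_def l2conv_def vL2_nth) (simp add: L2_norm_def)

text \<open>In Green's identity the boundary term is absorbed by the test function, so the normal
  component of E may be nonzero at the plates.\<close>

lemma V_PEC_smooth:
  assumes E: "E \<in> PEC" and d: "divergence E = (\<lambda>p. 0)" shows "E \<in> V_PEC L a"
proof -
  have sE: "E \<in> smooth_per_v L" using E by blast
  have "E \<in> H0_curl L a"
    unfolding H0_curl_def
    using graph_closure_curl(2)[OF PEC_sub E vconv_const[OF vL2_smooth[OF sE]]
        vconv_const[OF vL2_smooth[OF smooth_per_curl[OF sE]]]] by blast
  moreover have "pairing L a E (grad f) = 0" if f: "f \<in> test L a" for f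
  proof -
    have "(\<integral>p. f p * divergence E p \<partial>M) = - pairing L a (grad f) E"
      by (rule Green_grad[OF test_smooth_per[OF f] sE]) (simp add: test_plates[OF f])
    moreover have "pairing L a (grad f) E = pairing L a E (grad f)"
      by (simp add: pairing_def mult.commute)
    ultimately show ?thesis by (simp add: d)
  qed
  ultimately show ?thesis by (simp add: V_PEC_def weak_div_free_def)
qed

lemma ip_cmult_right: "ip f (\<lambda>p. c * g p) = cnj c * ip f g"
  using ip_cmult_left[of c g f] ip_cnj[of "\<lambda>p. c * g p" f] ip_cnj[of g f] by (metis complex_cnj_mult)

lemma vip_FF: "E \<in> vL2 \<Longrightarrow> vip E (FF j x) = dot (hat E j) x"
  by (simp add: v_inner_sum vL2_smooth smooth_FF sum_3 dot_3 ip_cmult_right C.coeff_def S.coeff_def mult.commute)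

definition psumF :: "(index \<Rightarrow> complex ^ 3) \<Rightarrow> index set \<Rightarrow> vfield" where
  "psumF c B = (\<lambda>p. \<Sum>j\<in>B. FF j (c j) p)"

lemma psumF_nth: "(\<lambda>p. psumF c B p $ 1) = S.psum (\<lambda>j. c j $ 1) B" "(\<lambda>p. psumF c B p $ 2) = S.psum (\<lambda>j. c j $ 2) B"
   "(\<lambda>p. psumF c B p $ 3) = C.psum (\<lambda>j. c j $ 3) B"
  by (simp_all add: psumF_def S.psum_def C.psum_def sum_component)

lemma smooth_psumF: "psumF c B \<in> smooth_per_v L"
  unfolding psumF_def by (intro smooth_per_v_sum smooth_FF)

lemma psumF_PEC: "psumF c B \<in> PEC"
  using smooth_psumF[of c B] by (simp add: psumF_def sum_component SS_plates)

lemma psumF_V_PEC: "(\<And>j. adm j (c j)) \<Longrightarrow> psumF c B \<in> V_PEC L a"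
proof (rule V_PEC_smooth[OF psumF_PEC])
  assume "\<And>j. adm j (c j)"
  then show "divergence (psumF c B) = (\<lambda>p. 0)"
    unfolding psumF_def divergence_sum[OF smooth_FF] by (simp add: divergence_FF)
qed

lemma expansionF: "E \<in> vL2 \<Longrightarrow> vconv (\<lambda>N. psumF (hat E) (box_index N)) E"
  unfolding vconv_def forall_3 psumF_nth
  by (simp add: S.expansion C.expansion vL2_nth)

lemma vip_psumF: "W \<in> vL2 \<Longrightarrow> finite B \<Longrightarrow> vip (psumF c B) W = (\<Sum>j\<in>B. dot (c j) (hat W j))"
proof -
  assume W: "W \<in> vL2" and B: "finite B"
  have "vip (FF j x) W = dot x (hat W j)" for j x
    using vip_FF[OF W, of j x] vip_cnj[of W "FF j x"] by (simp add: dot_3 mult.commute)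
  then show ?thesis
    unfolding psumF_def using W B by (simp add: vip_sum_left vL2_smooth smooth_FF)
qed

lemma ParsevalF:
  assumes "E \<in> vL2" "W \<in> vL2"
  shows "(\<lambda>N. \<Sum>j\<in>box_index N. dot (hat E j) (hat W j)) \<longlonglongrightarrow> vip E W"
  using vconv_inner[OF expansionF[OF assms(1)] assms(2)] by (simp add: vip_psumF assms(2))

lemma AE_eq_if_hat_eq:
  assumes E: "E \<in> vL2" and F: "F \<in> vL2" and h: "\<And>j. hat E j = hat F j"
  shows "AE p in M. E p = F p"
proof -
  have h': "S.coeff (\<lambda>p. E p $ 1) j = S.coeff (\<lambda>p. F p $ 1) j" "S.coeff (\<lambda>p. E p $ 2) j = S.coeff (\<lambda>p. F p $ 2) j"
    "C.coeff (\<lambda>p. E p $ 3) j = C.coeff (\<lambda>p. F p $ 3) j" for j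
    using arg_cong[OF h[of j], of "\<lambda>x. x $ 1"] arg_cong[OF h[of j], of "\<lambda>x. x $ 2"] arg_cong[OF h[of j], of "\<lambda>x. x $ 3"]
    by simp_all
  have "AE p in M. E p $ 1 = F p $ 1" by (rule S.AE_eq_if_coeff_eq[OF vL2_nth[OF E] vL2_nth[OF F] h'(1)])
  moreover have "AE p in M. E p $ 2 = F p $ 2" by (rule S.AE_eq_if_coeff_eq[OF vL2_nth[OF E] vL2_nth[OF F] h'(2)])
  moreover have "AE p in M. E p $ 3 = F p $ 3" by (rule C.AE_eq_if_coeff_eq[OF vL2_nth[OF E] vL2_nth[OF F] h'(3)])
  ultimately show ?thesis by eventually_elim (simp add: vec_eq_iff forall_3)
qed

text \<open>\<open>nrm 0\<close> equals the normalising factor of \<open>h0\<close>, so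
  \<open>h0\<close> is itself the mode with index (0,0,0) and direction e_z.\<close>

lemma vip_h0: "E \<in> vL2 \<Longrightarrow> vip E (h0 L a) = hat E (0, 0, 0) $ 3"
proof -
  assume E: "E \<in> vL2"
  have "nrm 0 = 1 / sqrt (L\<^sup>2 * a)"
    by (simp add: nrm_def power2_eq_square real_sqrt_divide)
  then have "h0 L a = FF (0, 0, 0) (vector [0, 0, 1])"
    by (simp add: h0_def FF_def CC_zero SS_zero)
  then show ?thesis using vip_FF[OF E] by (simp add: dot_3)
qed

text \<open>Testing with \<open>\<chi>\<^sub>m SS\<close>, where \<open>\<chi>\<^sub>m\<close> are the cutoffs, turns the distributional condition into the
  algebraic one.\<close>

lemma weak_div_free_hat:
  assumes E: "E \<in> vL2" and d: "weak_div_free L a E"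
  shows "of_real (kx j) * hat E j $ 1 + of_real (ky j) * hat E j $ 2 + \<i> * of_real (nu j) * hat E j $ 3 = 0"
proof -
  define i where "i = neg j"
  have E': "(\<lambda>p. E p $ k) \<in> L2 L a" for k by (rule vL2_nth[OF E])
  have g: "grad (\<lambda>p. cut m p * SS i p) p $ 1 = \<i> * of_real (kx i) * (cut m p * SS i p)"
    "grad (\<lambda>p. cut m p * SS i p) p $ 2 = \<i> * of_real (ky i) * (cut m p * SS i p)"
    "grad (\<lambda>p. cut m p * SS i p) p $ 3 = of_real (nu i) * (cut m p * CC i p) + cut' m p * SS i p" for m p
    by (simp_all add: smooth_pd_mult smooth_cut smooth_SS cut_pd SS_pd)
  have "0 = \<i> * of_real (kx i) * (\<integral>p. E p $ 1 * (cut m p * SS i p) \<partial>M) + \<i> * of_real (ky i) * (\<integral>p. E p $ 2 * (cut m p * SS i p) \<partial>M)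
     + (of_real (nu i) * (\<integral>p. E p $ 3 * (cut m p * CC i p) \<partial>M) + (\<integral>p. E p $ 3 * (cut' m p * SS i p) \<partial>M))" for m
  proof -
    have t: "(\<lambda>p. cut m p * SS i p) \<in> test L a" by (intro cut_test smooth_per_SS)
    have gL: "grad (\<lambda>p. cut m p * SS i p) \<in> vL2" by (rule vL2_smooth[OF smooth_per_grad[OF test_smooth_per[OF t]]])
    have "0 = pairing L a E (grad (\<lambda>p. cut m p * SS i p))" using d t by (simp add: weak_div_free_def)
    also have "\<dots> = (\<integral>p. \<i> * of_real (kx i) * (E p $ 1 * (cut m p * SS i p)) \<partial>M) + (\<integral>p. \<i> * of_real (ky i) * (E p $ 2 * (cut m p * SS i p)) \<partial>M)
       + (\<integral>p. of_real (nu i) * (E p $ 3 * (cut m p * CC i p)) + E p $ 3 * (cut' m p * SS i p) \<partial>M)"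
      unfolding pairing_sum[OF E gL] sum_3 g by (simp add: algebra_simps)
    also have "\<dots> = \<i> * of_real (kx i) * (\<integral>p. E p $ 1 * (cut m p * SS i p) \<partial>M) + \<i> * of_real (ky i) * (\<integral>p. E p $ 2 * (cut m p * SS i p) \<partial>M)
       + (of_real (nu i) * (\<integral>p. E p $ 3 * (cut m p * CC i p) \<partial>M) + (\<integral>p. E p $ 3 * (cut' m p * SS i p) \<partial>M))"
    proof -
      have "integrable M (\<lambda>p. E p $ 3 * (cut m p * CC i p))" "integrable M (\<lambda>p. E p $ 3 * (cut' m p * SS i p))"
        by (intro integrable_mult_L2 E' L2_continuous smooth_continuous smooth_mult smooth_cut smooth_CC smooth_cut' smooth_SS)+
      then show ?thesis by simp
    qed
    finally show ?thesis .
  qed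
  moreover have "(\<lambda>m. \<i> * of_real (kx i) * (\<integral>p. E p $ 1 * (cut m p * SS i p) \<partial>M) + \<i> * of_real (ky i) * (\<integral>p. E p $ 2 * (cut m p * SS i p) \<partial>M)
     + (of_real (nu i) * (\<integral>p. E p $ 3 * (cut m p * CC i p) \<partial>M) + (\<integral>p. E p $ 3 * (cut' m p * SS i p) \<partial>M))) \<longlonglongrightarrow>
     \<i> * of_real (kx i) * (\<integral>p. E p $ 1 * SS i p \<partial>M) + \<i> * of_real (ky i) * (\<integral>p. E p $ 2 * SS i p \<partial>M)
     + (of_real (nu i) * (\<integral>p. E p $ 3 * CC i p \<partial>M) + 0)"
    by (intro tendsto_add tendsto_mult tendsto_const cut_limit cut'_limit E' smooth_per_CC smooth_per_SS)
  ultimately have "\<i> * of_real (kx i) * (\<integral>p. E p $ 1 * SS i p \<partial>M) + \<i> * of_real (ky i) * (\<integral>p. E p $ 2 * SS i p \<partial>M)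
     + of_real (nu i) * (\<integral>p. E p $ 3 * CC i p \<partial>M) = 0"
    by (simp add: LIMSEQ_const_iff)
  then have "\<i> * of_real (kx i) * hat E j $ 1 + \<i> * of_real (ky i) * hat E j $ 2 + of_real (nu i) * hat E j $ 3 = 0"
    by (simp add: C.coeff_def S.coeff_def s_inner_def cnj_CC cnj_SS i_def)
  \<comment> \<open>Multiplying by i and undoing the sign change of the lateral wave numbers under
    \<open>neg\<close> gives the equation in \<open>adm\<close>.\<close>
  then have "\<i> * (\<i> * of_real (kx i) * hat E j $ 1 + \<i> * of_real (ky i) * hat E j $ 2 + of_real (nu i) * hat E j $ 3) = 0"
    by simp
  then show ?thesis by (simp add: i_def algebra_simps flip: mult.assoc)
qed

section \<open>The physical space in terms of coefficients\<close>

lemma V_PEC_vL2: "E \<in> V_PEC L a \<Longrightarrow> E \<in> vL2"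
  by (simp add: V_PEC_def H0_curl_def norm_closure_def H_curl_def)

lemma V_PEC_H_PEC: "E \<in> V_PEC L a \<Longrightarrow> E \<in> H_PEC L a"
  unfolding H_PEC_def
  by (rule norm_closureI[where g="\<lambda>n. E"]) (simp_all add: V_PEC_vL2 L2_norm_def)

lemma H_phys_vL2: "E \<in> H_phys L a \<Longrightarrow> E \<in> vL2"
  by (simp add: H_phys_def H_PEC_def norm_closure_def)

text \<open>For a fixed test function the condition is continuous in L2, so it survives the closure
  defining \<open>H_PEC\<close>.\<close>

lemma H_phys_weak_div_free: "E \<in> H_phys L a \<Longrightarrow> weak_div_free L a E"
proof -
  assume EH: "E \<in> H_phys L a"
  then have E: "E \<in> vL2" "E \<in> norm_closure (L2_norm L a) (L2 L a) (V_PEC L a)"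
    by (simp_all add: H_phys_vL2) (simp add: H_phys_def H_PEC_def)
  obtain g where g: "\<And>n. g n \<in> V_PEC L a" and lim: "(\<lambda>n::nat. vnm (\<lambda>p. E p - g n p)) \<longlonglongrightarrow> 0"
    using norm_closureD(2)[OF E(2) vnm_nonneg] by blast
  have c: "vconv g E" by (rule vconv_if_vnm[OF V_PEC_vL2[OF g] E(1) lim])
  show ?thesis
    unfolding weak_div_free_def
  proof
    fix f assume f: "f \<in> test L a"
    have "(\<lambda>n. pairing L a (g n) (grad f)) \<longlonglongrightarrow> pairing L a E (grad f)"
      by (rule vconv_pairing[OF c vL2_smooth[OF smooth_per_grad[OF test_smooth_per[OF f]]]])
    moreover have "pairing L a (g n) (grad f) = 0" for n
      using g[of n] f by (simp add: V_PEC_def weak_div_free_def)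
    ultimately show "pairing L a E (grad f) = 0" by (simp add: LIMSEQ_const_iff)
  qed
qed

text \<open>For sufficiency, partial sums with admissible coefficients are smooth divergence-free
  PEC fields that converge in L2, which places the limit in \<open>H_PEC\<close>.\<close>

lemma H_phys_iff: "E \<in> H_phys L a \<longleftrightarrow> E \<in> vL2 \<and> (\<forall>j. adm j (hat E j))"
proof
  assume E: "E \<in> H_phys L a"
  have "hat E (0, 0, 0) $ 3 = 0"
    using E vip_h0[OF H_phys_vL2[OF E]] by (simp add: H_phys_def)
  then have "adm j (hat E j)" for j
    unfolding adm_def using weak_div_free_hat[OF H_phys_vL2[OF E] H_phys_weak_div_free[OF E], of j]
    by (intro conjI impI) simp_all
  with H_phys_vL2[OF E] show "E \<in> vL2 \<and> (\<forall>j. adm j (hat E j))" by blast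
next
  assume *: "E \<in> vL2 \<and> (\<forall>j. adm j (hat E j))"
  then have E: "E \<in> vL2" and adm: "\<And>j. adm j (hat E j)" by blast+
  have "E \<in> H_PEC L a"
    unfolding H_PEC_def
    by (rule norm_closureI[OF E psumF_V_PEC[of "hat E"] vnm_if_vconv[OF expansionF[OF E]]]) (rule adm)
  moreover have "vip E (h0 L a) = 0"
    unfolding vip_h0[OF E] using adm[of "(0,0,0)"] by (simp add: adm_def)
  ultimately show "E \<in> H_phys L a" by (simp add: H_phys_def)
qed

section \<open>The Maxwell form on modes\<close>

lemma V_phys_limit:
  assumes "E \<in> V_phys L a"
  obtains g where "\<And>n. g n \<in> PEC" "vconv g E" "vconv (\<lambda>n. curl (g n)) (weak_curl L a E)"
proof -
  have "E \<in> norm_closure (H_curl_norm L a) (H_curl L a) PEC"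
    using assms by (simp add: V_phys_def V_PEC_def H0_curl_def)
  from graph_closure_curl(1)[OF PEC_sub this] show thesis using that by blast
qed

lemma V_phys_weak_curl: "E \<in> V_phys L a \<Longrightarrow> is_weak_curl L a E (weak_curl L a E)"
  by (rule is_weak_curl_weak_curl) (simp add: V_phys_def V_PEC_def H0_curl_def norm_closure_def H_curl_def)

text \<open>The curl of a mode has cosine tangential components, which need not vanish at the
  plates, so the boundary term is removed by v: for approximating smooth PEC fields Green's identity
  moves the curl, and \<open>curl_curl_FF\<close> applies.\<close>

lemma weak_curl_mode:
  assumes v: "v \<in> V_phys L a" and x: "adm j x"
  shows "vip (weak_curl L a v) (curl (FF j x)) = of_real (lam j) * vip v (FF j x)"
proof -
  obtain g where g: "\<And>n. g n \<in> PEC" and lg: "vconv g v" and lc: "vconv (\<lambda>n. curl (g n)) (weak_curl L a v)"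
    using V_phys_limit[OF v] by blast
  have s: "curl (FF j x) \<in> smooth_per_v L" by (rule smooth_per_curl[OF smooth_FF])
  have "vip (curl (g n)) (curl (FF j x)) = of_real (lam j) * vip (g n) (FF j x)" for n
  proof -
    have gn: "g n \<in> smooth_per_v L" "\<And>x y z. z = 0 \<or> z = a \<Longrightarrow> g n (x, y, z) $ 1 = 0 \<and> g n (x, y, z) $ 2 = 0"
      using g[of n] by auto
    have "vip (curl (g n)) (curl (FF j x)) = pairing L a (g n) (curl (cnjv (curl (FF j x))))"
      unfolding vip_pairing by (rule Green_curl[OF gn(1) smooth_per_cnjv[OF s]]) (simp add: gn(2))
    also have "\<dots> = vip (g n) (FF j (of_real (lam j) *s x))"
      by (simp add: curl_cnjv[OF s] curl_curl_FF[OF x] vip_pairing)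
    also have "\<dots> = cnj (vip (\<lambda>p. of_real (lam j) *s FF j x p) (g n))"
      by (simp only: FF_cmult vip_cnj)
    also have "\<dots> = of_real (lam j) * vip (g n) (FF j x)"
      by (simp only: vip_cmult_left complex_cnj_mult vip_cnj complex_cnj_complex_of_real)
    finally show ?thesis .
  qed
  moreover have "(\<lambda>n. vip (curl (g n)) (curl (FF j x))) \<longlonglongrightarrow> vip (weak_curl L a v) (curl (FF j x))"
    by (rule vconv_inner[OF lc vL2_smooth[OF s]])
  moreover have "(\<lambda>n. of_real (lam j) * vip (g n) (FF j x)) \<longlonglongrightarrow> of_real (lam j) * vip v (FF j x)"
    by (intro tendsto_mult tendsto_const vconv_inner lg vL2_smooth smooth_FF)
  ultimately show ?thesis using LIMSEQ_unique by simp
qed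

lemma hat_FF: "hat (FF i x) j $ 3 = (if i = j then x $ 3 else 0)"
  by (simp add: C.coeff_def ip_cmult_left ip_CC)

lemma FF_V_phys: "adm j x \<Longrightarrow> FF j x \<in> V_phys L a"
proof -
  assume x: "adm j x"
  have V: "FF j x \<in> V_PEC L a" by (rule V_PEC_smooth[OF FF_PEC divergence_FF[OF x]])
  have "vip (FF j x) (h0 L a) = 0"
    unfolding vip_h0[OF vL2_smooth[OF smooth_FF]] hat_FF using x by (simp add: adm_def)
  then show ?thesis using V V_PEC_H_PEC[OF V] by (simp add: V_phys_def H_phys_def)
qed

lemma curl_psumF: "curl (psumF c B) = (\<lambda>p. \<Sum>j\<in>B. GG j (rot j (c j)) p)"
  unfolding psumF_def curl_sum[OF smooth_FF] curl_FF ..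

text \<open>The entries of \<open>rot\<close> combine coefficients with factors kx, ky and nu, all
  dominated by the square root of \<open>lam\<close>. The third component is a sine series, whence
  the condition for plate number 0.\<close>

lemma curl_psumF_conv:
  assumes c: "\<And>i. sq_bounded (\<lambda>j. c j $ i)" and d: "\<And>i. sq_bounded (\<lambda>j. of_real (lam j) * c j $ i)"
    and z: "\<And>j. snd (snd j) = 0 \<Longrightarrow> c j $ 1 = 0 \<and> c j $ 2 = 0"
  shows "\<exists>G. vconv (\<lambda>N. curl (psumF c (box_index N))) G"
proof -
  have g: "(\<lambda>p. curl (psumF c B) p $ 1) = C.psum (\<lambda>j. rot j (c j) $ 1) B"
    "(\<lambda>p. curl (psumF c B) p $ 2) = C.psum (\<lambda>j. rot j (c j) $ 2) B"
    "(\<lambda>p. curl (psumF c B) p $ 3) = S.psum (\<lambda>j. rot j (c j) $ 3) B" for B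
    unfolding curl_psumF C.psum_def S.psum_def by (simp_all add: sum_component)
  note b = sq_bounded_le_lam[OF c d]
  have m: "sq_bounded (\<lambda>j. - f j)" if "sq_bounded f" for f
    using that by (simp add: sq_bounded_def)
  have 1: "sq_bounded (\<lambda>j. rot j (c j) $ 1)"
    using sq_bounded_add[OF b[OF le_lam(2), of 3] b[OF le_lam(4), of 2]] by (simp add: rot_def)
  have 2: "sq_bounded (\<lambda>j. rot j (c j) $ 2)"
    using sq_bounded_add[OF b[OF le_lam(3), of 1] m[OF b[OF le_lam(1), of 3]]] by (simp add: rot_def)
  have 3: "sq_bounded (\<lambda>j. rot j (c j) $ 3)"
    using sq_bounded_add[OF b[OF le_lam(1), of 2] m[OF b[OF le_lam(2), of 1]]] by (simp add: rot_def)
  show ?thesis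
  proof (rule exI, rule vconv_vector, unfold g)
    show "l2conv (\<lambda>N. C.psum (\<lambda>j. rot j (c j) $ 1) (box_index N)) (C.syn (\<lambda>j. rot j (c j) $ 1))"
      by (rule l2conv_C[OF 1])
    show "l2conv (\<lambda>N. C.psum (\<lambda>j. rot j (c j) $ 2) (box_index N)) (C.syn (\<lambda>j. rot j (c j) $ 2))"
      by (rule l2conv_C[OF 2])
    show "l2conv (\<lambda>N. S.psum (\<lambda>j. rot j (c j) $ 3) (box_index N)) (S.syn (\<lambda>j. rot j (c j) $ 3))"
      by (rule l2conv_S[OF 3]) (simp add: rot_def z)
  qed
qed

lemma sq_bounded_hat: "E \<in> vL2 \<Longrightarrow> sq_bounded (\<lambda>j. hat E j $ i)"
proof -
  assume E: "E \<in> vL2"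
  have "\<forall>i. sq_bounded (\<lambda>j. hat E j $ i)"
    unfolding forall_3 hat_nth
    using S.sq_bounded_coeff[OF vL2_nth[OF E]] C.sq_bounded_coeff[OF vL2_nth[OF E]] by simp
  then show ?thesis by blast
qed

text \<open>As in the scalar case, except that only admissible directions may be tested. The defect,
  hat F minus \<open>lam\<close> times hat E, is itself admissible, so it serves as its own test
  vector and has length zero.\<close>

lemma L_Mx_modes:
  "(E, F) \<in> L_Mx L a \<longleftrightarrow> E \<in> H_phys L a \<and> F \<in> H_phys L a \<and> (\<forall>j. hat F j = of_real (lam j) *s hat E j)"
proof
  assume "(E, F) \<in> L_Mx L a"
  then have E: "E \<in> V_phys L a" and F: "F \<in> H_phys L a" and eq: "\<And>v. v \<in> V_phys L a \<Longrightarrow> q_Mx L a E v = vip F v"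
    by (auto simp: L_Mx_def form_operator_def)
  have EH: "E \<in> H_phys L a" using E by (simp add: V_phys_def)
  note EL = H_phys_vL2[OF EH] and FL = H_phys_vL2[OF F]
  have "hat F j = of_real (lam j) *s hat E j" for j
  proof -
    define d where "d = hat F j - of_real (lam j) *s hat E j"
    have "adm j (hat E j)" "adm j (hat F j)" using EH F by (simp_all add: H_phys_iff)
    then have "adm j ((- of_real (lam j)) *s hat E j + 1 *s hat F j)" by (rule adm_lincomb)
    moreover have "(- of_real (lam j)) *s hat E j + 1 *s hat F j = d"
      by (simp add: d_def vec_eq_iff)
    ultimately have d: "adm j d" by simp
    note V = FF_V_phys[OF d]
    have "dot (hat F j) d = q_Mx L a E (FF j d)" unfolding eq[OF V] vip_FF[OF FL] ..
    also have "\<dots> = vip (weak_curl L a E) (curl (FF j d))"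
      unfolding q_Mx_def
      by (rule vip_cong_AE_right[OF weak_curl_vL2[OF V_phys_weak_curl[OF E]] weak_curl_vL2[OF V_phys_weak_curl[OF V]]
            vL2_smooth[OF smooth_per_curl[OF smooth_FF]] weak_curl_unique[OF V_phys_weak_curl[OF V] weak_curl_smooth[OF smooth_FF]]])
    also have "\<dots> = of_real (lam j) * dot (hat E j) d"
      unfolding weak_curl_mode[OF E d] vip_FF[OF EL] ..
    finally have "dot d d = 0" by (simp add: d_def dot_3 algebra_simps)
    then show ?thesis using dot_self_zero[of d] by (simp add: d_def)
  qed
  with EH F show "E \<in> H_phys L a \<and> F \<in> H_phys L a \<and> (\<forall>j. hat F j = of_real (lam j) *s hat E j)" by blast
next
  assume *: "E \<in> H_phys L a \<and> F \<in> H_phys L a \<and> (\<forall>j. hat F j = of_real (lam j) *s hat E j)"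
  then have E: "E \<in> H_phys L a" and F: "F \<in> H_phys L a" and c: "\<And>j. hat F j = of_real (lam j) *s hat E j" by auto
  note EL = H_phys_vL2[OF E] and FL = H_phys_vL2[OF F]
  have adm: "\<And>j. adm j (hat E j)" using E by (simp add: H_phys_iff)
  have "sq_bounded (\<lambda>j. of_real (lam j) * hat E j $ i)" for i
    using sq_bounded_hat[OF FL, of i] unfolding c by simp
  then obtain G where G: "vconv (\<lambda>N. curl (psumF (hat E) (box_index N))) G"
    using curl_psumF_conv[of "hat E"] sq_bounded_hat[OF EL] S_coeff_0 by auto
  from graph_closure_curl(2)[OF PEC_sub psumF_PEC expansionF[OF EL] G]
  have H0: "E \<in> H0_curl L a" and w: "is_weak_curl L a E G" by (simp_all add: H0_curl_def)
  have V: "E \<in> V_phys L a"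
    using H0 H_phys_weak_div_free[OF E] E by (simp add: V_phys_def V_PEC_def)
  have "q_Mx L a E v = vip F v" if v: "v \<in> V_phys L a" for v
  proof -
    define W where "W = weak_curl L a v"
    have W: "W \<in> vL2" unfolding W_def by (rule weak_curl_vL2[OF V_phys_weak_curl[OF v]])
    have vL: "v \<in> vL2" using v by (simp add: V_phys_def H_phys_vL2)
    have "q_Mx L a E v = vip G W"
      unfolding q_Mx_def W_def[symmetric]
      by (rule vip_cong_AE[OF weak_curl_vL2[OF V_phys_weak_curl[OF V]] weak_curl_vL2[OF w] W
            weak_curl_unique[OF V_phys_weak_curl[OF V] w]])
    moreover have "(\<lambda>N. vip (curl (psumF (hat E) (box_index N))) W) \<longlonglongrightarrow> vip G W"
      by (rule vconv_inner[OF G W])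
    moreover have "vip (curl (psumF (hat E) (box_index N))) W = (\<Sum>j\<in>box_index N. dot (hat F j) (hat v j))" for N
    proof -
      have "vip (curl (psumF (hat E) (box_index N))) W = (\<Sum>j\<in>box_index N. vip (curl (FF j (hat E j))) W)"
        unfolding psumF_def curl_sum[OF smooth_FF]
        by (intro vip_sum_left W finite_box_index vL2_smooth smooth_per_curl smooth_FF)
      also have "\<dots> = (\<Sum>j\<in>box_index N. cnj (vip W (curl (FF j (hat E j)))))"
        by (simp only: vip_cnj)
      also have "\<dots> = (\<Sum>j\<in>box_index N. cnj (of_real (lam j) * dot (hat v j) (hat E j)))"
        unfolding W_def weak_curl_mode[OF v adm] vip_FF[OF vL] ..
      also have "\<dots> = (\<Sum>j\<in>box_index N. dot (hat F j) (hat v j))"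
        unfolding c by (simp add: dot_3 algebra_simps)
      finally show ?thesis .
    qed
    ultimately have "(\<lambda>N. \<Sum>j\<in>box_index N. dot (hat F j) (hat v j)) \<longlonglongrightarrow> q_Mx L a E v" by simp
    from LIMSEQ_unique[OF this ParsevalF[OF FL vL]] show ?thesis .
  qed
  with V F show "(E, F) \<in> L_Mx L a" by (simp add: L_Mx_def form_operator_def)
qed

section \<open>The unitary operator\<close>

text \<open>Transverse electric (\<open>pol_E\<close>) and transverse magnetic (\<open>pol_M\<close>) polarisations.  For vanishing lateral wave vector
  the two families are completed by the constant directions \<open>e\<^sub>x\<close> and \<open>e\<^sub>y\<close>.\<close>

definition kap :: "index \<Rightarrow> real" where "kap j = sqrt ((kx j)\<^sup>2 + (ky j)\<^sup>2)"

definition pol_E :: "index \<Rightarrow> complex ^ 3" where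
  "pol_E j = (if kap j = 0 then vector [1, 0, 0] else
     vector [- of_real (ky j / kap j), of_real (kx j / kap j), 0])"

definition pol_M :: "index \<Rightarrow> complex ^ 3" where
  "pol_M j = (if kap j = 0 then vector [0, 1, 0] else
     vector [of_real (nu j * kx j / (kap j * sqrt (lam j))), of_real (nu j * ky j / (kap j * sqrt (lam j))),
       \<i> * of_real (kap j / sqrt (lam j))])"

lemma i_mult_i: "\<i> * x * (\<i> * y) = - (x * y)"
proof -
  have "\<i> * x * (\<i> * y) = (\<i> * \<i>) * (x * y)" by (simp only: mult_ac)
  then show ?thesis by simp
qed

lemma kap_sq: "(kap j)\<^sup>2 = (kx j)\<^sup>2 + (ky j)\<^sup>2"
  by (simp add: kap_def)

lemma lam_kap: "lam j = (kap j)\<^sup>2 + (nu j)\<^sup>2"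
  by (simp add: lam_def kap_sq)

lemma kap_zero: "kap j = 0 \<Longrightarrow> kx j = 0 \<and> ky j = 0"
  using kap_sq[of j] by (simp add: sum_power2_eq_zero_iff)

lemma lam_pos: "kap j \<noteq> 0 \<Longrightarrow> lam j > 0"
  using zero_le_power2[of "nu j"] by (simp add: lam_kap add_pos_nonneg)

text \<open>Rests on kap^2 = kx^2 + ky^2 and lam = kap^2 + nu^2. All entries are real except the
  imaginary third entry of \<open>pol_M\<close>, so the products reduce to real identities.\<close>

lemma pol_orthonormal:
  "dot (pol_E j) (pol_E j) = 1" "dot (pol_M j) (pol_M j) = 1"
  "dot (pol_E j) (pol_M j) = 0" "dot (pol_M j) (pol_E j) = 0"
proof -
  consider "kap j = 0" | "kap j \<noteq> 0" by blast
  then have "dot (pol_E j) (pol_E j) = 1 \<and> dot (pol_M j) (pol_M j) = 1 \<and>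
    dot (pol_E j) (pol_M j) = 0 \<and> dot (pol_M j) (pol_E j) = 0"
  proof cases
    case 1
    then show ?thesis by (simp add: dot_3 pol_E_def pol_M_def)
  next
    case 2
    define s where "s = sqrt (lam j)"
    have s: "s > 0" "s\<^sup>2 = lam j" using lam_pos[OF 2] by (auto simp: s_def)
    have k: "kx j * kx j + ky j * ky j = kap j * kap j" using kap_sq[of j] by (simp add: power2_eq_square)
    have l: "s * s = kap j * kap j + nu j * nu j" using s lam_kap[of j] by (simp add: power2_eq_square)
    have E: "(ky j / kap j) * (ky j / kap j) + (kx j / kap j) * (kx j / kap j) = 1"
      using 2 k by (simp add: divide_simps)
    have "(nu j * kx j / (kap j * s)) * (nu j * kx j / (kap j * s)) + (nu j * ky j / (kap j * s)) * (nu j * ky j / (kap j * s))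
        = nu j * nu j * (kx j * kx j + ky j * ky j) / (kap j * kap j * (s * s))"
      by (simp add: add_divide_distrib[symmetric] algebra_simps)
    also have "\<dots> = nu j * nu j / (s * s)" unfolding k using 2 by simp
    finally have M: "(nu j * kx j / (kap j * s)) * (nu j * kx j / (kap j * s)) + (nu j * ky j / (kap j * s)) * (nu j * ky j / (kap j * s))
        + (kap j / s) * (kap j / s) = 1"
      using l s(1) 2 by (simp add: add_divide_distrib[symmetric])
    have EM: "- (ky j / kap j) * (nu j * kx j / (kap j * s)) + (kx j / kap j) * (nu j * ky j / (kap j * s)) = 0"
      by (simp add: algebra_simps)
    have "dot (pol_E j) (pol_E j) = of_real ((ky j / kap j) * (ky j / kap j) + (kx j / kap j) * (kx j / kap j))"
      using 2 by (simp add: dot_3 pol_E_def)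
    moreover have "dot (pol_M j) (pol_M j) = of_real ((nu j * kx j / (kap j * s)) * (nu j * kx j / (kap j * s)) + (nu j * ky j / (kap j * s)) * (nu j * ky j / (kap j * s))
        + (kap j / s) * (kap j / s))"
      using 2 by (simp add: dot_3 pol_M_def s_def[symmetric] i_mult_i)
    moreover have "dot (pol_E j) (pol_M j) = of_real (- (ky j / kap j) * (nu j * kx j / (kap j * s)) + (kx j / kap j) * (nu j * ky j / (kap j * s)))"
      "dot (pol_M j) (pol_E j) = of_real (- (ky j / kap j) * (nu j * kx j / (kap j * s)) + (kx j / kap j) * (nu j * ky j / (kap j * s)))"
      using 2 by (simp_all add: dot_3 pol_E_def pol_M_def s_def[symmetric])
    ultimately show ?thesis unfolding E M EM by simp
  qed
  then show "dot (pol_E j) (pol_E j) = 1" "dot (pol_M j) (pol_M j) = 1"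
    "dot (pol_E j) (pol_M j) = 0" "dot (pol_M j) (pol_E j) = 0" by blast+
qed

text \<open>Bounded entries keep coefficient families square-summable when they are multiplied by a
  polarisation vector.\<close>

lemma unit_nth_le: "dot x x = 1 \<Longrightarrow> norm (x $ i) \<le> 1"
proof -
  assume x: "dot x x = 1"
  have "dot x x = of_real (\<Sum>i\<in>UNIV. (norm (x $ i))\<^sup>2)"
    by (simp add: dot_def complex_norm_square del: of_real_power)
  with x have "of_real (\<Sum>i\<in>UNIV. (norm (x $ i))\<^sup>2) = (1::complex)" by simp
  then have "(norm x)\<^sup>2 = 1" by (simp only: norm_vec_sq of_real_eq_1_iff)
  then show ?thesis
    using Finite_Cartesian_Product.norm_nth_le[of x i] by (simp add: power2_eq_1_iff) (use norm_ge_zero[of x] in linarith)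
qed

lemma pol_le: "norm (pol_E j $ i) \<le> 1" "norm (pol_M j $ i) \<le> 1"
  using unit_nth_le pol_orthonormal by blast+

lemma index_zero: "kap j = 0 \<Longrightarrow> nu j = 0 \<Longrightarrow> j = (0, 0, 0)"
  using kap_zero[of j] L a by (cases j) (simp add: kx_def ky_def nu_def)

text \<open>For vanishing lateral wave vector the condition constrains the normal entry, which is 0
  in both vectors. Otherwise the tangential part of \<open>pol_M\<close> contributes nu kap / sqrt
  lam, which its normal part cancels.\<close>

lemma adm_pol: "adm j (pol_E j)" "adm j (pol_M j)"
proof -
  have z: "kap (0,0,0) = 0" by (simp add: kap_def kx_def ky_def)
  show "adm j (pol_E j)"
    using kap_zero[of j] z by (auto simp: adm_def pol_E_def)
  show "adm j (pol_M j)"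
  proof (cases "kap j = 0")
    case False
    define s where "s = sqrt (lam j)"
    have k: "kx j * kx j + ky j * ky j = kap j * kap j" using kap_sq[of j] by (simp add: power2_eq_square)
    have "kx j * (nu j * kx j / (kap j * s)) + ky j * (nu j * ky j / (kap j * s)) = nu j * (kx j * kx j + ky j * ky j) / (kap j * s)"
      by (simp add: add_divide_distrib[symmetric] algebra_simps)
    also have "\<dots> = nu j * (kap j / s)" unfolding k using False by simp
    finally have "complex_of_real (kx j * (nu j * kx j / (kap j * s)) + ky j * (nu j * ky j / (kap j * s))) = of_real (nu j * (kap j / s))"
      by simp
    moreover have "\<i> * complex_of_real (nu j) * (\<i> * of_real (kap j / s)) = - of_real (nu j * (kap j / s))"
      by (simp add: i_mult_i)
    ultimately have "of_real (kx j) * pol_M j $ 1 + of_real (ky j) * pol_M j $ 2 + \<i> * of_real (nu j) * pol_M j $ 3 = 0"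
      using False by (simp add: pol_M_def s_def[symmetric])
    then show ?thesis using False z by (auto simp: adm_def)
  qed (use kap_zero[of j] in \<open>auto simp: adm_def pol_M_def\<close>)
qed

text \<open>An admissible vector is orthogonal to the nonzero vector \<open>(k\<^sub>x, k\<^sub>y, -i\<nu>)\<close>, as are both
  polarisation vectors, so it is determined by its components along these two.\<close>

lemma adm_orthogonal_zero:
  assumes x: "adm j x" and E: "dot x (pol_E j) = 0" and M: "dot x (pol_M j) = 0"
  shows "x = 0"
proof (cases "kap j = 0")
  case True
  then have "x $ 1 = 0" "x $ 2 = 0" using E M by (simp_all add: dot_3 pol_E_def pol_M_def)
  moreover have "x $ 3 = 0"
    using x kap_zero[OF True] index_zero[OF True] by (cases "nu j = 0") (auto simp: adm_def)
  ultimately show ?thesis by (simp add: vec_eq_iff forall_3)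
next
  case False
  define k l n \<kappa> s where "k = complex_of_real (kx j)" "l = complex_of_real (ky j)" "n = complex_of_real (nu j)"
    "\<kappa> = complex_of_real (kap j)" "s = complex_of_real (sqrt (lam j))"
  have nz: "\<kappa> \<noteq> 0" "s \<noteq> 0" using False lam_pos[OF False] by (simp_all add: k_l_n_\<kappa>_s_def)
  have cn: "cnj k = k" "cnj l = l" "cnj n = n" "cnj \<kappa> = \<kappa>" "cnj s = s"
    by (simp_all add: k_l_n_\<kappa>_s_def)
  have kk: "k * k + l * l = \<kappa> * \<kappa>"
  proof -
    have "kx j * kx j + ky j * ky j = kap j * kap j" using kap_sq[of j] by (simp add: power2_eq_square)
    then show ?thesis unfolding k_l_n_\<kappa>_s_def by (simp only: of_real_add[symmetric] of_real_mult[symmetric])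
  qed
  have ss: "\<kappa> * \<kappa> + n * n \<noteq> 0"
  proof -
    have "kap j * kap j + nu j * nu j \<noteq> 0" using lam_pos[OF False] lam_kap[of j] False by (simp add: power2_eq_square)
    then show ?thesis unfolding k_l_n_\<kappa>_s_def by (simp only: of_real_add[symmetric] of_real_mult[symmetric] of_real_eq_0_iff not_False_eq_True)
  qed
  have e1: "k * x $ 1 + l * x $ 2 = - \<i> * n * x $ 3"
    using x by (simp add: adm_def k_l_n_\<kappa>_s_def eq_neg_iff_add_eq_0)
  have "(- l * x $ 1 + k * x $ 2) / \<kappa> = 0"
    using E False by (simp add: dot_3 pol_E_def k_l_n_\<kappa>_s_def diff_divide_distrib mult.commute)
  then have e2: "k * x $ 2 = l * x $ 1" using nz by simp
  have "(n * (k * x $ 1 + l * x $ 2) - \<i> * \<kappa> * \<kappa> * x $ 3) / (\<kappa> * s) = 0"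
  proof -
    have "(n * (k * x $ 1 + l * x $ 2) - \<i> * \<kappa> * \<kappa> * x $ 3) / (\<kappa> * s) = dot x (pol_M j)"
      using False nz by (simp add: dot_3 pol_M_def k_l_n_\<kappa>_s_def[symmetric] cn add_divide_distrib diff_divide_distrib algebra_simps)
    then show ?thesis using M by simp
  qed
  then have "n * (k * x $ 1 + l * x $ 2) = \<i> * \<kappa> * \<kappa> * x $ 3" using nz by simp
  \<comment> \<open>Eliminating the tangential part through the divergence condition leaves a
    nonzero multiple of the normal entry.\<close>
  then have "\<i> * \<kappa> * \<kappa> * x $ 3 - n * (- \<i> * n * x $ 3) = 0" unfolding e1 by simp
  then have "\<i> * (\<kappa> * \<kappa> + n * n) * x $ 3 = 0" by (simp add: algebra_simps)
  then have x3: "x $ 3 = 0" using ss by simp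
  \<comment> \<open>Multiplying by k^2 + l^2 = kap^2 expresses each tangential entry through k x1 +
    l x2, which is now 0.\<close>
  have "(k * k + l * l) * x $ 1 = k * (k * x $ 1) + l * (k * x $ 2)" unfolding e2 by (simp add: algebra_simps)
  also have "\<dots> = k * (k * x $ 1 + l * x $ 2)" by (simp add: algebra_simps)
  finally have x1: "x $ 1 = 0" using x3 nz unfolding e1 kk by simp
  have "(k * k + l * l) * x $ 2 = k * (k * x $ 2) + l * (l * x $ 2)" by (simp add: algebra_simps)
  also have "\<dots> = l * (k * x $ 1 + l * x $ 2)" unfolding e2 by (simp add: algebra_simps)
  finally have x2: "x $ 2 = 0" using x3 nz unfolding e1 kk by simp
  show ?thesis using x1 x2 x3 by (simp add: vec_eq_iff forall_3)
qed

lemma dot_lincomb_left: "dot (c *s x + d *s y) z = c * dot x z + d * dot y z"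
  by (simp add: dot_3 algebra_simps)

lemma dot_lincomb_right: "dot z (c *s x + d *s y) = cnj c * dot z x + cnj d * dot z y"
  by (simp add: dot_3 algebra_simps)

lemma adm_expansion:
  assumes "adm j x" shows "x = dot x (pol_E j) *s pol_E j + dot x (pol_M j) *s pol_M j"
proof -
  let ?y = "dot x (pol_E j) *s pol_E j + dot x (pol_M j) *s pol_M j"
  have s: "x - ?y = 1 *s x + (-1) *s ?y" by (simp add: vec_eq_iff)
  have "adm j (x - ?y)" unfolding s by (intro adm_lincomb assms adm_pol)
  moreover have "dot (x - ?y) (pol_E j) = 0" "dot (x - ?y) (pol_M j) = 0"
    unfolding s dot_lincomb_left by (simp_all add: pol_orthonormal)
  ultimately have "x - ?y = 0" by (rule adm_orthogonal_zero)
  then show ?thesis by simp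
qed

section \<open>From pairs of scalar functions to physical fields\<close>

definition Ucoeff :: "sfield \<times> sfield \<Rightarrow> index \<Rightarrow> complex ^ 3" where
  "Ucoeff w j = S.coeff (fst w) j *s pol_E j + C.coeff (snd w) j *s pol_M j"

definition U :: "sfield \<times> sfield \<Rightarrow> vfield" where
  "U w = (\<lambda>p. vector [S.syn (\<lambda>j. Ucoeff w j $ 1) p, S.syn (\<lambda>j. Ucoeff w j $ 2) p, C.syn (\<lambda>j. Ucoeff w j $ 3) p])"

lemma Ucoeff_dot: "dot (Ucoeff w j) (pol_E j) = S.coeff (fst w) j" "dot (Ucoeff w j) (pol_M j) = C.coeff (snd w) j"
  unfolding Ucoeff_def dot_lincomb_left by (simp_all add: pol_orthonormal)

text \<open>The tangential components are synthesised from sines, so their coefficients must vanish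
  for plate number 0. There the Dirichlet coefficient is 0 and, for nonzero lateral wave vector, the
  tangential entries of \<open>pol_M\<close> carry the factor nu. At index (0,0,0)
  \<open>pol_M\<close> is e_y, but its coefficient is the constant mode excluded by
  \<open>H_N'\<close>.\<close>

lemma U_props:
  assumes "w \<in> L2 L a \<times> H_N' L a"
  shows "U w \<in> vL2" "hat (U w) j = Ucoeff w j"
proof -
  obtain u v where w: "w = (u, v)" by (cases w)
  have u: "u \<in> L2 L a" and v: "v \<in> L2 L a" and v0: "C.coeff v (0, 0, 0) = 0"
    using assms by (auto simp: w H_N'_modes)
  have b: "sq_bounded (\<lambda>j. Ucoeff w j $ i)" for i
    unfolding Ucoeff_def w fst_conv snd_conv vector_add_component vector_smult_component
    by (intro sq_bounded_add sq_bounded_mult S.sq_bounded_coeff C.sq_bounded_coeff u v pol_le)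
  have z: "Ucoeff w j $ 1 = 0 \<and> Ucoeff w j $ 2 = 0" if n: "snd (snd j) = 0" for j
  proof (cases "kap j = 0")
    case True
    then have "j = (0, 0, 0)" using nu_zero[OF n] by (rule index_zero)
    then show ?thesis using S_coeff_0[OF n, of u] v0 by (simp add: Ucoeff_def w)
  next
    case False
    then show ?thesis using S_coeff_0[OF n, of u] nu_zero[OF n] by (simp add: Ucoeff_def w pol_M_def)
  qed
  have S: "S.adapted (\<lambda>j. Ucoeff w j $ 1)" "S.adapted (\<lambda>j. Ucoeff w j $ 2)" using z by (simp_all add: S_adapted_iff)
  note s1 = S.syn[OF S(1) b] and s2 = S.syn[OF S(2) b] and s3 = C.syn[OF C_adapted b, of 3]
  show "U w \<in> vL2" unfolding vL2_iff forall_3 U_def by (simp add: s1 s2 s3)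
  show "hat (U w) j = Ucoeff w j" unfolding vec_eq_iff forall_3 hat_nth by (simp add: U_def s1 s2 s3)
qed

lemma U_H_phys: "w \<in> L2 L a \<times> H_N' L a \<Longrightarrow> U w \<in> H_phys L a"
  unfolding H_phys_iff by (simp add: U_props) (simp add: Ucoeff_def adm_lincomb adm_pol)

lemma U_inner:
  assumes w: "w \<in> L2 L a \<times> H_N' L a" and w': "w' \<in> L2 L a \<times> H_N' L a"
  shows "vip (U w) (U w') = ip (fst w) (fst w') + ip (snd w) (snd w')"
proof -
  have f: "fst w \<in> L2 L a" "fst w' \<in> L2 L a" "snd w \<in> L2 L a" "snd w' \<in> L2 L a"
    using w w' by (auto simp: H_N'_modes)
  have "dot (Ucoeff w j) (Ucoeff w' j) = S.coeff (fst w) j * cnj (S.coeff (fst w') j) + C.coeff (snd w) j * cnj (C.coeff (snd w') j)" for j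
    unfolding Ucoeff_def dot_lincomb_left dot_lincomb_right by (simp add: pol_orthonormal)
  then have "(\<lambda>N. (\<Sum>j\<in>box_index N. S.coeff (fst w) j * cnj (S.coeff (fst w') j)) +
      (\<Sum>j\<in>box_index N. C.coeff (snd w) j * cnj (C.coeff (snd w') j))) \<longlonglongrightarrow> vip (U w) (U w')"
    using ParsevalF[OF U_props(1)[OF w] U_props(1)[OF w']] by (simp add: U_props(2) w w' sum.distrib)
  moreover have "(\<lambda>N. (\<Sum>j\<in>box_index N. S.coeff (fst w) j * cnj (S.coeff (fst w') j)) +
      (\<Sum>j\<in>box_index N. C.coeff (snd w) j * cnj (C.coeff (snd w') j))) \<longlonglongrightarrow> ip (fst w) (fst w') + ip (snd w) (snd w')"
    by (intro tendsto_add S.Parseval C.Parseval f)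
  ultimately show ?thesis by (rule LIMSEQ_unique)
qed

lemma H_N'_lincomb: "v \<in> H_N' L a \<Longrightarrow> v' \<in> H_N' L a \<Longrightarrow> (\<lambda>q. c * v q + d * v' q) \<in> H_N' L a"
  by (simp add: H_N'_modes L2_add L2_cmult C.coeff_add)

lemma U_linear:
  assumes u: "u \<in> L2 L a" "u' \<in> L2 L a" and v: "v \<in> H_N' L a" "v' \<in> H_N' L a"
  shows "AE p in M. U (\<lambda>q. c * u q + d * u' q, \<lambda>q. c * v q + d * v' q) p = c *s U (u, v) p + d *s U (u', v') p"
proof -
  let ?w = "(\<lambda>q. c * u q + d * u' q, \<lambda>q. c * v q + d * v' q)"
  have vL: "v \<in> L2 L a" "v' \<in> L2 L a" using v by (simp_all add: H_N'_modes)
  have w: "(u, v) \<in> L2 L a \<times> H_N' L a" "(u', v') \<in> L2 L a \<times> H_N' L a" "?w \<in> L2 L a \<times> H_N' L a"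
    using u v H_N'_lincomb by (simp_all add: L2_add L2_cmult)
  note n = vL2_nth[OF U_props(1)[OF w(1)]] vL2_nth[OF U_props(1)[OF w(2)]]
  let ?R = "\<lambda>p. c *s U (u, v) p + d *s U (u', v') p"
  have R: "?R \<in> vL2"
    unfolding vL2_iff vector_add_component vector_smult_component by (intro allI L2_add L2_cmult n)
  have "hat (U ?w) j = hat ?R j" for j
  proof -
    have "hat ?R j = c *s hat (U (u, v)) j + d *s hat (U (u', v')) j"
      unfolding vec_eq_iff forall_3 hat_nth vector_add_component vector_smult_component
      by (simp add: S.coeff_add C.coeff_add n)
    also have "\<dots> = Ucoeff ?w j"
      unfolding U_props(2)[OF w(1)] U_props(2)[OF w(2)]
      by (simp add: Ucoeff_def vec_eq_iff S.coeff_add C.coeff_add u vL algebra_simps)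
    finally show ?thesis by (simp add: U_props(2)[OF w(3)])
  qed
  from AE_eq_if_hat_eq[OF U_props(1)[OF w(3)] R this] show ?thesis .
qed

text \<open>\<open>U\<close> is built from coefficients alone, so arguments equal almost everywhere
  have identical images.\<close>

lemma U_cong_AE:
  fixes u u' v v' :: sfield
  assumes "u \<in> L2 L a" "u' \<in> L2 L a" "v \<in> H_N' L a" "v' \<in> H_N' L a"
    and "AE p in M. u p = u' p" "AE p in M. v p = v' p"
  shows "U (u, v) = U (u', v')"
proof -
  have "Ucoeff (u, v) = Ucoeff (u', v')"
    using S.coeff_cong_AE[OF assms(1,2,5)] C.coeff_cong_AE[OF _ _ assms(6)] assms(3,4)
    by (simp add: fun_eq_iff Ucoeff_def H_N'_modes)
  then show ?thesis by (simp add: U_def)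
qed

text \<open>The coefficients of the preimage are the components along the two polarisations; by
  \<open>adm_expansion\<close> they determine an admissible vector completely.\<close>

lemma U_surj:
  assumes E: "E \<in> H_phys L a"
  shows "\<exists>w\<in>L2 L a \<times> H_N' L a. AE p in M. U w p = E p"
proof -
  have EL: "E \<in> vL2" and adm: "\<And>j. adm j (hat E j)" using E by (simp_all add: H_phys_iff)
  define c d where "c j = dot (hat E j) (pol_E j)" and "d j = dot (hat E j) (pol_M j)" for j
  have b: "sq_bounded c" "sq_bounded d"
    unfolding c_def d_def dot_3
    by (intro sq_bounded_add sq_bounded_mult sq_bounded_hat EL; simp add: pol_le)+
  \<comment> \<open>\<open>pol_E\<close> has zero normal entry, so c j involves only sine
    coefficients, which vanish for plate number 0.\<close>
  have cz: "c j = 0" if n: "snd (snd j) = 0" for j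
    using S_coeff_0[OF n] by (simp add: c_def dot_3 pol_E_def)
  have kz: "kap (0,0,0) = 0" by (simp add: kap_def kx_def ky_def)
  \<comment> \<open>At this index \<open>pol_M\<close> is e_y, hence again only a sine coefficient
    enters.\<close>
  have dz: "d (0, 0, 0) = 0"
    using S_coeff_0[of "(0,0,0)"] by (simp add: d_def dot_3 pol_M_def kz)
  define u v where "u = S.syn c" and "v = C.syn d"
  have "S.adapted c" using cz by (simp add: S_adapted_iff)
  note s = S.syn[OF this b(1), folded u_def] C.syn[OF C_adapted b(2), folded v_def]
  have w: "(u, v) \<in> L2 L a \<times> H_N' L a"
    using s dz by (simp add: H_N'_modes)
  have "hat (U (u, v)) j = hat E j" for j
    using adm_expansion[OF adm[of j]] by (simp add: U_props(2)[OF w] Ucoeff_def s c_def d_def)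
  from AE_eq_if_hat_eq[OF U_props(1)[OF w] EL this] w show ?thesis by blast
qed

lemma unitary_U: "unitary_sum L a (L2 L a) (H_N' L a) (H_phys L a) U"
  unfolding unitary_sum_def
proof (intro conjI ballI allI impI)
  show "U w \<in> H_phys L a" if "w \<in> L2 L a \<times> H_N' L a" for w
    using that by (rule U_H_phys)
  show "\<exists>w\<in>L2 L a \<times> H_N' L a. AE p in M. U w p = E p" if "E \<in> H_phys L a" for E
    using that by (rule U_surj)
  fix u v u' v' :: sfield assume m: "u \<in> L2 L a" "v \<in> H_N' L a" "u' \<in> L2 L a" "v' \<in> H_N' L a"
  show "AE p in M. U (u, v) p = U (u', v') p"
    if "(AE p in M. u p = u' p) \<and> (AE p in M. v p = v' p)"
    using U_cong_AE[OF m(1,3,2,4)] that by simp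
  show "AE p in M. U (\<lambda>q. c * u q + d * u' q, \<lambda>q. c * v q + d * v' q) p = c *s U (u, v) p + d *s U (u', v') p" for c d
    by (rule U_linear[OF m(1,3,2,4)])
  show "vip (U (u, v)) (U (u', v')) = ip u u' + ip v v'"
    using U_inner[of "(u, v)" "(u', v')"] m by simp
qed

text \<open>All graphs are multiplication by \<open>lam\<close> on coefficients, and the
  polarisations are orthonormal at each index. The equivalence also matches the operator domains,
  beyond intertwining on one of them.\<close>

lemma U_intertwines:
  assumes w: "w \<in> L2 L a \<times> H_N' L a" and g: "g \<in> L2 L a \<times> H_N' L a"
  shows "(w, g) \<in> op_sum (L_D L a) (L_N' L a) \<longleftrightarrow> (U w, U g) \<in> L_Mx L a"
proof -
  have "(w, g) \<in> op_sum (L_D L a) (L_N' L a) \<longleftrightarrow>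
      (\<forall>j. S.coeff (fst g) j = of_real (lam j) * S.coeff (fst w) j \<and> C.coeff (snd g) j = of_real (lam j) * C.coeff (snd w) j)"
    using w g by (cases w; cases g) (auto simp: op_sum_def L_D_modes L_N'_modes)
  also have "\<dots> \<longleftrightarrow> (\<forall>j. Ucoeff g j = of_real (lam j) *s Ucoeff w j)"
  proof (intro iff_allI iffI)
    fix j
    show "Ucoeff g j = of_real (lam j) *s Ucoeff w j"
      if "S.coeff (fst g) j = of_real (lam j) * S.coeff (fst w) j \<and> C.coeff (snd g) j = of_real (lam j) * C.coeff (snd w) j"
      using that by (simp add: Ucoeff_def vec_eq_iff algebra_simps)
    assume "Ucoeff g j = of_real (lam j) *s Ucoeff w j"
    \<comment> \<open>Orthonormality recovers both scalar coefficients from \<open>Ucoeff\<close>;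
      the zero summand gives the equation the shape of \<open>dot_lincomb_left\<close>.\<close>
    then have "Ucoeff g j = of_real (lam j) *s Ucoeff w j + 0 *s Ucoeff w j" by simp
    then have "dot (Ucoeff g j) z = of_real (lam j) * dot (Ucoeff w j) z" for z
      by (simp only: dot_lincomb_left) simp
    from this[of "pol_E j"] this[of "pol_M j"]
    show "S.coeff (fst g) j = of_real (lam j) * S.coeff (fst w) j \<and> C.coeff (snd g) j = of_real (lam j) * C.coeff (snd w) j"
      by (simp add: Ucoeff_dot)
  qed
  also have "\<dots> \<longleftrightarrow> (U w, U g) \<in> L_Mx L a"
    using U_H_phys w g by (simp add: L_Mx_modes U_props(2))
  finally show ?thesis .
qed

end

theorem mainTheorem2:
  fixes L a :: real
  assumes "L > 0" and "a > 0"
  shows "\<exists>U :: sfield \<times> sfield \<Rightarrow> vfield.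
           unitary_sum L a (L2 L a) (H_N' L a) (H_phys L a) U \<and>
           (\<forall>w \<in> L2 L a \<times> H_N' L a. \<forall>g \<in> L2 L a \<times> H_N' L a.
              (w, g) \<in> op_sum (L_D L a) (L_N' L a) \<longleftrightarrow> (U w, U g) \<in> L_Mx L a)"
proof -
  interpret slab_domain L a by unfold_locales (use assms in auto)
  show ?thesis using unitary_U U_intertwines by blast
qed

end
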